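(* Let $n=3$, $1<p<\infty$, $\lambda_0>0$ and $v_0(x)=\lambda_0(x_1,x_2,-2x_3)$, which is a divergence-free element of $\mathscr L^1_{1(p,1)}(\mathbb R^3)$ with $v_0(0)=0$. Consider the unique solution $v$ of the Euler equations $\partial_tv+(v\cdot\nabla)v=-\nabla\pi$, $\nabla\cdot v=0$, $v(\cdot,0)=v_0$ with $v(0,t)=0$ and pressure satisfying $\nabla\pi=\nabla\Pi(v,v)$. It has the form $v(x,t)=\operatorname{diag}(\lambda_1(t),\lambda_2(t),\lambda_3(t))\,x$ with $$\dot\lambda_i+\lambda_i^2=\tfrac13|\lambda|^2\quad\text{in }(0,T_* ),\quad i=1,2,3,\qquad |\lambda|^2=\lambda_1^2+\lambda_2^2+\lambda_3^2,$$ where $T_*$ is the maximal time of existence, and $\lambda_1=\lambda_2=\lambda$, $\lambda_3=-2\lambda$, where $\lambda$ solves the Riccati equation $$\dot\lambda=\tfrac13\lambda^2\quad\text{in }(0,T_* ),\qquad \lambda(0)=\lambda_0,$$ which has the unique solution $$\lambda(t)=\frac{3\lambda_0}{\lambda(0)t-3},\quad t\in(0,T_* ),\qquad T_*=\frac{3}{\lambda(0)}.$$ In particular the solution $v$ blows up at the finite time $T_*$.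
   Context: Notation. $B(x_0,r)$ is the ball of radius $r$ centered at $x_0$, $B(r)=B(0,r)$. $\mathcal P_N$ is the space of polynomials on $\mathbb R^n$ of degree $\le N$. For $f\in L^p_{loc}(\mathbb R^n)$, $\operatorname{osc}_{p,N}(f;x_0,r)=|B(r)|^{-1/p}\inf_{P\in\mathcal P_N}\|f-P\|_{L^p(B(x_0,r))}$. The space $\mathscr L^{1}_{1(p,1)}(\mathbb R^n)$ consists of all $f\in L^p_{loc}(\mathbb R^n)$ (componentwise for vector fields) with finite seminorm $|f|_{\mathscr L^1_{1(p,1)}}=\sup_{x_0\in\mathbb R^n}\sum_{j\in\mathbb Z}2^{-j}\operatorname{osc}_{p,1}(f;x_0,2^j)$; its norm is the seminorm plus $\|f\|_{L^p(B(1))}$. Let $\varphi\in C_c^\infty(B(1))$ be the standard mollifier, $\int\varphi=1$, $\varphi_r=r^{-n}\varphi(\cdot/r)$. $P^0_\infty(g):=\lim_{r\to\infty}(g*\varphi_r)(x_0)$, whenever the limit exists and is independent of $x_0$. For $f\in\mathscr L^1_{1(p,1)}(\mathbb R^n)$, $\dot P^1_\infty(f)(x)=P^0_\infty(\nabla f)\cdot x$ (componentwise). For divergence-free $v\in\mathscr L^1_{1(p,1)}(\mathbb R^n)$, $\nabla\Pi(v,v)$ denotes $\nabla\pi$, where $\pi\in W^{1,p}_{loc}(\mathbb R^n)$ with $\nabla\pi\in\mathscr L^1_{1(p,1)}(\mathbb R^n)$ is the solution (unique up to a constant) of $-\Delta\pi=\nabla\cdot\nabla\cdot(v\otimes v)$,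 $\nabla\pi(0)=0$, $\dot P^1_\infty(\nabla\pi)=-\frac1nP^0_\infty(\nabla v:(\nabla v)^\top)\,x$, with $\nabla v:(\nabla v)^\top=\sum_{i,j}\partial_iv_j\partial_jv_i$. For $v=A(t)x$ with $A$ trace-free this means $\nabla\pi=-\frac1n\operatorname{trace}(A^2)x$. Uniqueness is meant in the class of velocities $v\in L^\infty_{loc}([0,T_* );\mathscr L^1_{1(p,1)}(\mathbb R^3))$. A pair $(v,\pi)$ with $v,\pi\in L^\infty(0,T;L^2_{loc})$ is a solution on $\mathbb R^n\times(0,T)$ if $\nabla v$, $D^2\pi$ are bounded there and the equations hold a.e.; on $(0,T_* )$ this is required for each $T<T_*$.
   Formalization: The printed constants contradict the printed system, since |λ|²=6λ² gives λ'=λ², and the printed formula equals −λ0 at t=0; proved instead: λ'=λ², λ(t)=λ0/(1−λ0 t), T_*=1/λ0, in place of λ'=λ²/3, 3λ0/(λ0 t−3), 3/λ0. *)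

theory Defs
  imports "HOL-Analysis.Analysis"
begin

section \<open>Test functions and weak derivatives\<close>

text \<open>Function classes modulo null sets are represented by Borel functions.\<close>

definition pd :: "'a::euclidean_space \<Rightarrow> ('a \<Rightarrow> real) \<Rightarrow> 'a \<Rightarrow> real" where
  "pd b f x = frechet_derivative f (at x) b"

primrec Ck :: "nat \<Rightarrow> ('a::euclidean_space \<Rightarrow> real) \<Rightarrow> bool" where
  "Ck 0 f \<longleftrightarrow> continuous_on UNIV f"
| "Ck (Suc k) f \<longleftrightarrow> (\<forall>x. f differentiable (at x)) \<and> (\<forall>b\<in>Basis. Ck k (pd b f))"

definition test_functions :: "'a::euclidean_space set \<Rightarrow> ('a \<Rightarrow> real) set" where
  "test_functions \<Omega> = {\<phi>. (\<forall>k. Ck k \<phi>) \<and> compact (closure {x. \<phi> x \<noteq> 0})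
      \<and> closure {x. \<phi> x \<noteq> 0} \<subseteq> \<Omega>}"

definition locally_integrable_on :: "('a::euclidean_space \<Rightarrow> real) \<Rightarrow> 'a set \<Rightarrow> bool" where
  "locally_integrable_on f \<Omega> \<longleftrightarrow>
     (\<forall>K. compact K \<and> K \<subseteq> \<Omega> \<longrightarrow> set_integrable lborel K f)"

definition weak_deriv ::
  "'a::euclidean_space set \<Rightarrow> 'a \<Rightarrow> ('a \<Rightarrow> real) \<Rightarrow> ('a \<Rightarrow> real) \<Rightarrow> bool" where
  "weak_deriv \<Omega> b f g \<longleftrightarrow> locally_integrable_on f \<Omega> \<and> locally_integrable_on g \<Omega> \<and>
     (\<forall>\<phi>\<in>test_functions \<Omega>.
        (LINT x|lborel. f x * pd b \<phi> x) = - (LINT x|lborel. g x * \<phi> x))"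

definition weak_gradient ::
  "(real^'n \<Rightarrow> real) \<Rightarrow> (real^'n \<Rightarrow> real^'n) \<Rightarrow> bool" where
  "weak_gradient f G \<longleftrightarrow> (\<forall>j. weak_deriv UNIV (axis j 1) f (\<lambda>x. G x $ j))"

text \<open>Convention: row \<open>i\<close>, column \<open>j\<close> of \<open>Df\<close> is \<open>\<partial>\<^sub>j f\<^sub>i\<close>.\<close>

definition weak_jacobian ::
  "(real^'n \<Rightarrow> real^'n) \<Rightarrow> (real^'n \<Rightarrow> real^'n^'n) \<Rightarrow> bool" where
  "weak_jacobian f Df \<longleftrightarrow> (\<forall>i. weak_gradient (\<lambda>x. f x $ i) (\<lambda>x. Df x $ i))"

definition divergence_free :: "(real^'n \<Rightarrow> real^'n) \<Rightarrow> bool" where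
  "divergence_free f \<longleftrightarrow> (\<exists>Df. weak_jacobian f Df \<and> (AE x in lborel. trace (Df x) = 0))"

section \<open>Oscillation and the space \<open>\<L>\<^sup>1\<^bsub>1(p,1)\<^esub>\<close>\<close>

definition Lp_norm :: "real \<Rightarrow> 'a::euclidean_space set \<Rightarrow> ('a \<Rightarrow> 'b::real_normed_vector) \<Rightarrow> ennreal" where
  "Lp_norm p S f =
     (let I = (\<integral>\<^sup>+x\<in>S. ennreal (norm (f x) powr p) \<partial>lborel)
      in if I = \<infinity> then \<infinity> else ennreal (enn2real I powr (1 / p)))"

definition Lp_loc :: "real \<Rightarrow> ('a::euclidean_space \<Rightarrow> real) set" where
  "Lp_loc p = {f \<in> borel_measurable lborel. \<forall>R>0. Lp_norm p (ball 0 R) f < \<infinity>}"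

text \<open>In the following sum, \<open>\<alpha>\<close> ranges over the (finitely many) multi-indices of order at most \<open>N\<close>.\<close>

definition poly_space :: "nat \<Rightarrow> (real^'n \<Rightarrow> real) set" where
  "poly_space N = {P. \<exists>c :: ('n \<Rightarrow> nat) \<Rightarrow> real. \<forall>x.
      P x = (\<Sum>\<alpha> | (\<Sum>i\<in>UNIV. \<alpha> i) \<le> N. c \<alpha> * (\<Prod>i\<in>UNIV. (x $ i) ^ \<alpha> i))}"

definition osc :: "real \<Rightarrow> nat \<Rightarrow> (real^'n \<Rightarrow> real) \<Rightarrow> real^'n \<Rightarrow> real \<Rightarrow> ennreal" where
  "osc p N f x0 r = ennreal (measure lborel (ball (0::real^'n) r) powr (- 1 / p)) *
     (INF P\<in>poly_space N. Lp_norm p (ball x0 r) (\<lambda>x. f x - P x))"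

definition L_seminorm :: "real \<Rightarrow> (real^'n \<Rightarrow> real) \<Rightarrow> ennreal" where
  "L_seminorm p f =
     (SUP x0. \<Sum>\<^sub>\<infinity>j\<in>(UNIV::int set). ennreal (2 powi (- j)) * osc p 1 f x0 (2 powi j))"

definition L_norm :: "real \<Rightarrow> (real^'n \<Rightarrow> real) \<Rightarrow> ennreal" where
  "L_norm p f = L_seminorm p f + Lp_norm p (ball 0 1) f"

definition L_space :: "real \<Rightarrow> (real^'n \<Rightarrow> real) set" where
  "L_space p = {f \<in> Lp_loc p. L_seminorm p f < \<infinity>}"

text \<open>Vector fields are treated componentwise.\<close>

definition L_vec_norm :: "real \<Rightarrow> (real^'n \<Rightarrow> real^'n) \<Rightarrow> ennreal" where
  "L_vec_norm p f = (\<Sum>i\<in>UNIV. L_norm p (\<lambda>x. f x $ i))"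

definition L_vec_space :: "real \<Rightarrow> (real^'n \<Rightarrow> real^'n) set" where
  "L_vec_space p = {f. \<forall>i. (\<lambda>x. f x $ i) \<in> L_space p}"

section \<open>Asymptotic polynomials and the pressure gradient \<open>\<nabla>\<Pi>(v,v)\<close>\<close>

definition bump :: "real^'n \<Rightarrow> real" where
  "bump x = (if norm x < 1 then exp (- 1 / (1 - (norm x)\<^sup>2)) else 0)"

definition mollifier :: "real^'n \<Rightarrow> real" where
  "mollifier x = bump x / (LINT y|lborel. bump (y::real^'n))"

definition mollifier_scaled :: "real \<Rightarrow> real^'n \<Rightarrow> real" where
  "mollifier_scaled r x = mollifier ((1 / r) *\<^sub>R x) / r ^ CARD('n)"

definition convolution :: "(real^'n \<Rightarrow> real) \<Rightarrow> (real^'n \<Rightarrow> real) \<Rightarrow> real^'n \<Rightarrow> real" where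
  "convolution g h x = (LINT y|lborel. g y * h (x - y))"

text \<open>\<open>P\<^sup>0\<^sub>\<infinity>(g)\<close> is a partial operation: \<open>P0_infty g c\<close> says that it is defined and has value \<open>c\<close>.
  Likewise \<open>P1dot_infty f L\<close> says that the linear field \<open>x \<mapsto> P\<^sup>0\<^sub>\<infinity>(\<nabla>f) x\<close> is defined and is \<open>L\<close>.\<close>

definition P0_infty :: "(real^'n \<Rightarrow> real) \<Rightarrow> real \<Rightarrow> bool" where
  "P0_infty g c \<longleftrightarrow> (\<forall>x0. ((\<lambda>r. convolution g (mollifier_scaled r) x0) \<longlongrightarrow> c) at_top)"

definition P1dot_infty :: "(real^'n \<Rightarrow> real^'n) \<Rightarrow> (real^'n \<Rightarrow> real^'n) \<Rightarrow> bool" where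
  "P1dot_infty f L \<longleftrightarrow> (\<exists>Df M. weak_jacobian f Df \<and>
     (\<forall>i j. P0_infty (\<lambda>x. Df x $ i $ j) (M $ i $ j)) \<and> L = (\<lambda>x. M *v x))"

text \<open>\<open>is_Pi p v \<pi>\<close>: \<open>\<pi>\<close> is the potential, unique up to a constant, whose gradient is \<open>\<nabla>\<Pi>(v,v)\<close>.
  The pointwise condition \<open>\<nabla>\<pi>(0) = 0\<close> refers to the continuous representative \<open>G\<close> of \<open>\<nabla>\<pi>\<close>;
  the equation \<open>-\<Delta>\<pi> = \<nabla>\<cdot>\<nabla>\<cdot>(v \<otimes> v)\<close> is meant in the sense of distributions.\<close>

definition is_Pi :: "real \<Rightarrow> (real^'n \<Rightarrow> real^'n) \<Rightarrow> (real^'n \<Rightarrow> real) \<Rightarrow> bool" where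
  "is_Pi p v \<pi> \<longleftrightarrow>
     v \<in> L_vec_space p \<and> divergence_free v \<and>
     (\<exists>G. weak_gradient \<pi> G \<and> \<pi> \<in> Lp_loc p \<and> (\<forall>i. (\<lambda>x. G x $ i) \<in> Lp_loc p) \<and>
        G \<in> L_vec_space p \<and>
        (\<forall>\<phi>\<in>test_functions UNIV.
           - (LINT x|lborel. \<pi> x * (\<Sum>i\<in>UNIV. pd (axis i 1) (pd (axis i 1) \<phi>) x)) =
           (LINT x|lborel. (\<Sum>i\<in>UNIV. \<Sum>j\<in>UNIV.
               v x $ i * v x $ j * pd (axis i 1) (pd (axis j 1) \<phi>) x))) \<and>
        continuous_on UNIV G \<and> G 0 = 0 \<and>
        (\<exists>Dv c. weak_jacobian v Dv \<and>
           P0_infty (\<lambda>x. \<Sum>i\<in>UNIV. \<Sum>j\<in>UNIV. Dv x $ j $ i * Dv x $ i $ j) c \<and>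
           P1dot_infty G (\<lambda>x. (- (1 / real CARD('n)) * c) *\<^sub>R x)))"

section \<open>The Euler equations\<close>

definition Linf_L2loc :: "real \<Rightarrow> (real^'n \<Rightarrow> real \<Rightarrow> 'b::euclidean_space) \<Rightarrow> bool" where
  "Linf_L2loc T f \<longleftrightarrow>
     set_borel_measurable lborel (UNIV \<times> {0<..<T}) (\<lambda>(x, t). f x t) \<and>
     (\<forall>R>0. \<exists>C::real. AE t in lborel. 0 < t \<and> t < T \<longrightarrow>
        Lp_norm 2 (ball 0 R) (\<lambda>x. f x t) \<le> ennreal C)"

text \<open>\<open>(v, \<pi>)\<close> is a solution on \<open>\<real>\<^sup>n \<times> (0,T)\<close>; all derivatives are weak derivatives in space-time.
  Note that \<open>Dv *v v\<close> is \<open>(v\<cdot>\<nabla>)v\<close> and \<open>trace Dv\<close> is \<open>\<nabla>\<cdot>v\<close>.\<close>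

definition euler_on ::
  "(real^'n \<Rightarrow> real \<Rightarrow> real^'n) \<Rightarrow> (real^'n \<Rightarrow> real \<Rightarrow> real) \<Rightarrow> real \<Rightarrow> bool" where
  "euler_on v \<pi> T \<longleftrightarrow> Linf_L2loc T v \<and> Linf_L2loc T \<pi> \<and>
     (let \<Omega> = UNIV \<times> {0<..<T} in
      \<exists>(Dv :: (real^'n) \<times> real \<Rightarrow> real^'n^'n) (v_t :: (real^'n) \<times> real \<Rightarrow> real^'n)
        (D\<pi> :: (real^'n) \<times> real \<Rightarrow> real^'n) (D2\<pi> :: (real^'n) \<times> real \<Rightarrow> real^'n^'n).
        (\<forall>i j. weak_deriv \<Omega> (axis j 1, 0) (\<lambda>(x, t). v x t $ i) (\<lambda>z. Dv z $ i $ j)) \<and>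
        (\<forall>i. weak_deriv \<Omega> (0, 1) (\<lambda>(x, t). v x t $ i) (\<lambda>z. v_t z $ i)) \<and>
        (\<forall>j. weak_deriv \<Omega> (axis j 1, 0) (\<lambda>(x, t). \<pi> x t) (\<lambda>z. D\<pi> z $ j)) \<and>
        (\<forall>i j. weak_deriv \<Omega> (axis j 1, 0) (\<lambda>z. D\<pi> z $ i) (\<lambda>z. D2\<pi> z $ i $ j)) \<and>
        (\<exists>C. AE z in lborel. z \<in> \<Omega> \<longrightarrow> norm (Dv z) \<le> C \<and> norm (D2\<pi> z) \<le> C) \<and>
        (AE z in lborel. z \<in> \<Omega> \<longrightarrow>
           v_t z + Dv z *v v (fst z) (snd z) = - D\<pi> z \<and> trace (Dv z) = 0))"

text \<open>The initial value problem on \<open>[0,T)\<close>, \<open>T \<le> \<infinity>\<close>, with \<open>v(0,t) = 0\<close> and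
  \<open>\<nabla>\<pi> = \<nabla>\<Pi>(v,v)\<close>, in the class \<open>L\<^sup>\<infinity>\<^sub>l\<^sub>o\<^sub>c([0,T); \<L>\<^sup>1\<^bsub>1(p,1)\<^esub>)\<close>. Such velocities are locally Lipschitz in
  space-time, so \<open>v\<close> is identified with its continuous representative, for which the conditions at
  \<open>t = 0\<close> and at \<open>x = 0\<close> are pointwise conditions.\<close>

definition euler_solution ::
  "real \<Rightarrow> (real^'n \<Rightarrow> real^'n) \<Rightarrow> ereal \<Rightarrow>
   (real^'n \<Rightarrow> real \<Rightarrow> real^'n) \<Rightarrow> (real^'n \<Rightarrow> real \<Rightarrow> real) \<Rightarrow> bool" where
  "euler_solution p v0 T v \<pi> \<longleftrightarrow>
     (\<forall>S>0. ereal S < T \<longrightarrow> euler_on v \<pi> S) \<and>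
     continuous_on (UNIV \<times> {t. 0 \<le> t \<and> ereal t < T}) (\<lambda>(x, t). v x t) \<and>
     (\<forall>x. v x 0 = v0 x) \<and>
     (\<forall>t. 0 \<le> t \<and> ereal t < T \<longrightarrow> v 0 t = 0) \<and>
     (AE t in lborel. 0 < t \<and> ereal t < T \<longrightarrow>
        (\<lambda>x. v x t) \<in> L_vec_space p \<and> is_Pi p (\<lambda>x. v x t) (\<lambda>x. \<pi> x t)) \<and>
     (\<forall>S>0. ereal S < T \<longrightarrow> (\<exists>C::real. AE t in lborel. 0 < t \<and> t < S \<longrightarrow>
        L_vec_norm p (\<lambda>x. v x t) \<le> ennreal C))"

definition max_existence_time :: "real \<Rightarrow> (real^'n \<Rightarrow> real^'n) \<Rightarrow> ereal" where
  "max_existence_time p v0 = Sup {T. 0 < T \<and> (\<exists>v \<pi>. euler_solution p v0 T v \<pi>)}"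

end

theory Submission
  imports Defs
begin

text \<open>Existence is a computation. For uniqueness, let \<open>v\<close> be any solution. Along trajectories
  \<open>X' = v(X, t)\<close> the integral of the Lagrangian \<open>|v|\<^sup>2/2 - \<pi>\<close> is a potential of \<open>v\<close> up to an
  error of second order in the distance of two trajectories, since \<open>v\<close> and \<open>\<nabla>\<pi>\<close> are Lipschitz in
  space and the initial velocity is a gradient; hence \<open>v(\<cdot>, t)\<close> is a gradient for each \<open>t\<close> (this is
  the conservation of circulation, proved without differentiating the vorticity equation). Its
  potential is harmonic with bounded second differences, so by the mean value property these are
  constant and \<open>v(x, t) = B(t) x\<close>. The condition on \<open>P1dot_infty\<close> then determines the pressure, and
  \<open>B' + B\<^sup>2 = (tr(B\<^sup>2)/n) I\<close>. Uniqueness for this equation gives \<open>B = diag(\<lambda>, \<lambda>, -2\<lambda>)\<close> with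
  \<open>\<lambda>' = \<lambda>\<^sup>2\<close>, and no solution extends beyond the blow-up of \<open>\<lambda>\<close> at time \<open>1 / lam0\<close>.\<close>


section \<open>Test functions\<close>

text \<open>Only weak derivatives are available, with \<open>Dv\<close> and \<open>D2\<pi>\<close>
  merely bounded, and velocities may grow linearly at infinity; a classical vorticity equation or a
  global energy estimate for a difference of solutions is out of reach. Circulation needs less: a
  Lipschitz velocity has trajectories, and a second-order Taylor bound for the pressure survives
  mollification with the same constant. Mollification leaves errors that are linear in the distance
  of two trajectories but arbitrarily small; when two approximate potentials are compared,
  subdividing segments removes the quadratic errors too, so the potentials converge. The Hessian of
  the pressure of a linear velocity is not found pointwise: by the momentum equation its weighted
  mean over a ball is the same for every radius, and an infinite radius turns the asymptotic
  condition into that value. Constants: for the multiples lambda (1, 1, -2) one has |lambda|^2 = 6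
  lambda^2, so lambda' = 2 lambda^2 - lambda^2 = lambda^2; the Riccati coefficient is 1, not 1/3,
  and the blow-up time is 1 / lambda(0), not 3 / lambda(0).\<close>

lemma pd_eqI: "(f has_derivative D) (at x) \<Longrightarrow> pd b f x = D b"
  by (metis frechet_derivative_at pd_def)

lemma has_derivative_pd: "f differentiable (at x) \<Longrightarrow> (f has_derivative (\<lambda>h. pd h f x)) (at x)"
  unfolding pd_def by (simp add: frechet_derivative_works[symmetric] eta_contract_eq)

lemma Ck_SucI:
  assumes "\<And>x. (f has_derivative D x) (at x)" "\<And>b. b \<in> Basis \<Longrightarrow> Ck k (\<lambda>x. D x b)"
  shows "Ck (Suc k) f"
proof -
  have "pd b f = (\<lambda>x. D x b)" for b
    using pd_eqI[OF assms(1)] by auto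
  then show ?thesis
    using assms by (auto simp: differentiable_def)
qed

lemma Ck_Suc_has_derivative: "Ck (Suc k) f \<Longrightarrow> (f has_derivative (\<lambda>h. pd h f x)) (at x)"
  by (simp add: has_derivative_pd)

lemma Ck_SucD: "Ck (Suc k) f \<Longrightarrow> Ck k f"
proof (induction k arbitrary: f)
  case 0
  then show ?case
    by (auto simp: continuous_on_eq_continuous_at intro: differentiable_imp_continuous_within)
qed auto

lemma Ck_continuous: "Ck k f \<Longrightarrow> continuous_on UNIV f"
  by (induction k) (auto dest: Ck_SucD simp del: Ck.simps(2))

lemma Ck_const: "Ck k (\<lambda>x. c)"
proof (induction k arbitrary: c)
  case (Suc k)
  show ?case by (rule Ck_SucI[where D="\<lambda>x h. 0"]) (auto intro: Suc)
qed auto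

lemma Ck_bounded_linear: "bounded_linear L \<Longrightarrow> Ck k L"
proof (cases k)
  case 0
  then show "bounded_linear L \<Longrightarrow> Ck k L" by (simp add: linear_continuous_on)
next
  case (Suc j)
  then show "bounded_linear L \<Longrightarrow> Ck k L"
    by (auto intro!: Ck_SucI[where D="\<lambda>x. L"] Ck_const bounded_linear_imp_has_derivative simp del: Ck.simps)
qed

lemma Ck_add: "Ck k f \<Longrightarrow> Ck k g \<Longrightarrow> Ck k (\<lambda>x. f x + g x)"
proof (induction k arbitrary: f g)
  case (Suc k)
  show ?case
    by (rule Ck_SucI[where D="\<lambda>x h. pd h f x + pd h g x"])
      (use Suc in \<open>auto intro!: derivative_eq_intros Ck_Suc_has_derivative simp del: Ck.simps\<close>,
       use Suc in auto)
qed (auto intro: continuous_intros)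

lemma Ck_mult: "Ck k f \<Longrightarrow> Ck k g \<Longrightarrow> Ck k (\<lambda>x. f x * g x)"
proof (induction k arbitrary: f g)
  case (Suc k)
  note d = Ck_Suc_has_derivative[OF Suc.prems(1)] Ck_Suc_has_derivative[OF Suc.prems(2)]
  have c: "Ck k f" "Ck k g" using Suc.prems Ck_SucD by blast+
  show ?case
  proof (rule Ck_SucI[where D="\<lambda>x h. f x * pd h g x + pd h f x * g x"])
    show "((\<lambda>x. f x * g x) has_derivative (\<lambda>h. f x * pd h g x + pd h f x * g x)) (at x)" for x
      by (rule has_derivative_mult[OF d])
    show "Ck k (\<lambda>x. f x * pd b g x + pd b f x * g x)" if "b \<in> Basis" for b
      using Suc that c by (intro Ck_add Suc.IH) auto
  qed
qed (auto intro: continuous_intros)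

lemma Ck_sum: "(\<And>i. i \<in> I \<Longrightarrow> Ck k (f i)) \<Longrightarrow> Ck k (\<lambda>x. \<Sum>i\<in>I. f i x)"
  by (induction I rule: infinite_finite_induct) (auto intro: Ck_const Ck_add)

lemma Ck_prod: "(\<And>i. i \<in> I \<Longrightarrow> Ck k (f i)) \<Longrightarrow> Ck k (\<lambda>x. \<Prod>i\<in>I. f i x)"
  by (induction I rule: infinite_finite_induct) (auto intro: Ck_const Ck_mult)

lemma pd_linear:
  assumes "f differentiable (at x)"
  shows "linear (\<lambda>h. pd h f x)"
  using has_derivative_linear[OF has_derivative_pd[OF assms]] .

lemma pd_Basis_sum:
  assumes "f differentiable (at x)"
  shows "pd h f x = (\<Sum>e\<in>Basis. (h \<bullet> e) * pd e f x)"
proof -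
  have "pd (\<Sum>e\<in>Basis. (h \<bullet> e) *\<^sub>R e) f x = (\<Sum>e\<in>Basis. (h \<bullet> e) * pd e f x)"
    using linear_sum[OF pd_linear[OF assms], of "\<lambda>e. (h \<bullet> e) *\<^sub>R e" Basis]
    by (simp add: linear_scale[OF pd_linear[OF assms]])
  then show ?thesis by (simp add: euclidean_representation)
qed

lemma Ck_affine:
  fixes f :: "'b::euclidean_space \<Rightarrow> real" and L :: "'a::euclidean_space \<Rightarrow> 'b"
  assumes L: "bounded_linear L"
  shows "Ck k f \<Longrightarrow> Ck k (\<lambda>x. f (a + L x))"
proof (induction k arbitrary: f)
  case 0
  then show ?case
    using continuous_on_compose2[of UNIV f UNIV "\<lambda>x. a + L x"]
      continuous_on_add[OF continuous_on_const linear_continuous_on[OF L], of UNIV a] by simp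
next
  case (Suc k)
  have dif: "f differentiable (at x)" for x using Suc.prems by simp
  show ?case
  proof (rule Ck_SucI[where D="\<lambda>x h. pd (L h) f (a + L x)"])
    fix x
    have "((\<lambda>x. a + L x) has_derivative L) (at x)"
      by (auto intro!: derivative_eq_intros bounded_linear_imp_has_derivative L)
    from has_derivative_compose[OF this has_derivative_pd[OF dif]]
    show "((\<lambda>x. f (a + L x)) has_derivative (\<lambda>h. pd (L h) f (a + L x))) (at x)" .
  next
    fix b :: 'a
    have "(\<lambda>x. pd (L b) f (a + L x)) = (\<lambda>x. \<Sum>e\<in>Basis. (L b \<bullet> e) * pd e f (a + L x))"
      by (intro ext pd_Basis_sum dif)
    moreover have "Ck k (\<lambda>x. \<Sum>e\<in>Basis. (L b \<bullet> e) * pd e f (a + L x))"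
    proof (rule Ck_sum, rule Ck_mult[OF Ck_const])
      fix e :: 'b assume "e \<in> Basis"
      then have "Ck k (pd e f)" using Suc.prems by simp
      then show "Ck k (\<lambda>x. pd e f (a + L x))" by (rule Suc.IH)
    qed
    ultimately show "Ck k (\<lambda>x. pd (L b) f (a + L x))" by simp
  qed
qed

lemma pd_affine:
  fixes f :: "'b::euclidean_space \<Rightarrow> real" and L :: "'a::euclidean_space \<Rightarrow> 'b"
  assumes L: "bounded_linear L" and dif: "f differentiable (at (a + L x))"
  shows "pd h (\<lambda>x. f (a + L x)) x = pd (L h) f (a + L x)"
proof -
  have "((\<lambda>x. a + L x) has_derivative L) (at x)"
    by (auto intro!: derivative_eq_intros bounded_linear_imp_has_derivative L)
  from has_derivative_compose[OF this has_derivative_pd[OF dif]] show ?thesis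
    by (rule pd_eqI)
qed

lemma has_real_derivative_along_line:
  assumes "f differentiable (at (x + s *\<^sub>R b))"
  shows "((\<lambda>s. f (x + s *\<^sub>R b)) has_real_derivative pd b f (x + s *\<^sub>R b)) (at s)"
proof -
  have "((\<lambda>s. x + s *\<^sub>R b) has_derivative (\<lambda>h. h *\<^sub>R b)) (at s)"
    by (auto intro!: derivative_eq_intros)
  from has_derivative_compose[OF this has_derivative_pd[OF assms]] show ?thesis
    by (simp add: has_field_derivative_def linear_scale[OF pd_linear[OF assms]] mult_commute_abs)
qed

lemma Ck_pd:
  assumes "Ck (Suc k) f"
  shows "Ck k (pd h f)"
proof -
  have "pd h f = (\<lambda>x. \<Sum>e\<in>Basis. (h \<bullet> e) * pd e f x)"
    using assms by (intro ext pd_Basis_sum) simp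
  moreover have "Ck k (\<lambda>x. \<Sum>e\<in>Basis. (h \<bullet> e) * pd e f x)"
    by (intro Ck_sum Ck_mult Ck_const) (use assms in simp)
  ultimately show ?thesis by simp
qed

lemma Ck_compose_real:
  fixes g :: "real \<Rightarrow> real" and f :: "'a::euclidean_space \<Rightarrow> real"
  shows "Ck k g \<Longrightarrow> Ck k f \<Longrightarrow> Ck k (\<lambda>x. g (f x))"
proof (induction k arbitrary: g)
  case 0
  then show ?case
    using continuous_on_compose2[of UNIV g UNIV f] by auto
next
  case (Suc k)
  have dif: "g differentiable (at x)" for x using Suc.prems by simp
  have lin: "pd t g y = t * pd 1 g y" for t y
    using pd_Basis_sum[OF dif, of t y] by simp
  show ?case
  proof (rule Ck_SucI[where D="\<lambda>x h. pd h f x * pd 1 g (f x)"])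
    show "((\<lambda>x. g (f x)) has_derivative (\<lambda>h. pd h f x * pd 1 g (f x))) (at x)" for x
      using has_derivative_compose[OF Ck_Suc_has_derivative[OF Suc.prems(2)] has_derivative_pd[OF dif]]
      by (simp flip: lin)
    show "Ck k (\<lambda>x. pd b f x * pd 1 g (f x))" if "b \<in> Basis" for b
    proof (rule Ck_mult)
      show "Ck k (pd b f)" using Suc.prems that by simp
      have "Ck k (pd 1 g)" using Suc.prems by simp
      then show "Ck k (\<lambda>x. pd 1 g (f x))" using Suc.IH Ck_SucD[OF Suc.prems(2)] by blast
    qed
  qed
qed

section \<open>Functions vanishing to infinite order at 0\<close>

text \<open>The classical exp (- 1 / t), multiplied by a polynomial in 1 / t so that the family is
  closed under differentiation; smoothness of every member then follows by one induction, and
  \<open>q = 1\<close> gives the usual cut-off profile.\<close>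

definition exp_step :: "real poly \<Rightarrow> real \<Rightarrow> real" where
  "exp_step q t = (if t \<le> 0 then 0 else poly q (1 / t) * exp (- (1 / t)))"

lemma poly_times_exp_minus_tendsto_0: "((\<lambda>s. poly q s * exp (- s)) \<longlongrightarrow> (0::real)) at_top"
proof -
  have "((\<lambda>s. \<Sum>i\<le>degree q. coeff q i * (s ^ i / exp s)) \<longlongrightarrow> (\<Sum>i\<le>degree q. coeff q i * 0)) at_top"
    by (intro tendsto_intros tendsto_power_div_exp_0)
  then show ?thesis
    by (simp add: poly_altdef sum_distrib_right exp_minus divide_inverse mult.assoc)
qed

lemma exp_step_tendsto_0: "(exp_step q \<longlongrightarrow> 0) (at_right 0)"
proof -
  have "((\<lambda>t. poly q (1 / t) * exp (- (1 / t))) \<longlongrightarrow> 0) (at_right 0)"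
    using filterlim_compose[OF poly_times_exp_minus_tendsto_0[of q] filterlim_inverse_at_top_right]
    by (simp add: divide_inverse)
  moreover have "eventually (\<lambda>t. poly q (1 / t) * exp (- (1 / t)) = exp_step q t) (at_right 0)"
    by (auto simp: eventually_at_right_field exp_step_def intro!: exI[of _ 1])
  ultimately show ?thesis by (rule Lim_transform_eventually)
qed

text \<open>With s = 1 / t one has ds/dt = - s^2, so the derivative of q(s) exp(-s) in t is s^2 (q -
  q')(s) exp(-s). Only t = 0 needs an argument, through the two one-sided difference
  quotients.\<close>

lemma exp_step_deriv:
  "(exp_step q has_real_derivative exp_step (monom 1 2 * (q - pderiv q)) t) (at t)"
proof -
  consider "t < 0" | "t = 0" | "t > 0" by linarith
  then show ?thesis
  proof cases
    case 1
    have "((\<lambda>t. 0) has_real_derivative 0) (at t)" by simp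
    then have "(exp_step q has_real_derivative 0) (at t)"
      by (rule has_field_derivative_transform_within_open[where S="{..<0}"])
        (use 1 in \<open>auto simp: exp_step_def\<close>)
    then show ?thesis using 1 by (simp add: exp_step_def)
  next
    case 2
    \<comment> \<open>Dividing by h multiplies the polynomial by its variable, which is
      \<open>pCons 0 q\<close>, so the quotient stays in the family.\<close>
    have "((\<lambda>h. (exp_step q (0 + h) - exp_step q 0) / h) \<longlongrightarrow> 0) (at_right 0)"
    proof (rule Lim_transform_eventually[OF exp_step_tendsto_0[of "pCons 0 q"]])
      show "eventually (\<lambda>h. exp_step (pCons 0 q) h = (exp_step q (0 + h) - exp_step q 0) / h) (at_right 0)"
        by (auto simp: eventually_at_right_field exp_step_def intro!: exI[of _ 1])
    qed
    moreover have "((\<lambda>h. (exp_step q (0 + h) - exp_step q 0) / h) \<longlongrightarrow> 0) (at_left 0)"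
    proof (rule Lim_transform_eventually[of "\<lambda>_. 0"])
      show "eventually (\<lambda>h. 0 = (exp_step q (0 + h) - exp_step q 0) / h) (at_left 0)"
        by (auto simp: eventually_at_left_field exp_step_def intro!: exI[of _ "-1"])
    qed simp
    ultimately have "((\<lambda>h. (exp_step q (0 + h) - exp_step q 0) / h) \<longlongrightarrow> 0) (at 0)"
      by (simp add: filterlim_split_at)
    then show ?thesis using 2 by (simp add: DERIV_def exp_step_def)
  next
    case 3
    have "((\<lambda>t. poly q (1 / t) * exp (- (1 / t))) has_real_derivative
        exp_step (monom 1 2 * (q - pderiv q)) t) (at t)"
      using 3 by (auto intro!: derivative_eq_intros simp: exp_step_def poly_monom field_simps power2_eq_square)
    then show ?thesis
      by (rule has_field_derivative_transform_within_open[where S="{0<..}"])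
        (use 3 in \<open>auto simp: exp_step_def\<close>)
  qed
qed

lemma Ck_exp_step: "Ck k (exp_step q)"
proof (induction k arbitrary: q)
  case 0
  have "continuous_on UNIV (exp_step q)"
    by (intro continuous_at_imp_continuous_on ballI DERIV_isCont[OF exp_step_deriv])
  then show ?case by simp
next
  case (Suc k)
  show ?case
    by (rule Ck_SucI[where D="\<lambda>t h. exp_step (monom 1 2 * (q - pderiv q)) t * h"])
      (use exp_step_deriv in \<open>auto simp: has_field_derivative_def intro!: Suc\<close>)
qed

abbreviation hfun :: "real \<Rightarrow> real" where "hfun \<equiv> exp_step 1"

lemma hfun_nonneg: "0 \<le> hfun t" and hfun_le_1: "hfun t \<le> 1"
  and hfun_pos: "0 < t \<Longrightarrow> 0 < hfun t" and hfun_eq_0: "t \<le> 0 \<Longrightarrow> hfun t = 0"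
  by (auto simp: exp_step_def)

text \<open>Under growing rescaling the profile approaches a step; products of such profiles later
  approximate indicators of boxes.\<close>

lemma hfun_tendsto_indicator: "(\<lambda>m. hfun (real (Suc m) * t)) \<longlonglongrightarrow> (if t > 0 then 1 else 0)"
proof (cases "t > 0")
  case True
  have "(\<lambda>m. exp (- (1 / (real (Suc m) * t)))) \<longlonglongrightarrow> exp (- (0 * (1/t)))"
    unfolding divide_inverse inverse_mult_distrib mult_1
    by (intro tendsto_intros LIMSEQ_inverse_real_of_nat)
  moreover have "hfun (real (Suc m) * t) = exp (- (1 / (real (Suc m) * t)))" for m
    using True by (auto simp: exp_step_def mult_le_0_iff)
  ultimately show ?thesis using True by simp
next
  case False
  then have "hfun (real (Suc m) * t) = 0" for m
    by (intro hfun_eq_0) (simp add: mult_le_0_iff)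
  then show ?thesis using False by simp
qed

section \<open>Closure properties of the test functions; a radial bump\<close>

lemma test_functionsI:
  assumes "\<And>k. Ck k \<phi>" "compact K" "K \<subseteq> \<Omega>" "\<And>x. x \<notin> K \<Longrightarrow> \<phi> x = 0"
  shows "\<phi> \<in> test_functions \<Omega>"
proof -
  have "closure {x. \<phi> x \<noteq> 0} \<subseteq> K"
    using assms by (intro closure_minimal compact_imp_closed) auto
  moreover have "closed (closure {x. \<phi> x \<noteq> 0})" by simp
  ultimately have "compact (closure {x. \<phi> x \<noteq> 0})"
    using compact_Int_closed[OF assms(2), of "closure {x. \<phi> x \<noteq> 0}"] \<open>closure _ \<subseteq> K\<close>
    by (simp add: Int_absorb1)
  then show ?thesis
    using \<open>closure {x. \<phi> x \<noteq> 0} \<subseteq> K\<close> assms by (auto simp: test_functions_def)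
qed

lemma test_functionsE:
  assumes "\<phi> \<in> test_functions \<Omega>"
  obtains K where "compact K" "K \<subseteq> \<Omega>" "\<And>x. x \<notin> K \<Longrightarrow> \<phi> x = 0" "\<And>b x. x \<notin> K \<Longrightarrow> pd b \<phi> x = 0"
proof
  let ?K = "closure {x. \<phi> x \<noteq> 0}"
  show "compact ?K" "?K \<subseteq> \<Omega>" using assms by (auto simp: test_functions_def)
  show 0: "\<phi> x = 0" if "x \<notin> ?K" for x
    using that closure_subset[of "{x. \<phi> x \<noteq> 0}"] by auto
  show "pd b \<phi> x = 0" if "x \<notin> ?K" for b x
  proof -
    have "(\<phi> has_derivative (\<lambda>_. 0)) (at x)"
    proof (rule has_derivative_transform_within_open[of "\<lambda>_. 0" _ _ _ "- ?K"])
      show "0 = \<phi> y" if "y \<in> - ?K" for y using 0[of y] that by simp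
    qed (use that in \<open>simp_all add: open_Compl\<close>)
    then show ?thesis by (rule pd_eqI)
  qed
qed

lemma test_functions_Ck: "\<phi> \<in> test_functions \<Omega> \<Longrightarrow> Ck k \<phi>"
  by (simp add: test_functions_def)

lemma test_functions_mono: "\<Omega> \<subseteq> \<Omega>' \<Longrightarrow> test_functions \<Omega> \<subseteq> test_functions \<Omega>'"
  by (auto simp: test_functions_def)

lemma test_functions_continuous: "\<phi> \<in> test_functions \<Omega> \<Longrightarrow> continuous_on UNIV \<phi>"
  using test_functions_Ck Ck_continuous by blast

lemma test_functions_differentiable: "\<phi> \<in> test_functions \<Omega> \<Longrightarrow> \<phi> differentiable (at x)"
  using test_functions_Ck[of \<phi> \<Omega> "Suc 0"] by simp

lemma test_functions_pd:
  assumes "\<phi> \<in> test_functions \<Omega>"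
  shows "pd b \<phi> \<in> test_functions \<Omega>"
proof -
  from assms obtain K where "compact K" "K \<subseteq> \<Omega>" "\<And>b x. x \<notin> K \<Longrightarrow> pd b \<phi> x = 0"
    by (metis test_functionsE)
  then show ?thesis
    using test_functions_Ck[OF assms] by (intro test_functionsI Ck_pd) auto
qed

lemma test_functions_cmult:
  assumes "\<phi> \<in> test_functions \<Omega>"
  shows "(\<lambda>x. c * \<phi> x) \<in> test_functions \<Omega>"
proof -
  from assms obtain K where K: "compact K" "K \<subseteq> \<Omega>" "\<And>x. x \<notin> K \<Longrightarrow> \<phi> x = 0"
    by (metis test_functionsE)
  show ?thesis
    by (rule test_functionsI[OF Ck_mult[OF Ck_const test_functions_Ck[OF assms]] K(1,2)]) (simp add: K)
qed

lemma test_functions_affine: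
  fixes \<phi> :: "'b::euclidean_space \<Rightarrow> real" and L :: "'a::euclidean_space \<Rightarrow> 'b"
  assumes "\<phi> \<in> test_functions \<Omega>" "bounded_linear L" "compact K" "K \<subseteq> \<Omega>'"
    "\<And>x. x \<notin> K \<Longrightarrow> \<phi> (a + L x) = 0"
  shows "(\<lambda>x. \<phi> (a + L x)) \<in> test_functions \<Omega>'"
  using assms Ck_affine[OF assms(2) test_functions_Ck[OF assms(1)]]
  by (intro test_functionsI[of _ K]) auto

text \<open>The standard bump exp(-1 / (1 - |x|^2)), written as a smooth profile composed with a
  polynomial in x, so that smoothness across the unit sphere needs no case distinction.\<close>

definition rbump :: "'a::euclidean_space \<Rightarrow> real" where
  "rbump x = hfun (1 - x \<bullet> x)"

lemma Ck_one_minus_inner: "Ck k (\<lambda>x. 1 - x \<bullet> x)"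
proof -
  have "(\<lambda>x::'a. 1 - x \<bullet> x) = (\<lambda>x. 1 + (-1) * (\<Sum>b\<in>Basis. (x \<bullet> b) * (x \<bullet> b)))"
    by (subst euclidean_inner) auto
  moreover have l: "Ck k (\<lambda>x::'a. x \<bullet> b)" for b
    by (rule Ck_bounded_linear[OF bounded_linear_inner_left])
  have "Ck k (\<lambda>x::'a. 1 + (-1) * (\<Sum>b\<in>Basis. (x \<bullet> b) * (x \<bullet> b)))"
    by (rule Ck_add[OF Ck_const Ck_mult[OF Ck_const Ck_sum]]) (rule Ck_mult[OF l l])
  ultimately show ?thesis by simp
qed

lemma Ck_rbump: "Ck k rbump"
  unfolding rbump_def[abs_def] by (rule Ck_compose_real[OF Ck_exp_step Ck_one_minus_inner])

lemma rbump_nonneg: "0 \<le> rbump x" and rbump_pos: "norm x < 1 \<Longrightarrow> 0 < rbump x"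
  and rbump_eq_0: "1 \<le> norm x \<Longrightarrow> rbump x = 0" and rbump_minus: "rbump (- x) = rbump x"
  by (auto simp: rbump_def hfun_nonneg norm_eq_sqrt_inner intro!: hfun_pos hfun_eq_0)

lemma rbump_test_function: "rbump \<in> test_functions UNIV"
  by (rule test_functionsI[of _ "cball 0 1"]) (auto intro: Ck_rbump rbump_eq_0)

section \<open>Weak derivatives of classically differentiable functions\<close>

lemma integrable_continuous_compact_support:
  fixes f :: "'a::euclidean_space \<Rightarrow> real"
  assumes "continuous_on UNIV f" "compact K" "\<And>x. x \<notin> K \<Longrightarrow> f x = 0"
  shows "integrable lborel f"
proof -
  have "integrable lborel (\<lambda>x. indicator K x *\<^sub>R f x)"
    using assms by (intro borel_integrable_compact continuous_on_subset[OF assms(1)]) auto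
  also have "(\<lambda>x. indicator K x *\<^sub>R f x) = f"
  proof
    show "indicator K x *\<^sub>R f x = f x" for x using assms(3)[of x] by (cases "x \<in> K") auto
  qed
  finally show ?thesis .
qed

lemma test_functions_integrable: "\<phi> \<in> test_functions \<Omega> \<Longrightarrow> integrable lborel \<phi>"
  by (metis integrable_continuous_compact_support test_functionsE test_functions_continuous)

lemma continuous_compact_support_bounded:
  fixes f :: "'a::euclidean_space \<Rightarrow> real"
  assumes "continuous_on UNIV f" "compact K" "\<And>x. x \<notin> K \<Longrightarrow> f x = 0"
  obtains M where "0 \<le> M" "\<And>x. \<bar>f x\<bar> \<le> M"
proof -
  have "bounded (f ` K)"
    using assms by (intro compact_imp_bounded compact_continuous_image continuous_on_subset[OF assms(1)]) auto
  then obtain M where M: "\<And>x. x \<in> K \<Longrightarrow> \<bar>f x\<bar> \<le> M" by (auto simp: bounded_iff)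
  show thesis
    by (rule that[of "max 0 M"]) (use M assms(3) in \<open>auto simp: max_def, fastforce+\<close>)
qed

lemma test_functions_bounded:
  assumes "\<phi> \<in> test_functions \<Omega>"
  obtains M where "0 \<le> M" "\<And>x. \<bar>\<phi> x\<bar> \<le> M"
  by (metis assms test_functionsE test_functions_continuous continuous_compact_support_bounded)

lemma locally_integrable_mult:
  fixes f :: "'a::euclidean_space \<Rightarrow> real"
  assumes f: "locally_integrable_on f \<Omega>" and "continuous_on UNIV \<phi>" "compact K" "K \<subseteq> \<Omega>"
    and 0: "\<And>x. x \<notin> K \<Longrightarrow> \<phi> x = 0"
  shows "integrable lborel (\<lambda>x. f x * \<phi> x)"
proof -
  have i: "integrable lborel (\<lambda>x. indicator K x *\<^sub>R f x)"
    using assms by (auto simp: locally_integrable_on_def set_integrable_def)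
  obtain M where M: "0 \<le> M" "\<And>x. \<bar>\<phi> x\<bar> \<le> M"
    using continuous_compact_support_bounded[OF assms(2,3) 0] by blast
  have eq: "(\<lambda>x. f x * \<phi> x) = (\<lambda>x. \<phi> x * (indicator K x *\<^sub>R f x))"
  proof
    show "f x * \<phi> x = \<phi> x * (indicator K x *\<^sub>R f x)" for x using 0[of x] by (cases "x \<in> K") auto
  qed
  have "\<phi> \<in> borel_measurable lborel"
    using assms(2) by (simp add: borel_measurable_continuous_onI)
  then show ?thesis
    unfolding eq
    by (intro Bochner_Integration.integrable_bound[OF integrable_mult_right[OF i, of M]])
      (use M i in \<open>auto simp: abs_mult intro!: mult_right_mono borel_measurable_times\<close>)
qed

lemma locally_integrable_mult_test:
  "locally_integrable_on f \<Omega> \<Longrightarrow> \<phi> \<in> test_functions \<Omega> \<Longrightarrow> integrable lborel (\<lambda>x. f x * \<phi> x)"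
  by (metis locally_integrable_mult test_functionsE test_functions_continuous)

lemma continuous_imp_locally_integrable:
  "continuous_on \<Omega> f \<Longrightarrow> locally_integrable_on f \<Omega>"
  unfolding locally_integrable_on_def set_integrable_def
  by (intro allI impI borel_integrable_compact) (auto intro: continuous_on_subset)

lemma lborel_integral_shift:
  fixes f :: "'a::euclidean_space \<Rightarrow> real"
  assumes "f \<in> borel_measurable borel"
  shows "(LINT x|lborel. f (x + a)) = (LINT x|lborel. f x)"
proof -
  have "(LINT x|lborel. f x) = (LINT x|distr lborel borel ((+) a). f x)"
    by (simp add: lborel_distr_plus)
  also have "\<dots> = (LINT x|lborel. f (a + x))"
    using assms by (intro integral_distr) auto
  finally show ?thesis by (simp add: add.commute)
qed

text \<open>Difference quotients of \<open>h\<close> integrate to zero by translation invariance.\<close>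

lemma integral_directional_derivative_eq_0:
  fixes h :: "'a::euclidean_space \<Rightarrow> real"
  assumes ch: "continuous_on UNIV h" and cg: "continuous_on UNIV g"
    and K: "compact K" "\<And>x. x \<notin> K \<Longrightarrow> h x = 0"
    and d: "\<And>x. ((\<lambda>s. h (x + s *\<^sub>R b)) has_real_derivative g x) (at 0)"
  shows "(LINT x|lborel. g x) = 0"
proof -
  have d': "((\<lambda>s. h (x + s *\<^sub>R b)) has_real_derivative g (x + s *\<^sub>R b)) (at s)" for x s
    using DERIV_shift[of "\<lambda>s. h (x + s *\<^sub>R b)" _ 0 s] d[of "x + s *\<^sub>R b"]
    by (simp add: algebra_simps)
  have g0: "g x = 0" if "x \<notin> K" for x
  proof -
    have "((\<lambda>s. 0) has_real_derivative 0) (at 0)" by simp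
    then have "((\<lambda>s. h (x + s *\<^sub>R b)) has_real_derivative 0) (at 0)"
    proof (rule has_field_derivative_transform_within_open[where S="(\<lambda>s. x + s *\<^sub>R b) -` (- K)"])
      show "open ((\<lambda>s. x + s *\<^sub>R b) -` (- K))"
        using K(1) by (intro open_vimage continuous_intros) (auto intro: compact_imp_closed)
      show "0 = h (x + s *\<^sub>R b)" if "s \<in> (\<lambda>s. x + s *\<^sub>R b) -` (- K)" for s
        using K(2)[of "x + s *\<^sub>R b"] that by simp
    qed (use that in simp)
    with d[of x] show ?thesis using DERIV_unique by blast
  qed
  obtain M where M: "0 \<le> M" "\<And>x. \<bar>g x\<bar> \<le> M"
    using continuous_compact_support_bounded[OF cg K(1) g0] by blast
  \<comment> \<open>\<open>K\<close> swept along -b: every difference quotient with step at most 1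
    vanishes outside it, which gives one integrable majorant for all n.\<close>
  define K' where "K' = (\<lambda>(x, s). x + s *\<^sub>R b) ` (K \<times> {-1..0})"
  have K': "compact K'"
    unfolding K'_def case_prod_beta
    by (intro compact_continuous_image compact_Times K compact_Icc continuous_intros)
  define q where "q n x = real (Suc n) * (h (x + (1 / real (Suc n)) *\<^sub>R b) - h x)" for n x
  have mean: "\<exists>s\<in>{0..1}. q n x = g (x + s *\<^sub>R b)" for n x
  proof -
    have "\<exists>z. 0 < z \<and> z < 1 / real (Suc n) \<and>
        h (x + (1 / real (Suc n)) *\<^sub>R b) - h (x + 0 *\<^sub>R b) = (1 / real (Suc n) - 0) * g (x + z *\<^sub>R b)"
      by (rule MVT2) (use d' in auto)
    then obtain z where z: "0 < z" "z < 1 / real (Suc n)" "q n x = g (x + z *\<^sub>R b)"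
      by (auto simp: q_def field_simps)
    have "1 / real (Suc n) \<le> 1" by simp
    then have "z \<le> 1" using z(2) by linarith
    then show ?thesis using z by (intro bexI[of _ z]) auto
  qed
  have bound: "\<bar>q n x\<bar> \<le> M * indicator K' x" for n x
  proof -
    obtain s where s: "s \<in> {0..1}" "q n x = g (x + s *\<^sub>R b)" using mean by blast
    show ?thesis
    proof (cases "x + s *\<^sub>R b \<in> K")
      case True
      then have "x \<in> K'"
        using s unfolding K'_def by (intro image_eqI[of _ _ "(x + s *\<^sub>R b, - s)"]) auto
      then show ?thesis using M s by simp
    next
      case False
      then show ?thesis using g0 s M by simp
    qed
  qed
  have mb: "h \<in> borel_measurable borel" "g \<in> borel_measurable borel"
    using ch cg by (auto intro: borel_measurable_continuous_onI)
  have qm: "q n \<in> borel_measurable lborel" for n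
    unfolding q_def[abs_def] using mb by measurable
  have ih: "integrable lborel h"
    using integrable_continuous_compact_support[OF ch K] .
  have "(\<lambda>n. LINT x|lborel. q n x) \<longlonglongrightarrow> (LINT x|lborel. g x)"
  proof (rule integral_dominated_convergence[where w="\<lambda>x. M * indicator K' x"])
    show "integrable lborel (\<lambda>x. M * indicator K' x :: real)"
      using K' by (auto intro!: integrable_mult_right integrable_real_indicator emeasure_compact_finite
          borel_compact)
    show "AE x in lborel. (\<lambda>n. q n x) \<longlonglongrightarrow> g x"
    proof (rule AE_I2)
      fix x
      have "(\<lambda>n. (h (x + (0 + inverse (real (Suc n))) *\<^sub>R b) - h (x + 0 *\<^sub>R b)) / inverse (real (Suc n))) \<longlonglongrightarrow> g x"
      proof (rule filterlim_compose[OF d[of x, unfolded DERIV_def]])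
        show "filterlim (\<lambda>n. inverse (real (Suc n))) (at 0) sequentially"
          using LIMSEQ_inverse_real_of_nat by (auto simp: filterlim_at)
      qed
      then show "(\<lambda>n. q n x) \<longlonglongrightarrow> g x" by (simp add: q_def field_simps)
    qed
  qed (use mb qm bound in auto)
  moreover have "(LINT x|lborel. q n x) = 0" for n
  proof -
    let ?a = "(1 / real (Suc n)) *\<^sub>R b"
    have "integrable lborel (\<lambda>x. h (x + ?a))"
    proof (rule integrable_continuous_compact_support[where K="(\<lambda>x. x - ?a) ` K"])
      show "continuous_on UNIV (\<lambda>x. h (x + ?a))"
        by (rule continuous_on_compose2[OF ch]) (auto intro: continuous_intros)
      show "compact ((\<lambda>x. x - ?a) ` K)"
        by (intro compact_continuous_image K continuous_intros)
      show "x \<notin> (\<lambda>x. x - ?a) ` K \<Longrightarrow> h (x + ?a) = 0" for x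
        by (rule K) (metis add_diff_cancel image_eqI)
    qed
    then show ?thesis
      using ih lborel_integral_shift[OF mb(1), of ?a] by (simp add: q_def)
  qed
  ultimately show ?thesis by (simp add: LIMSEQ_const_iff)
qed

text \<open>Integration by parts: the product of f and a test function is continuous with compact
  support, so its derivative along b integrates to zero. Working in the single direction b allows
  space and time derivatives to be treated separately.\<close>

lemma weak_deriv_classical:
  fixes f :: "'a::euclidean_space \<Rightarrow> real"
  assumes \<Omega>: "open \<Omega>" and f: "continuous_on \<Omega> f" and g: "continuous_on \<Omega> g"
    and d: "\<And>x. x \<in> \<Omega> \<Longrightarrow> ((\<lambda>s. f (x + s *\<^sub>R b)) has_real_derivative g x) (at 0)"
  shows "weak_deriv \<Omega> b f g"
  unfolding weak_deriv_def
proof (intro conjI ballI)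
  show lf: "locally_integrable_on f \<Omega>" and lg: "locally_integrable_on g \<Omega>"
    using f g by (auto intro: continuous_imp_locally_integrable)
  fix \<phi> assume \<phi>: "\<phi> \<in> test_functions \<Omega>"
  then obtain K where K: "compact K" "K \<subseteq> \<Omega>" "\<And>x. x \<notin> K \<Longrightarrow> \<phi> x = 0" "\<And>b x. x \<notin> K \<Longrightarrow> pd b \<phi> x = 0"
    by (rule test_functionsE) blast
  \<comment> \<open>Continuity on the whole space is glued from \<Omega>, where both factors are
    continuous, and the complement of \<open>K\<close>, where the product is 0; \<open>u\<close> is
    arbitrary outside \<Omega>.\<close>
  have ext: "continuous_on UNIV (\<lambda>x. u x * \<psi> x)"
    if "continuous_on \<Omega> u" "\<psi> \<in> test_functions \<Omega>" "\<And>x. x \<notin> K \<Longrightarrow> \<psi> x = 0" for u \<psi>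
  proof -
    have "continuous_on (\<Omega> \<union> - K) (\<lambda>x. u x * \<psi> x)"
    proof (rule continuous_on_open_Un)
      show "continuous_on \<Omega> (\<lambda>x. u x * \<psi> x)"
        by (intro continuous_on_mult that(1) continuous_on_subset[OF test_functions_continuous[OF that(2)]]) simp
      show "continuous_on (- K) (\<lambda>x. u x * \<psi> x)"
        using that(3) by (subst continuous_on_cong[OF refl, where g="\<lambda>_. 0"]) auto
    qed (use \<Omega> K(1) in \<open>auto intro: compact_imp_closed\<close>)
    moreover have "\<Omega> \<union> - K = UNIV" using K by auto
    ultimately show ?thesis by simp
  qed
  have c: "continuous_on UNIV (\<lambda>x. f x * \<phi> x)" "continuous_on UNIV (\<lambda>x. f x * pd b \<phi> x)"
    "continuous_on UNIV (\<lambda>x. g x * \<phi> x)"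
    by (rule ext[OF f \<phi>], use K(3) in blast, rule ext[OF f test_functions_pd[OF \<phi>]], use K(4) in blast,
        rule ext[OF g \<phi>], use K(3) in blast)
  have "(LINT x|lborel. f x * pd b \<phi> x + g x * \<phi> x) = 0"
  proof (rule integral_directional_derivative_eq_0[OF c(1) _ K(1)])
    show "continuous_on UNIV (\<lambda>x. f x * pd b \<phi> x + g x * \<phi> x)"
      by (rule continuous_on_add[OF c(2,3)])
    show "x \<notin> K \<Longrightarrow> f x * \<phi> x = 0" for x using K(3)[of x] by simp
    fix x
    show "((\<lambda>s. f (x + s *\<^sub>R b) * \<phi> (x + s *\<^sub>R b)) has_real_derivative f x * pd b \<phi> x + g x * \<phi> x) (at 0)"
    proof (cases "x \<in> \<Omega>")
      case True
      have "((\<lambda>s. \<phi> (x + s *\<^sub>R b)) has_real_derivative pd b \<phi> x) (at 0)"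
        using has_real_derivative_along_line[OF test_functions_differentiable[OF \<phi>], where x=x and s=0 and b=b] by simp
      from DERIV_mult[OF d[OF True] this] show ?thesis
        by (simp add: algebra_simps)
    next
      case False
      then have x: "x \<in> - K" using K by auto
      have "((\<lambda>s. 0) has_real_derivative 0) (at 0)" by simp
      then have "((\<lambda>s. f (x + s *\<^sub>R b) * \<phi> (x + s *\<^sub>R b)) has_real_derivative 0) (at 0)"
      proof (rule has_field_derivative_transform_within_open[where S="(\<lambda>s. x + s *\<^sub>R b) -` (- K)"])
        show "open ((\<lambda>s. x + s *\<^sub>R b) -` (- K))"
          using K(1) by (intro open_vimage continuous_intros) (auto intro: compact_imp_closed)
        show "0 = f (x + s *\<^sub>R b) * \<phi> (x + s *\<^sub>R b)" if "s \<in> (\<lambda>s. x + s *\<^sub>R b) -` (- K)" for s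
          using K(3)[of "x + s *\<^sub>R b"] that by simp
      qed (use x in simp)
      then show ?thesis using x K(3)[of x] K(4)[of x b] by simp
    qed
  qed
  moreover have "integrable lborel (\<lambda>x. f x * pd b \<phi> x)" "integrable lborel (\<lambda>x. g x * \<phi> x)"
    using \<phi> lf lg by (auto intro: locally_integrable_mult_test test_functions_pd)
  ultimately show "(LINT x|lborel. f x * pd b \<phi> x) = - (LINT x|lborel. g x * \<phi> x)"
    by simp
qed

section \<open>Mollification\<close>

text \<open>A uniform quadratic remainder is the form in which derivatives are obtained below, under
  integrals as well as for potentials: integrating the remainder bound replaces an exchange of
  limits.\<close>

lemma has_derivative_quadratic:
  fixes f :: "'a::euclidean_space \<Rightarrow> 'b::real_normed_vector"
  assumes "bounded_linear D" "0 < \<delta>" "0 \<le> K"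
    and "\<And>h. norm h < \<delta> \<Longrightarrow> norm (f (x + h) - f x - D h) \<le> K * (norm h)\<^sup>2"
  shows "(f has_derivative D) (at x)"
proof (rule has_derivativeI_sandwich[OF \<open>0 < \<delta>\<close> assms(1)])
  show "(\<lambda>y. K * norm (y - x)) \<midarrow>x\<rightarrow> 0"
    by (auto intro!: tendsto_eq_intros)
  fix y assume y: "y \<noteq> x" "dist y x < \<delta>"
  have "norm (f y - f x - D (y - x)) \<le> K * (norm (y - x))\<^sup>2"
    using assms(4)[of "y - x"] y by (simp add: dist_norm)
  then show "norm (f y - f x - D (y - x)) / norm (y - x) \<le> K * norm (y - x)"
    using y by (simp add: divide_le_eq power2_eq_square mult.assoc)
qed

lemma abs_pd_le:
  assumes "f differentiable (at x)"
  shows "\<bar>pd h f x\<bar> \<le> norm h * (\<Sum>e\<in>Basis. \<bar>pd e f x\<bar>)"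
proof -
  have "\<bar>pd h f x\<bar> \<le> (\<Sum>e\<in>Basis. \<bar>(h \<bullet> e) * pd e f x\<bar>)"
    unfolding pd_Basis_sum[OF assms, of h] by (rule sum_abs)
  also have "\<dots> \<le> (\<Sum>e\<in>Basis. norm h * \<bar>pd e f x\<bar>)"
    by (intro sum_mono) (auto simp: abs_mult Basis_le_norm intro!: mult_right_mono)
  finally show ?thesis by (simp add: sum_distrib_left)
qed

text \<open>Expanding h twice in the basis reduces the claim to finitely many bounded functions and
  makes the bound quadratic in h and uniform in x.\<close>

lemma second_pd_bound:
  assumes \<rho>: "\<rho> \<in> test_functions \<Omega>"
  obtains K where "0 \<le> K" "\<And>h x. \<bar>pd h (pd h \<rho>) x\<bar> \<le> K * (norm h)\<^sup>2"
proof -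
  have "\<exists>M. 0 \<le> M \<and> (\<forall>x. \<bar>pd e (pd b \<rho>) x\<bar> \<le> M)" for e b
    using test_functions_bounded[OF test_functions_pd[OF test_functions_pd[OF \<rho>]]] by metis
  then obtain M where M: "\<And>e b. 0 \<le> M e b" "\<And>e b x. \<bar>pd e (pd b \<rho>) x\<bar> \<le> M e b" by metis
  let ?K = "\<Sum>e\<in>Basis. \<Sum>b\<in>Basis. M e b"
  have "\<bar>pd h (pd h \<rho>) x\<bar> \<le> ?K * (norm h)\<^sup>2" for h x
  proof -
    have eq: "pd h \<rho> = (\<lambda>x. \<Sum>b\<in>Basis. (h \<bullet> b) * pd b \<rho> x)"
      by (intro ext pd_Basis_sum test_functions_differentiable[OF \<rho>])
    have "pd e (pd h \<rho>) x = (\<Sum>b\<in>Basis. (h \<bullet> b) * pd e (pd b \<rho>) x)" for e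
      unfolding eq
      by (rule pd_eqI[where D="\<lambda>k. \<Sum>b\<in>Basis. (h \<bullet> b) * pd k (pd b \<rho>) x"])
        (intro has_derivative_sum has_derivative_mult_right has_derivative_pd
          test_functions_differentiable[OF test_functions_pd[OF \<rho>]])
    then have "\<bar>pd e (pd h \<rho>) x\<bar> \<le> (\<Sum>b\<in>Basis. \<bar>(h \<bullet> b) * pd e (pd b \<rho>) x\<bar>)" for e
      by (simp add: sum_abs)
    also have "(\<Sum>b\<in>Basis. \<bar>(h \<bullet> b) * pd e (pd b \<rho>) x\<bar>) \<le> (\<Sum>b\<in>Basis. norm h * M e b)" for e
      using M by (intro sum_mono) (auto simp: abs_mult Basis_le_norm intro!: mult_mono)
    finally have 1: "\<bar>pd e (pd h \<rho>) x\<bar> \<le> norm h * (\<Sum>b\<in>Basis. M e b)" for e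
      by (simp add: sum_distrib_left)
    have "\<bar>pd h (pd h \<rho>) x\<bar> \<le> norm h * (\<Sum>e\<in>Basis. \<bar>pd e (pd h \<rho>) x\<bar>)"
      by (rule abs_pd_le[OF test_functions_differentiable[OF test_functions_pd[OF \<rho>]]])
    also have "\<dots> \<le> norm h * (\<Sum>e\<in>Basis. norm h * (\<Sum>b\<in>Basis. M e b))"
      by (intro mult_left_mono sum_mono 1) auto
    finally show ?thesis by (simp add: sum_distrib_left power2_eq_square mult_ac)
  qed
  then show thesis using that[of ?K] M by (simp add: sum_nonneg)
qed

lemma test_function_Taylor:
  assumes \<rho>: "\<rho> \<in> test_functions \<Omega>"
  obtains K where "0 \<le> K" "\<And>x h. \<bar>\<rho> (x + h) - \<rho> x - pd h \<rho> x\<bar> \<le> K * (norm h)\<^sup>2"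
proof -
  obtain K where K: "0 \<le> K" "\<And>h x. \<bar>pd h (pd h \<rho>) x\<bar> \<le> K * (norm h)\<^sup>2"
    using second_pd_bound[OF \<rho>] by blast
  have "\<bar>\<rho> (x + h) - \<rho> x - pd h \<rho> x\<bar> \<le> K * (norm h)\<^sup>2" for x h
  proof -
    note d = has_real_derivative_along_line[OF test_functions_differentiable]
    obtain s where s: "0 < s" "s < 1" "\<rho> (x + 1 *\<^sub>R h) - \<rho> (x + 0 *\<^sub>R h) = (1 - 0) * pd h \<rho> (x + s *\<^sub>R h)"
      using MVT2[of 0 1 "\<lambda>s. \<rho> (x + s *\<^sub>R h)" "\<lambda>s. pd h \<rho> (x + s *\<^sub>R h)"] d[OF \<rho>] by auto
    obtain r where r: "0 < r" "r < s"
      "pd h \<rho> (x + s *\<^sub>R h) - pd h \<rho> (x + 0 *\<^sub>R h) = (s - 0) * pd h (pd h \<rho>) (x + r *\<^sub>R h)"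
      using MVT2[OF s(1), of "\<lambda>s. pd h \<rho> (x + s *\<^sub>R h)" "\<lambda>s. pd h (pd h \<rho>) (x + s *\<^sub>R h)"]
        d[OF test_functions_pd[OF \<rho>]] by auto
    have "\<bar>\<rho> (x + h) - \<rho> x - pd h \<rho> x\<bar> = s * \<bar>pd h (pd h \<rho>) (x + r *\<^sub>R h)\<bar>"
      using s r by (simp add: abs_mult)
    also have "\<dots> \<le> 1 * (K * (norm h)\<^sup>2)"
      using s K by (intro mult_mono) auto
    finally show ?thesis by simp
  qed
  then show thesis using that K(1) by blast
qed

lemma integrable_mult_translate:
  fixes f :: "'a::euclidean_space \<Rightarrow> real"
  assumes f: "integrable lborel f" and \<rho>: "\<rho> \<in> test_functions \<Omega>"
  shows "integrable lborel (\<lambda>y. f y * \<rho> (z - y))"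
proof -
  obtain M where M: "0 \<le> M" "\<And>x. \<bar>\<rho> x\<bar> \<le> M" using test_functions_bounded[OF \<rho>] by blast
  have [measurable]: "\<rho> \<in> borel_measurable borel"
    using test_functions_continuous[OF \<rho>] by (rule borel_measurable_continuous_onI)
  show ?thesis
    by (rule Bochner_Integration.integrable_bound[OF integrable_mult_right[OF f, of M]])
      (use M f in \<open>auto simp: abs_mult mult.commute[of M] intro!: mult_left_mono borel_measurable_times\<close>)
qed

lemma has_derivative_mollify:
  fixes f :: "'a::euclidean_space \<Rightarrow> real"
  assumes f: "integrable lborel f" and \<rho>: "\<rho> \<in> test_functions \<Omega>"
  shows "((\<lambda>z. LINT y|lborel. f y * \<rho> (z - y)) has_derivative
    (\<lambda>h. LINT y|lborel. f y * pd h \<rho> (z - y))) (at z)"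
proof -
  obtain K where K: "0 \<le> K" "\<And>x h. \<bar>\<rho> (x + h) - \<rho> x - pd h \<rho> x\<bar> \<le> K * (norm h)\<^sup>2"
    using test_function_Taylor[OF \<rho>] by blast
  note i = integrable_mult_translate[OF f]
  let ?I = "LINT y|lborel. \<bar>f y\<bar>"
  show ?thesis
  proof (rule has_derivative_quadratic[where \<delta>=1 and K="K * ?I"])
    note l = pd_linear[OF test_functions_differentiable[OF \<rho>]]
    show "bounded_linear (\<lambda>h. LINT y|lborel. f y * pd h \<rho> (z - y))"
    proof (rule linear_conv_bounded_linear[THEN iffD1], rule linearI)
      show "(LINT y|lborel. f y * pd (a + b) \<rho> (z - y)) =
        (LINT y|lborel. f y * pd a \<rho> (z - y)) + (LINT y|lborel. f y * pd b \<rho> (z - y))" for a b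
        unfolding linear_add[OF l] distrib_left
        by (rule Bochner_Integration.integral_add[OF i[OF test_functions_pd[OF \<rho>]] i[OF test_functions_pd[OF \<rho>]]])
      show "(LINT y|lborel. f y * pd (c *\<^sub>R a) \<rho> (z - y)) = c *\<^sub>R (LINT y|lborel. f y * pd a \<rho> (z - y))" for a c
        by (simp add: linear_scale[OF l] mult.left_commute)
    qed
    show "norm ((LINT y|lborel. f y * \<rho> (z + h - y)) - (LINT y|lborel. f y * \<rho> (z - y)) -
        (LINT y|lborel. f y * pd h \<rho> (z - y))) \<le> K * ?I * (norm h)\<^sup>2" for h
    proof -
      let ?r = "\<lambda>y. f y * (\<rho> (z - y + h) - \<rho> (z - y) - pd h \<rho> (z - y))"
      have eq: "z + h - y = z - y + h" for y by simp
      have "(LINT y|lborel. f y * \<rho> (z + h - y)) - (LINT y|lborel. f y * \<rho> (z - y)) -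
        (LINT y|lborel. f y * pd h \<rho> (z - y)) = (LINT y|lborel. ?r y)"
        using i[OF \<rho>, of "z + h"] i[OF \<rho>, of z] i[OF test_functions_pd[OF \<rho>], where z=z and b1=h]
        by (simp add: right_diff_distrib eq)
      moreover have "norm (LINT y|lborel. ?r y) \<le> (LINT y|lborel. \<bar>f y\<bar> * (K * (norm h)\<^sup>2))"
      proof (rule Bochner_Integration.integral_norm_bound_integral)
        show "integrable lborel ?r"
          using i[OF \<rho>, of "z + h"] i[OF \<rho>, of z] i[OF test_functions_pd[OF \<rho>], where z=z and b1=h]
          by (simp add: right_diff_distrib eq)
        show "integrable lborel (\<lambda>y. \<bar>f y\<bar> * (K * (norm h)\<^sup>2))" using f by simp
        show "norm (?r y) \<le> \<bar>f y\<bar> * (K * (norm h)\<^sup>2)" for y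
          unfolding real_norm_def abs_mult by (intro mult_left_mono K) auto
      qed
      ultimately show ?thesis by (simp add: mult_ac)
    qed
  qed (use K in auto)
qed

text \<open>The function y -> \<rho> (z - y) is a test function on \<Omega> because the ball around
  z lies in \<Omega>; the sign from the reflection cancels the sign in the definition of the weak
  derivative.\<close>

lemma weak_deriv_mollify:
  fixes f :: "'a::euclidean_space \<Rightarrow> real"
  assumes w: "weak_deriv \<Omega> b f g" and \<rho>: "\<rho> \<in> test_functions UNIV"
    and s: "\<And>x. e < norm x \<Longrightarrow> \<rho> x = 0" and b: "cball z e \<subseteq> \<Omega>"
  shows "(LINT y|lborel. f y * pd b \<rho> (z - y)) = (LINT y|lborel. g y * \<rho> (z - y))"
proof -
  have L: "bounded_linear (\<lambda>y::'a. - y)" by (simp add: bounded_linear_minus)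
  have "(\<lambda>y. \<rho> (z + - y)) \<in> test_functions \<Omega>"
    by (rule test_functions_affine[OF \<rho> L compact_cball b]) (auto intro!: s simp: dist_norm)
  then have \<phi>: "(\<lambda>y. \<rho> (z - y)) \<in> test_functions \<Omega>" by simp
  have "pd b (\<lambda>y. \<rho> (z - y)) y = - pd b \<rho> (z - y)" for y
    using pd_affine[OF L, of \<rho> z y b] test_functions_differentiable[OF \<rho>, of "z - y"]
    by (simp add: linear_neg[OF pd_linear])
  moreover have "(LINT y|lborel. f y * pd b (\<lambda>y. \<rho> (z - y)) y) = - (LINT y|lborel. g y * \<rho> (z - y))"
    using w \<phi> by (simp add: weak_deriv_def)
  ultimately show ?thesis by simp
qed

section \<open>Affine changes of variables and exceptional null sets\<close>

lemma lborel_integral_affine: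
  fixes f :: "'a::euclidean_space \<Rightarrow> real"
  assumes [measurable]: "f \<in> borel_measurable borel" and c: "c \<noteq> 0"
  shows "(LINT x|lborel. f x) = \<bar>c\<bar> ^ DIM('a) * (LINT x|lborel. f (t + c *\<^sub>R x))"
proof -
  have "(LINT x|lborel. f x) = (LINT x|density (distr lborel borel (\<lambda>x. t + c *\<^sub>R x)) (\<lambda>_. ennreal (\<bar>c\<bar>^DIM('a))). f x)"
    using lborel_affine[OF c, of t] by (simp add: ennreal_power)
  also have "\<dots> = \<bar>c\<bar> ^ DIM('a) * (LINT x|lborel. f (t + c *\<^sub>R x))"
    by (subst integral_density) (auto simp: integral_distr)
  finally show ?thesis .
qed

lemma lborel_integral_reflect:
  fixes f :: "'a::euclidean_space \<Rightarrow> real"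
  assumes "f \<in> borel_measurable borel"
  shows "(LINT x|lborel. f (z - x)) = (LINT x|lborel. f x)"
  using lborel_integral_affine[OF assms, of "-1" z] by simp

lemma AE_open_imp_all:
  fixes U :: "'a::euclidean_space set"
  assumes "AE x in lborel. x \<in> U \<longrightarrow> P x" "open U" "x \<in> U" "closed {x. P x}"
  shows "P x"
proof -
  have "AE x in lebesgue. x \<in> U \<longrightarrow> x \<in> {x. P x}"
    using assms(1) by (simp add: AE_completion)
  from mem_closed_if_AE_lebesgue_open[OF assms(2,4) this assms(3)] show ?thesis by simp
qed

lemma AE_open_obtain:
  fixes U :: "'a::euclidean_space set"
  assumes "AE x in lborel. P x" "open U" "U \<noteq> {}"
  obtains x where "x \<in> U" "P x"
proof (rule ccontr)
  assume "\<not> thesis"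
  then have n: "\<And>x. x \<in> U \<Longrightarrow> \<not> P x" using that by blast
  have "AE x in lborel. x \<in> U \<longrightarrow> False" using assms(1) by eventually_elim (use n in auto)
  from AE_open_imp_all[OF this assms(2)] assms(3) show False by auto
qed

lemma integral_continuous_pos:
  fixes f :: "'a::euclidean_space \<Rightarrow> real"
  assumes "continuous_on UNIV f" "integrable lborel f" "\<And>x. 0 \<le> f x" "0 < f x"
  shows "0 < (LINT x|lborel. f x)"
proof (rule ccontr)
  assume "\<not> ?thesis"
  moreover have "0 \<le> (LINT x|lborel. f x)" using assms by (intro integral_nonneg_AE) auto
  ultimately have "(LINT x|lborel. f x) = 0" by linarith
  then have "AE x in lborel. f x = 0"
    using integral_nonneg_eq_0_iff_AE[OF assms(2)] assms(3) by simp
  then have "AE x in lborel. x \<in> UNIV \<longrightarrow> f x \<le> 0" by eventually_elim simp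
  from AE_open_imp_all[OF this] have "f x \<le> 0"
    using assms(1) by (simp add: closed_Collect_le)
  then show False using assms(4) by simp
qed

section \<open>The normalised mollification kernel\<close>

text \<open>Normalising by the integral of the rescaled bump, rather than by a power of
  \<open>e\<close>, gives unit mass without a scaling of variables;
  \<open>mollifier_scaled_eq_mol\<close> later reconciles it with the kernel in the definition of
  \<open>P0_infty\<close>.\<close>

definition mol :: "real \<Rightarrow> 'a::euclidean_space \<Rightarrow> real" where
  "mol e x = (1 / (LINT y|lborel. rbump ((1 / e) *\<^sub>R (y::'a)))) * rbump ((1 / e) *\<^sub>R x)"

lemma rbump_scaled_test_function:
  assumes "0 < e"
  shows "(\<lambda>x::'a::euclidean_space. rbump ((1 / e) *\<^sub>R x)) \<in> test_functions UNIV"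
proof -
  have "(\<lambda>x::'a. rbump (0 + (1 / e) *\<^sub>R x)) \<in> test_functions UNIV"
    by (rule test_functions_affine[OF rbump_test_function _ compact_cball[of 0 e]])
      (use assms in \<open>auto intro!: rbump_eq_0 bounded_linear_scaleR_right simp: field_simps\<close>)
  then show ?thesis by simp
qed

lemma integral_rbump_scaled_pos:
  assumes "0 < e"
  shows "0 < (LINT y|lborel. rbump ((1 / e) *\<^sub>R (y::'a::euclidean_space)))"
  using rbump_scaled_test_function[OF assms, where 'a='a]
  by (intro integral_continuous_pos[of _ 0] test_functions_continuous test_functions_integrable)
    (auto intro: rbump_nonneg rbump_pos)

lemma mol_test_function: "0 < e \<Longrightarrow> mol e \<in> test_functions UNIV"
  unfolding mol_def[abs_def] by (intro test_functions_cmult rbump_scaled_test_function)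

lemma mol_nonneg: "0 < e \<Longrightarrow> 0 \<le> mol e x"
  unfolding mol_def by (intro mult_nonneg_nonneg rbump_nonneg) (simp add: integral_rbump_scaled_pos less_imp_le)

lemma mol_eq_0: "0 < e \<Longrightarrow> e \<le> norm x \<Longrightarrow> mol e x = 0"
  by (simp add: mol_def rbump_eq_0 field_simps)

lemma mol_measurable: "0 < e \<Longrightarrow> mol e \<in> borel_measurable borel"
  using test_functions_continuous[OF mol_test_function] by (intro borel_measurable_continuous_onI)

lemma integral_mol: "0 < e \<Longrightarrow> (LINT x|lborel. mol e (z - x)) = 1"
  using integral_rbump_scaled_pos[of e, where 'a='a]
  by (subst lborel_integral_reflect) (simp_all add: mol_measurable, simp add: mol_def[abs_def])

lemma integrable_mol: "0 < e \<Longrightarrow> integrable lborel (\<lambda>x. mol e (z - x))"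
  using integral_mol[of e z] not_integrable_integral_eq[of lborel "\<lambda>x. mol e (z - x)"] by fastforce

lemma mol_bound:
  assumes e: "0 < e" and g: "AE y in lborel. y \<in> cball z e \<longrightarrow> \<bar>g y\<bar> \<le> \<eta>"
  shows "\<bar>LINT y|lborel. g y * mol e (z - y)\<bar> \<le> \<eta>"
proof (cases "integrable lborel (\<lambda>y. g y * mol e (z - y))")
  case True
  have "norm (LINT y|lborel. g y * mol e (z - y)) \<le> (LINT y|lborel. norm (g y * mol e (z - y)))"
    by (rule integral_norm_bound)
  also have "\<dots> \<le> (LINT y|lborel. \<eta> * mol e (z - y))"
  proof (rule integral_mono_AE)
    show "AE y in lborel. norm (g y * mol e (z - y)) \<le> \<eta> * mol e (z - y)"
      using g
    proof eventually_elim
      case (elim y)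
      show ?case
      proof (cases "y \<in> cball z e")
        case True
        then show ?thesis
          using elim mol_nonneg[OF e, of "z - y"] by (auto simp: abs_mult intro: mult_right_mono)
      next
        case False
        then have "mol e (z - y) = 0" by (intro mol_eq_0 e) (simp add: dist_norm)
        then show ?thesis by simp
      qed
    qed
  qed (use True integrable_mol[OF e, of z] in auto)
  also have "\<dots> = \<eta>" by (simp add: integral_mol[OF e])
  finally show ?thesis by simp
next
  case False
  \<comment> \<open>A non-integrable integrand has integral 0 by default, so it remains to see that
    \<eta> is nonnegative; any point of the ball where the bound holds shows this.\<close>
  obtain y where "y \<in> ball z e" "y \<in> cball z e \<longrightarrow> \<bar>g y\<bar> \<le> \<eta>"
    using AE_open_obtain[OF g open_ball] e by (metis ball_eq_empty not_le)
  then have "0 \<le> \<eta>" by auto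
  then show ?thesis using False by (simp add: not_integrable_integral_eq)
qed

lemma mol_approx:
  assumes e: "0 < e" and f: "AE y in lborel. y \<in> cball z e \<longrightarrow> \<bar>f y - c\<bar> \<le> \<eta>"
    and i: "integrable lborel (\<lambda>y. f y * mol e (z - y))"
  shows "\<bar>(LINT y|lborel. f y * mol e (z - y)) - c\<bar> \<le> \<eta>"
proof -
  have "(LINT y|lborel. f y * mol e (z - y)) - c = (LINT y|lborel. (f y - c) * mol e (z - y))"
    using i integrable_mol[OF e, of z] by (simp add: left_diff_distrib integral_mol[OF e])
  then show ?thesis using mol_bound[OF e f] by simp
qed

lemma integral_cutoff:
  fixes f :: "'a::euclidean_space \<Rightarrow> real"
  assumes "cball z e \<subseteq> K" "\<And>x. e < norm x \<Longrightarrow> \<psi> x = 0"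
  shows "(LINT y|lborel. indicator K y *\<^sub>R f y * \<psi> (z - y)) = (LINT y|lborel. f y * \<psi> (z - y))"
proof -
  have "indicator K y *\<^sub>R f y * \<psi> (z - y) = f y * \<psi> (z - y)" for y
  proof (cases "y \<in> cball z e")
    case True
    then have "y \<in> K" using assms by blast
    then show ?thesis by simp
  next
    case False
    then have "\<psi> (z - y) = 0" by (intro assms) (simp add: dist_norm)
    then show ?thesis by simp
  qed
  then show ?thesis by (intro Bochner_Integration.integral_cong refl)
qed

lemma test_functions_pd_eq_0:
  assumes "\<rho> \<in> test_functions \<Omega>" "\<And>x. e \<le> norm x \<Longrightarrow> \<rho> x = 0" "e < norm x"
  shows "pd b \<rho> x = 0"
proof -
  have "(\<rho> has_derivative (\<lambda>_. 0)) (at x)"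
  proof (rule has_derivative_transform_within_open[of "\<lambda>_. 0" _ _ _ "- cball 0 e"])
    show "0 = \<rho> y" if "y \<in> - cball 0 e" for y using assms(2)[of y] that by simp
  qed (use assms in \<open>auto simp: open_Compl\<close>)
  then show ?thesis by (rule pd_eqI)
qed

text \<open>The convolution is taken with a cut-off of \<open>f\<close>, which makes it globally smooth; its derivatives
  see the weak derivatives of \<open>f\<close> as long as the support of the kernel stays inside \<open>K\<close>.\<close>

lemma has_derivative_mol_weak:
  fixes f :: "'a::euclidean_space \<Rightarrow> real"
  assumes f: "locally_integrable_on f \<Omega>" and K: "compact K" "K \<subseteq> \<Omega>"
    and e: "0 < e" "cball z e \<subseteq> K" and w: "\<And>b. b \<in> B \<Longrightarrow> weak_deriv \<Omega> b f (g b)"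
  obtains D where
    "((\<lambda>z. LINT y|lborel. indicator K y *\<^sub>R f y * mol e (z - y)) has_derivative D) (at z)"
    "\<And>b. b \<in> B \<Longrightarrow> D b = (LINT y|lborel. g b y * mol e (z - y))"
proof
  have "integrable lborel (\<lambda>y. indicator K y *\<^sub>R f y)"
    using f K by (auto simp: locally_integrable_on_def set_integrable_def)
  from has_derivative_mollify[OF this mol_test_function[OF e(1)]]
  show "((\<lambda>z. LINT y|lborel. indicator K y *\<^sub>R f y * mol e (z - y)) has_derivative
    (\<lambda>h. LINT y|lborel. indicator K y *\<^sub>R f y * pd h (mol e) (z - y))) (at z)" .
  show "(LINT y|lborel. indicator K y *\<^sub>R f y * pd b (mol e) (z - y)) = (LINT y|lborel. g b y * mol e (z - y))"
    if "b \<in> B" for b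
  proof -
    have "(LINT y|lborel. indicator K y *\<^sub>R f y * pd b (mol e) (z - y)) =
        (LINT y|lborel. f y * pd b (mol e) (z - y))"
      by (rule integral_cutoff[OF e(2)])
        (rule test_functions_pd_eq_0[OF mol_test_function[OF e(1)] mol_eq_0[OF e(1)]])
    also have "\<dots> = (LINT y|lborel. g b y * mol e (z - y))"
    proof (rule weak_deriv_mollify)
      show "weak_deriv \<Omega> b f (g b)" using w that by blast
      show "mol e x = 0" if "e < norm x" for x :: 'a using mol_eq_0[OF e(1), of x] that by simp
    qed (use e K mol_test_function in auto)
    finally show ?thesis .
  qed
qed

lemma has_real_derivative_line_comp:
  assumes "(f has_derivative D) (at (z + s *\<^sub>R b))"
  shows "((\<lambda>s. f (z + s *\<^sub>R b)) has_real_derivative D b) (at s)"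
proof -
  have "((\<lambda>s. z + s *\<^sub>R b) has_derivative (\<lambda>h. h *\<^sub>R b)) (at s)"
    by (auto intro!: derivative_eq_intros)
  from has_derivative_compose[OF this assms] show ?thesis
    by (simp add: has_field_derivative_def linear_scale[OF has_derivative_linear[OF assms]] mult_commute_abs)
qed

lemma compact_thicken:
  fixes A :: "'a::euclidean_space set"
  assumes "compact A" "open \<Omega>" "A \<subseteq> \<Omega>"
  obtains d K where "0 < d" "compact K" "K \<subseteq> \<Omega>" "\<And>x. x \<in> A \<Longrightarrow> cball x d \<subseteq> K"
proof -
  obtain d where d: "d > 0" "(\<Union>x\<in>A. cball x d) \<subseteq> \<Omega>"
    using compact_subset_open_imp_cball_epsilon_subset[OF assms] by blast
  have eq: "(\<Union>x\<in>A. cball x d) = (\<lambda>(x, y). x + y) ` (A \<times> cball 0 d)"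
  proof (intro subset_antisym subsetI)
    fix y assume "y \<in> (\<Union>x\<in>A. cball x d)"
    then obtain x where "x \<in> A" "y \<in> cball x d" by blast
    then show "y \<in> (\<lambda>(x, y). x + y) ` (A \<times> cball 0 d)"
      by (intro image_eqI[of _ _ "(x, y - x)"]) (auto simp: dist_norm norm_minus_commute)
  next
    fix y assume "y \<in> (\<lambda>(x, y). x + y) ` (A \<times> cball 0 d)"
    then obtain a b where "y = a + b" "a \<in> A" "norm b \<le> d" by auto
    then show "y \<in> (\<Union>x\<in>A. cball x d)" by (intro UN_I[of a]) (auto simp: dist_norm)
  qed
  have "compact (\<Union>x\<in>A. cball x d)"
    unfolding eq case_prod_beta
    by (intro compact_continuous_image compact_Times assms compact_cball continuous_intros)
  then show thesis using d that[of d "\<Union>x\<in>A. cball x d"] by blast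
qed

text \<open>Mollification makes the derivative along b classical, still bounded by C, and the mean
  value theorem applies on the segment; uniform continuity of f near the segment lets the kernel
  shrink. C bounds the derivative along the full vector b, so no length appears.\<close>

lemma weak_deriv_bounded_imp_increment_bounded:
  fixes f :: "'a::euclidean_space \<Rightarrow> real"
  assumes \<Omega>: "open \<Omega>" and w: "weak_deriv \<Omega> b f g" and f: "continuous_on \<Omega> f"
    and g: "AE y in lborel. y \<in> \<Omega> \<longrightarrow> \<bar>g y\<bar> \<le> C"
    and seg: "\<And>s. 0 \<le> s \<Longrightarrow> s \<le> 1 \<Longrightarrow> z + s *\<^sub>R b \<in> \<Omega>"
  shows "\<bar>f (z + b) - f z\<bar> \<le> C"
proof (rule field_le_epsilon)
  fix \<eta> :: real assume \<eta>: "0 < \<eta>"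
  define A where "A = (\<lambda>s. z + s *\<^sub>R b) ` {0..1}"
  have "compact A" unfolding A_def by (intro compact_continuous_image compact_Icc continuous_intros)
  moreover have "A \<subseteq> \<Omega>" using seg by (auto simp: A_def)
  ultimately obtain d K where d: "0 < d" "compact K" "K \<subseteq> \<Omega>" "\<And>x. x \<in> A \<Longrightarrow> cball x d \<subseteq> K"
    using compact_thicken[OF _ \<Omega>] by metis
  have lf: "locally_integrable_on f \<Omega>" using w by (simp add: weak_deriv_def)
  have "uniformly_continuous_on K f"
    using d f by (intro compact_uniformly_continuous continuous_on_subset[OF f]) auto
  then obtain d' where d': "0 < d'" "\<And>x y. x \<in> K \<Longrightarrow> y \<in> K \<Longrightarrow> dist x y < d' \<Longrightarrow> dist (f x) (f y) < \<eta> / 2"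
    unfolding uniformly_continuous_on_def using \<eta> by (metis half_gt_zero)
  \<comment> \<open>The kernel must stay inside \<open>K\<close> (e <= d) and within the modulus of
    continuity for \<eta> / 2 (e < d').\<close>
  define e where "e = min d (d' / 2)"
  have e: "0 < e" "e \<le> d" "e < d'" using d d' by (auto simp: e_def)
  have ball: "cball x e \<subseteq> K" if "x \<in> A" for x using d(4)[OF that] e by auto
  define M where "M x = (LINT y|lborel. indicator K y *\<^sub>R f y * mol e (x - y))" for x
  have approx: "\<bar>M x - f x\<bar> \<le> \<eta> / 2" if "x \<in> A" for x
    unfolding M_def
  proof (rule mol_approx[OF e(1)])
    show "AE y in lborel. y \<in> cball x e \<longrightarrow> \<bar>indicator K y *\<^sub>R f y - f x\<bar> \<le> \<eta> / 2"
    proof (intro AE_I2 impI)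
      fix y assume y: "y \<in> cball x e"
      then have "y \<in> K" "x \<in> K" using ball[OF that] e by auto
      moreover have "dist y x < d'" using y e by (simp add: dist_commute)
      ultimately show "\<bar>indicator K y *\<^sub>R f y - f x\<bar> \<le> \<eta> / 2"
        using d'(2)[of y x] by (simp add: dist_real_def less_imp_le)
    qed
    have "integrable lborel (\<lambda>y. indicator K y *\<^sub>R f y)"
      using lf d by (auto simp: locally_integrable_on_def set_integrable_def)
    then show "integrable lborel (\<lambda>y. indicator K y *\<^sub>R f y * mol e (x - y))"
      by (rule integrable_mult_translate[OF _ mol_test_function[OF e(1)]])
  qed
  have "\<exists>m. ((\<lambda>s. M (z + s *\<^sub>R b)) has_real_derivative m) (at s) \<and> \<bar>m\<bar> \<le> C" if "0 \<le> s" "s \<le> 1" for s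
  proof -
    have A: "z + s *\<^sub>R b \<in> A" using that by (auto simp: A_def)
    obtain D where D: "(M has_derivative D) (at (z + s *\<^sub>R b))"
      "D b = (LINT y|lborel. g y * mol e (z + s *\<^sub>R b - y))"
      using has_derivative_mol_weak[OF lf d(2,3) e(1) ball[OF A], of "{b}" "\<lambda>_. g" thesis] w
      unfolding M_def by simp
    have "AE y in lborel. y \<in> cball (z + s *\<^sub>R b) e \<longrightarrow> \<bar>g y\<bar> \<le> C"
      using g by eventually_elim (use ball[OF A] d in blast)
    from mol_bound[OF e(1) this] show ?thesis
      using has_real_derivative_line_comp[OF D(1)] D(2) by (intro exI[of _ "D b"]) simp
  qed
  then obtain m where m: "\<And>s. 0 \<le> s \<Longrightarrow> s \<le> 1 \<Longrightarrow> ((\<lambda>s. M (z + s *\<^sub>R b)) has_real_derivative m s) (at s)"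
    "\<And>s. 0 \<le> s \<Longrightarrow> s \<le> 1 \<Longrightarrow> \<bar>m s\<bar> \<le> C" by metis
  obtain s where s: "0 < s" "s < 1" "M (z + 1 *\<^sub>R b) - M (z + 0 *\<^sub>R b) = (1 - 0) * m s"
    using MVT2[of 0 1 "\<lambda>s. M (z + s *\<^sub>R b)" m] m(1) by auto
  then have "\<bar>M (z + b) - M z\<bar> \<le> C" using m(2)[of s] by simp
  moreover have "z \<in> A" unfolding A_def by (rule image_eqI[of _ _ 0]) auto
  moreover have "z + b \<in> A" unfolding A_def by (rule image_eqI[of _ _ 1]) auto
  ultimately show "\<bar>f (z + b) - f z\<bar> \<le> C + \<eta>"
    using approx[of z] approx[of "z + b"] by linarith
qed

section \<open>The fundamental lemma of the calculus of variations\<close>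

text \<open>A product of one-dimensional profiles: smooth, with values in [0,1], supported in the
  closed box and converging pointwise to the indicator of the open box, so that dominated
  convergence carries identities for test functions over to boxes.\<close>

definition box_bump :: "'a::euclidean_space \<Rightarrow> 'a \<Rightarrow> nat \<Rightarrow> 'a \<Rightarrow> real" where
  "box_bump l u m x = (\<Prod>b\<in>Basis. hfun (real (Suc m) * (x \<bullet> b - l \<bullet> b)) * hfun (real (Suc m) * (u \<bullet> b - x \<bullet> b)))"

lemma box_bump_eq_0:
  assumes "x \<notin> cbox l u"
  shows "box_bump l u m x = 0"
proof -
  from assms obtain b where b: "b \<in> Basis" "x \<bullet> b < l \<bullet> b \<or> u \<bullet> b < x \<bullet> b"
    by (auto simp: mem_box not_le)
  then have "hfun (real (Suc m) * (x \<bullet> b - l \<bullet> b)) = 0 \<or> hfun (real (Suc m) * (u \<bullet> b - x \<bullet> b)) = 0"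
    by (auto intro!: hfun_eq_0 simp: mult_le_0_iff)
  then show ?thesis
    unfolding box_bump_def using b(1) by (auto intro!: prod_zero)
qed

lemma box_bump_test_function:
  assumes "cbox l u \<subseteq> \<Omega>"
  shows "box_bump l u m \<in> test_functions \<Omega>"
proof (rule test_functionsI[OF _ compact_cbox assms])
  fix k
  have l: "Ck k (\<lambda>x::'a. c + a * (x \<bullet> b))" for a b c
    by (rule Ck_add[OF Ck_const Ck_mult[OF Ck_const Ck_bounded_linear[OF bounded_linear_inner_left]]])
  have "Ck k (\<lambda>x::'a. hfun (real (Suc m) * (x \<bullet> b - l \<bullet> b)))" for b
    using Ck_compose_real[OF Ck_exp_step l[of "- (real (Suc m) * (l \<bullet> b))" "real (Suc m)" b], of 1]
    by (simp add: algebra_simps)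
  moreover have "Ck k (\<lambda>x::'a. hfun (real (Suc m) * (u \<bullet> b - x \<bullet> b)))" for b
    using Ck_compose_real[OF Ck_exp_step l[of "real (Suc m) * (u \<bullet> b)" "- real (Suc m)" b], of 1]
    by (simp add: algebra_simps)
  ultimately show "Ck k (box_bump l u m)"
    unfolding box_bump_def[abs_def] by (intro Ck_prod Ck_mult)
qed (rule box_bump_eq_0)

lemma box_bump_bounds: "0 \<le> box_bump l u m x" "box_bump l u m x \<le> 1"
  unfolding box_bump_def
  by (auto intro!: prod_nonneg prod_le_1 mult_le_one hfun_nonneg hfun_le_1 mult_nonneg_nonneg)

lemma box_bump_tendsto: "(\<lambda>m. box_bump l u m x) \<longlonglongrightarrow> indicator (box l u) x"
proof -
  have "(\<lambda>m. box_bump l u m x) \<longlonglongrightarrow>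
      (\<Prod>b\<in>Basis. (if x \<bullet> b - l \<bullet> b > 0 then 1 else 0) * (if u \<bullet> b - x \<bullet> b > 0 then 1 else 0))"
    unfolding box_bump_def by (intro tendsto_prod tendsto_mult hfun_tendsto_indicator)
  also have "(\<Prod>b\<in>Basis. (if x \<bullet> b - l \<bullet> b > 0 then 1 else 0) * (if u \<bullet> b - x \<bullet> b > 0 then 1 else 0))
      = (indicator (box l u) x :: real)"
  proof (cases "x \<in> box l u")
    case True
    then show ?thesis by (auto simp: mem_box intro!: prod.neutral)
  next
    case False
    then obtain b where "b \<in> Basis" "\<not> (l \<bullet> b < x \<bullet> b \<and> x \<bullet> b < u \<bullet> b)" by (auto simp: mem_box)
    then show ?thesis using False by (subst prod_zero) (auto intro!: bexI[of _ b])
  qed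
  finally show ?thesis .
qed

lemma fundamental_lemma_box:
  fixes g :: "'a::euclidean_space \<Rightarrow> real"
  assumes g: "locally_integrable_on g \<Omega>" and c: "cbox l u \<subseteq> \<Omega>"
    and 0: "\<And>\<phi>. \<phi> \<in> test_functions \<Omega> \<Longrightarrow> (LINT x|lborel. g x * \<phi> x) = 0"
  shows "(LINT x:box l u|lborel. g x) = 0"
proof -
  have i: "integrable lborel (\<lambda>x. indicator (cbox l u) x *\<^sub>R g x)"
    using g c by (auto simp: locally_integrable_on_def set_integrable_def)
  have eq: "g x * box_bump l u m x = (indicator (cbox l u) x *\<^sub>R g x) * box_bump l u m x" for m x
    using box_bump_eq_0[of x l u m] by (cases "x \<in> cbox l u") auto
  have m: "box_bump l u m \<in> borel_measurable borel" for m
    using test_functions_continuous[OF box_bump_test_function[OF c]] by (rule borel_measurable_continuous_onI)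
  have "(\<lambda>m. LINT x|lborel. (indicator (cbox l u) x *\<^sub>R g x) * box_bump l u m x) \<longlonglongrightarrow>
      (LINT x|lborel. (indicator (cbox l u) x *\<^sub>R g x) * indicator (box l u) x)"
  proof (rule integral_dominated_convergence[where w="\<lambda>x. norm (indicator (cbox l u) x *\<^sub>R g x)"])
    show "AE x in lborel. (\<lambda>m. (indicator (cbox l u) x *\<^sub>R g x) * box_bump l u m x) \<longlonglongrightarrow>
        (indicator (cbox l u) x *\<^sub>R g x) * indicator (box l u) x"
      by (intro AE_I2 tendsto_intros box_bump_tendsto)
    show "AE x in lborel. norm ((indicator (cbox l u) x *\<^sub>R g x) * box_bump l u m x)
        \<le> norm (indicator (cbox l u) x *\<^sub>R g x)" for m
      by (intro AE_I2) (auto simp: abs_mult box_bump_bounds intro!: mult_left_le)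
    show "(\<lambda>x. (indicator (cbox l u) x *\<^sub>R g x) * box_bump l u m x) \<in> borel_measurable lborel" for m
      using borel_measurable_integrable[OF i] m[of m] by measurable
    show "(\<lambda>x. (indicator (cbox l u) x *\<^sub>R g x) * indicator (box l u) x) \<in> borel_measurable lborel"
      using borel_measurable_integrable[OF i] by measurable
  qed (use i in \<open>rule integrable_norm\<close>)
  moreover have "(LINT x|lborel. (indicator (cbox l u) x *\<^sub>R g x) * box_bump l u m x) = 0" for m
    using 0[OF box_bump_test_function[OF c, of m]] by (simp only: eq)
  ultimately have "(LINT x|lborel. (indicator (cbox l u) x *\<^sub>R g x) * indicator (box l u) x) = 0"
    by (simp add: LIMSEQ_const_iff)
  moreover have "(\<lambda>x. (indicator (cbox l u) x *\<^sub>R g x) * indicator (box l u) x) = (\<lambda>x. indicator (box l u) x *\<^sub>R g x)"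
    using box_subset_cbox[of l u] by (intro ext) (auto simp: indicator_def)
  ultimately show ?thesis unfolding set_lebesgue_integral_def by metis
qed

text \<open>Integrals of g over boxes vanish, and boxes form an intersection-stable generator of the
  Borel sets, so integrals over all Borel sets vanish and g is 0 almost everywhere. This is done
  inside one box at a time, since g is only locally integrable.\<close>

lemma fundamental_lemma:
  fixes g :: "'a::euclidean_space \<Rightarrow> real"
  assumes \<Omega>: "open \<Omega>" and g: "locally_integrable_on g \<Omega>"
    and 0: "\<And>\<phi>. \<phi> \<in> test_functions \<Omega> \<Longrightarrow> (LINT x|lborel. g x * \<phi> x) = 0"
  shows "AE x in lborel. x \<in> \<Omega> \<longrightarrow> g x = 0"
proof -
  have box: "AE x in lborel. x \<in> cbox a b \<longrightarrow> g x = 0" if c: "cbox a b \<subseteq> \<Omega>" for a b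
  proof -
    \<comment> \<open>The truncated function is integrable on the whole space, and its total
      integral is the one over the box, which is 0; the complement step of the induction rests on
      this.\<close>
    define G where "G x = indicator (box a b) x *\<^sub>R g x" for x
    have "set_integrable lborel (cbox a b) g"
      using g c by (auto simp: locally_integrable_on_def)
    then have "set_integrable lborel (box a b) g"
      by (rule set_integrable_subset) (auto simp: box_subset_cbox)
    then have iG: "integrable lborel G" by (simp add: G_def[abs_def] set_integrable_def)
    have iGA: "set_integrable lborel A G" if "A \<in> sets borel" for A
      unfolding set_integrable_def using integrable_mult_indicator[of A lborel G] that iG by simp
    have boxes: "(LINT x:box l u|lborel. G x) = 0" for l u
    proof -
      obtain l' u' where b: "box l u \<inter> box a b = box l' u'"
        by (rule that[OF box_Int_box])
      have "(LINT x:box l u|lborel. G x) = (LINT x:box l' u'|lborel. g x)"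
        unfolding set_lebesgue_integral_def G_def b[symmetric]
        by (intro Bochner_Integration.integral_cong) (auto simp: indicator_def)
      also have "\<dots> = 0"
      proof (cases "box l' u' = {}")
        case False
        then have "cbox l' u' \<subseteq> cbox a b"
          using b by (metis Int_lower2 closure_box closure_mono closed_cbox closure_minimal box_subset_cbox subset_trans)
        then show ?thesis using c by (intro fundamental_lemma_box[OF g _ 0]) auto
      qed (simp add: set_lebesgue_integral_def)
      finally show ?thesis .
    qed
    have sets: "(LINT x:A|lborel. G x) = 0" if "A \<in> sets lborel" for A
    proof -
      have "Int_stable (range (\<lambda>(a, b). box a b :: 'a set))"
        by (auto simp: Int_stable_def box_Int_box)
      moreover have "range (\<lambda>(a, b). box a b :: 'a set) \<subseteq> Pow UNIV" by simp
      moreover have "A \<in> sigma_sets UNIV (range (\<lambda>(a, b). box a b))"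
        using that by (simp add: borel_eq_box)
      ultimately show ?thesis
      proof (induction rule: sigma_sets_induct_disjoint)
        case (basic A)
        then show ?case using boxes by auto
      next
        case empty
        then show ?case by (simp add: set_lebesgue_integral_def)
      next
        case (compl A)
        then have A: "A \<in> sets borel" by (simp add: borel_eq_box)
        have "(LINT x:UNIV|lborel. G x) = (LINT x:A \<union> (UNIV - A)|lborel. G x)" by simp
        also have "\<dots> = (LINT x:A|lborel. G x) + (LINT x:UNIV - A|lborel. G x)"
          using A by (intro set_integral_Un iGA) auto
        finally have "(LINT x:UNIV|lborel. G x) = (LINT x:A|lborel. G x) + (LINT x:UNIV - A|lborel. G x)" .
        moreover have "(LINT x:UNIV|lborel. G x) = (LINT x:box a b|lborel. G x)"
          unfolding set_lebesgue_integral_def G_def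
          by (intro Bochner_Integration.integral_cong) (auto simp: indicator_def)
        ultimately show ?case using boxes[of a b] compl by simp
      next
        case (union A)
        then have A: "A i \<in> sets borel" for i by (auto simp: borel_eq_box)
        have "(LINT x:(\<Union>i. A i)|lborel. G x) = (\<Sum>i. (LINT x:(A i)|lborel. G x))"
          using A union(1) by (intro lebesgue_integral_countable_add iGA) (auto simp: disjoint_family_on_def)
        then show ?case using union by simp
      qed
    qed
    have "AE x in lborel. G x = 0"
      by (rule density_unique_real[OF iG]) (use sets in \<open>auto simp: set_lebesgue_integral_def\<close>)
    moreover have "AE x in lborel. x \<notin> cbox a b - box a b"
      using null_sets_cbox_Diff_box by (rule AE_not_in)
    ultimately show ?thesis by eventually_elim (auto simp: G_def)
  qed
  obtain D where D: "countable D" "\<And>X. X \<in> D \<Longrightarrow> \<exists>a b. X = cbox a b" "\<Union>D = \<Omega>"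
    using open_countable_Union_open_cbox[OF \<Omega>] by metis
  have "AE x in lborel. \<forall>X\<in>D. x \<in> X \<longrightarrow> g x = 0"
  proof (subst AE_ball_countable[OF D(1)], rule ballI)
    fix X assume "X \<in> D"
    then obtain a b where "X = cbox a b" "cbox a b \<subseteq> \<Omega>" using D by blast
    then show "AE x in lborel. x \<in> X \<longrightarrow> g x = 0" using box by simp
  qed
  then show ?thesis by eventually_elim (use D(3) in blast)
qed

lemma weak_deriv_unique:
  fixes f :: "'a::euclidean_space \<Rightarrow> real"
  assumes \<Omega>: "open \<Omega>" and g: "weak_deriv \<Omega> b f g" and h: "weak_deriv \<Omega> b f h"
  shows "AE x in lborel. x \<in> \<Omega> \<longrightarrow> g x = h x"
proof -
  have l: "locally_integrable_on g \<Omega>" "locally_integrable_on h \<Omega>"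
    using g h by (auto simp: weak_deriv_def)
  have "AE x in lborel. x \<in> \<Omega> \<longrightarrow> g x - h x = 0"
  proof (rule fundamental_lemma[OF \<Omega>])
    show "locally_integrable_on (\<lambda>x. g x - h x) \<Omega>"
      using l by (auto simp: locally_integrable_on_def)
    fix \<phi> assume \<phi>: "\<phi> \<in> test_functions \<Omega>"
    then show "(LINT x|lborel. (g x - h x) * \<phi> x) = 0"
      using g h locally_integrable_mult_test[OF l(1) \<phi>] locally_integrable_mult_test[OF l(2) \<phi>]
      by (auto simp: weak_deriv_def left_diff_distrib)
  qed
  then show ?thesis by simp
qed

section \<open>Ordinary differential equations\<close>

text \<open>Gronwall's inequality: exp (-2 L (t - a)) |f|^2 is nonincreasing. The square is used
  because the norm need not be differentiable at zeros of f.\<close>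

lemma norm_growth:
  fixes f :: "real \<Rightarrow> 'a::real_inner"
  assumes "a \<le> b" and c: "continuous_on {a..b} f"
    and d: "\<And>t. a < t \<Longrightarrow> t < b \<Longrightarrow> (f has_vector_derivative f' t) (at t)"
    and l: "\<And>t. a < t \<Longrightarrow> t < b \<Longrightarrow> norm (f' t) \<le> L * norm (f t)"
  shows "norm (f b) \<le> exp (L * (b - a)) * norm (f a)"
proof -
  let ?g = "\<lambda>t. exp (- 2 * L * (t - a)) * (f t \<bullet> f t)"
  have "?g b \<le> ?g a"
  proof (rule DERIV_nonpos_imp_decreasing_open[OF \<open>a \<le> b\<close>])
    fix t assume t: "a < t" "t < b"
    have "((\<lambda>t. f t \<bullet> f t) has_derivative (\<lambda>h. f t \<bullet> (h *\<^sub>R f' t) + (h *\<^sub>R f' t) \<bullet> f t)) (at t)"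
      using d[OF t] unfolding has_vector_derivative_def by (intro has_derivative_inner)
    then have i: "((\<lambda>t. f t \<bullet> f t) has_real_derivative 2 * (f t \<bullet> f' t)) (at t)"
      unfolding has_field_derivative_def
      by (rule has_derivative_eq_rhs) (auto simp: inner_commute)
    have "((\<lambda>t. exp (- 2 * L * (t - a))) has_real_derivative exp (- 2 * L * (t - a)) * (- 2 * L)) (at t)"
      by (auto intro!: derivative_eq_intros)
    from DERIV_mult[OF this i]
    have "(?g has_real_derivative exp (- 2 * L * (t - a)) * (2 * (f t \<bullet> f' t - L * (f t \<bullet> f t)))) (at t)"
      by (simp add: algebra_simps)
    moreover have "f t \<bullet> f' t \<le> L * (f t \<bullet> f t)"
    proof -
      have "f t \<bullet> f' t \<le> norm (f t) * norm (f' t)" by (rule norm_cauchy_schwarz)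
      also have "\<dots> \<le> norm (f t) * (L * norm (f t))" by (intro mult_left_mono l t) simp
      finally show ?thesis by (simp add: power2_norm_eq_inner[symmetric] power2_eq_square mult_ac)
    qed
    ultimately show "\<exists>y. (?g has_real_derivative y) (at t) \<and> y \<le> 0"
      by (intro exI[of _ "exp (- 2 * L * (t - a)) * (2 * (f t \<bullet> f' t - L * (f t \<bullet> f t)))"] conjI)
        (auto intro!: mult_nonneg_nonpos)
  qed (intro continuous_intros c)
  then have "exp (- 2 * L * (b - a)) * (norm (f b))\<^sup>2 \<le> (norm (f a))\<^sup>2"
    by (simp add: power2_norm_eq_inner)
  then have "exp (2 * L * (b - a)) * (exp (- 2 * L * (b - a)) * (norm (f b))\<^sup>2) \<le> exp (2 * L * (b - a)) * (norm (f a))\<^sup>2"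
    by (intro mult_left_mono) auto
  moreover have "exp (2 * L * (b - a)) * exp (- 2 * L * (b - a)) = 1"
    by (simp add: exp_minus exp_add[symmetric])
  moreover have "exp (2 * L * (b - a)) = (exp (L * (b - a)))\<^sup>2"
    by (simp add: exp_double[symmetric] mult.assoc)
  ultimately have "(norm (f b))\<^sup>2 \<le> (exp (L * (b - a)) * norm (f a))\<^sup>2"
    by (metis mult.assoc mult_1 power_mult_distrib)
  then show ?thesis by (rule power2_le_imp_le) simp
qed

primrec picard_iterate :: "(real \<Rightarrow> 'a::euclidean_space \<Rightarrow> 'a) \<Rightarrow> 'a \<Rightarrow> nat \<Rightarrow> real \<Rightarrow> 'a" where
  "picard_iterate f x0 0 = (\<lambda>t. x0)"
| "picard_iterate f x0 (Suc n) = (\<lambda>t. x0 + integral {0..t} (\<lambda>s. f s (picard_iterate f x0 n s)))"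

text \<open>Picard iteration; in the weighted norm with weight \<open>exp (- 2 * L * t)\<close> the iteration contracts
  by the factor 1/2 on the whole time interval.\<close>

lemma picard_lindeloef:
  fixes f :: "real \<Rightarrow> 'a::euclidean_space \<Rightarrow> 'a"
  assumes T: "0 \<le> T" and c: "continuous_on ({0..T} \<times> UNIV) (\<lambda>(t, x). f t x)"
    and L: "0 < L" and lip: "\<And>t x y. 0 \<le> t \<Longrightarrow> t \<le> T \<Longrightarrow> norm (f t x - f t y) \<le> L * norm (x - y)"
  obtains X where "X 0 = x0" "\<And>t. t \<in> {0..T} \<Longrightarrow> (X has_vector_derivative f t (X t)) (at t within {0..T})"
proof -
  define P where "P = picard_iterate f x0"
  have cf: "continuous_on {0..T} (\<lambda>s. f s (Y s))" if "continuous_on {0..T} Y" for Y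
  proof -
    have "continuous_on {0..T} (\<lambda>s. (s, Y s))" by (intro continuous_intros that)
    from continuous_on_compose2[OF c this] show ?thesis by auto
  qed
  have sub: "continuous_on {0..t} g" if "continuous_on {0..T} g" "t \<in> {0..T}" for t and g :: "real \<Rightarrow> 'b::topological_space"
    using that by (auto intro: continuous_on_subset)
  have PS: "P (Suc n) t = x0 + integral {0..t} (\<lambda>s. f s (P n s))" for n t
    by (simp add: P_def)
  have cP: "continuous_on {0..T} (P n)" for n
  proof (induction n)
    case (Suc n)
    have "continuous_on {0..T} (\<lambda>t. x0 + integral {0..t} (\<lambda>s. f s (P n s)))"
      by (intro continuous_intros indefinite_integral_continuous_1 integrable_continuous_real cf Suc)
    then show ?case by (simp add: PS)
  qed (simp add: P_def)
  have "bounded ((\<lambda>t. P 1 t - P 0 t) ` {0..T})"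
    by (intro compact_imp_bounded compact_continuous_image continuous_intros cP compact_Icc)
  then obtain M where "\<forall>d\<in>(\<lambda>t. P 1 t - P 0 t) ` {0..T}. norm d \<le> M"
    unfolding bounded_iff by blast
  then have M: "norm (P 1 t - P 0 t) \<le> M" if "t \<in> {0..T}" for t
    by (rule bspec) (rule imageI[OF that])
  have M0: "0 \<le> M" using order_trans[OF norm_ge_zero M[of 0]] T by simp
  have step: "norm (P (Suc n) t - P n t) \<le> M * (1/2)^n * exp (2 * L * t)" if "t \<in> {0..T}" for n t
    using that
  proof (induction n arbitrary: t)
    case 0
    then have "M * 1 \<le> M * exp (2 * L * t)" using M0 L by (intro mult_left_mono) auto
    then show ?case using M[OF 0] by simp
  next
    case (Suc n)
    have i: "(\<lambda>s. f s (P m s)) integrable_on {0..t}" for m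
      by (intro integrable_continuous_real sub[OF cf[OF cP] Suc.prems])
    have e: "((\<lambda>s. L * (M * (1/2)^n * exp (2 * L * s))) has_integral
        (M * (1/2)^Suc n * exp (2 * L * t) - M * (1/2)^Suc n * exp (2 * L * 0))) {0..t}"
    proof (rule fundamental_theorem_of_calculus)
      show "0 \<le> t" using Suc.prems by simp
      show "((\<lambda>s. M * (1/2)^Suc n * exp (2 * L * s)) has_vector_derivative L * (M * (1/2)^n * exp (2 * L * s)))
          (at s within {0..t})" for s
        unfolding has_real_derivative_iff_has_vector_derivative[symmetric]
        by (auto intro!: derivative_eq_intros)
    qed
    have "P (Suc (Suc n)) t - P (Suc n) t =
        integral {0..t} (\<lambda>s. f s (P (Suc n) s)) - integral {0..t} (\<lambda>s. f s (P n s))"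
      by (simp only: PS[of "Suc n"] PS[of n t]) simp
    also have "\<dots> = integral {0..t} (\<lambda>s. f s (P (Suc n) s) - f s (P n s))"
      by (rule Henstock_Kurzweil_Integration.integral_diff[symmetric, OF i i])
    finally have "norm (P (Suc (Suc n)) t - P (Suc n) t) = norm (integral {0..t} (\<lambda>s. f s (P (Suc n) s) - f s (P n s)))"
      by simp
    also have "\<dots> \<le> integral {0..t} (\<lambda>s. L * (M * (1/2)^n * exp (2 * L * s)))"
    proof (rule Henstock_Kurzweil_Integration.integral_norm_bound_integral)
      show "(\<lambda>s. f s (P (Suc n) s) - f s (P n s)) integrable_on {0..t}"
        by (rule Henstock_Kurzweil_Integration.integrable_diff[OF i i])
      show "(\<lambda>s. L * (M * (1/2)^n * exp (2 * L * s))) integrable_on {0..t}" using e by blast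
      fix s assume s: "s \<in> {0..t}"
      then have "norm (f s (P (Suc n) s) - f s (P n s)) \<le> L * norm (P (Suc n) s - P n s)"
        using Suc.prems by (intro lip) auto
      also have "\<dots> \<le> L * (M * (1/2)^n * exp (2 * L * s))"
        using s Suc.prems L by (intro mult_left_mono Suc.IH) auto
      finally show "norm (f s (P (Suc n) s) - f s (P n s)) \<le> L * (M * (1/2)^n * exp (2 * L * s))" .
    qed
    also have "\<dots> \<le> M * (1/2)^Suc n * exp (2 * L * t)"
      using integral_unique[OF e] M0 by simp
    finally show ?case .
  qed
  let ?X = "\<lambda>t. x0 + (\<Sum>i. P (Suc i) t - P i t)"
  have "uniform_limit {0..T} (\<lambda>n t. \<Sum>i<n. P (Suc i) t - P i t) (\<lambda>t. \<Sum>i. P (Suc i) t - P i t) sequentially"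
  proof (rule Weierstrass_m_test)
    show "norm (P (Suc n) t - P n t) \<le> M * exp (2 * L * T) * (1/2)^n" if "t \<in> {0..T}" for n t
    proof -
      have "norm (P (Suc n) t - P n t) \<le> M * (1/2)^n * exp (2 * L * t)" by (rule step[OF that])
      also have "\<dots> \<le> M * (1/2)^n * exp (2 * L * T)"
        using that L M0 by (intro mult_left_mono) auto
      finally show ?thesis by (simp add: mult_ac)
    qed
  qed (intro summable_mult summable_geometric, simp)
  then have "uniform_limit {0..T} (\<lambda>n t. x0 + (\<Sum>i<n. P (Suc i) t - P i t)) ?X sequentially"
    by (intro uniform_limit_add uniform_limit_const)
  moreover have "x0 + (\<Sum>i<n. P (Suc i) t - P i t) = P n t" for n t
    by (subst sum_lessThan_telescope) (simp add: P_def)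
  ultimately have ul: "uniform_limit {0..T} P ?X sequentially" by simp
  have cX: "continuous_on {0..T} ?X"
    by (rule uniform_limit_theorem[OF always_eventually[OF allI[OF cP]] ul]) simp
  have fixpoint: "?X t = x0 + integral {0..t} (\<lambda>s. f s (?X s))" if t: "t \<in> {0..T}" for t
  proof -
    have i: "(\<lambda>s. f s (Y s)) integrable_on {0..t}" if "continuous_on {0..T} Y" for Y
      by (intro integrable_continuous_real sub[OF cf t] that)
    have "norm (?X t - (x0 + integral {0..t} (\<lambda>s. f s (?X s)))) \<le> 0 + \<epsilon>" if "0 < \<epsilon>" for \<epsilon>
    proof -
      \<comment> \<open>Two errors add up to \<epsilon>: \<delta> from the distance of an iterate to
        the limit, and T L \<delta> from integrating the difference of the fields.\<close>
      define \<delta> where "\<delta> = \<epsilon> / (1 + L * T)"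
      have pos: "0 < 1 + L * T" using L T by (simp add: add_pos_nonneg)
      have "\<delta> > 0" using that pos by (simp add: \<delta>_def)
      then obtain N where N: "\<And>n s. n \<ge> N \<Longrightarrow> s \<in> {0..T} \<Longrightarrow> dist (P n s) (?X s) < \<delta>"
        using uniform_limitD[OF ul] by (force simp: eventually_sequentially)
      have "norm (integral {0..t} (\<lambda>s. f s (P N s) - f s (?X s))) \<le> integral {0..t} (\<lambda>s. L * \<delta>)"
      proof (rule Henstock_Kurzweil_Integration.integral_norm_bound_integral)
        show "(\<lambda>s. f s (P N s) - f s (?X s)) integrable_on {0..t}"
          by (rule Henstock_Kurzweil_Integration.integrable_diff[OF i[OF cP] i[OF cX]])
        fix s assume s: "s \<in> {0..t}"
        then have "norm (f s (P N s) - f s (?X s)) \<le> L * norm (P N s - ?X s)"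
          using t by (intro lip) auto
        also have "\<dots> \<le> L * \<delta>" using N[of N s] s t L by (intro mult_left_mono) (auto simp: dist_norm)
        finally show "norm (f s (P N s) - f s (?X s)) \<le> L * \<delta>" .
      qed auto
      also have "integral {0..t} (\<lambda>s. L * \<delta>) \<le> T * (L * \<delta>)"
        using t L \<open>\<delta> > 0\<close> by (auto intro!: mult_right_mono)
      finally have 1: "norm (P (Suc N) t - (x0 + integral {0..t} (\<lambda>s. f s (?X s)))) \<le> T * (L * \<delta>)"
        by (simp only: PS[of N t] Henstock_Kurzweil_Integration.integral_diff[OF i[OF cP] i[OF cX]] add_diff_cancel_left)
      have 2: "norm (?X t - P (Suc N) t) \<le> \<delta>"
        using N[of "Suc N" t] t by (simp add: dist_norm norm_minus_commute)
      have "norm (?X t - (x0 + integral {0..t} (\<lambda>s. f s (?X s)))) \<le> T * (L * \<delta>) + \<delta>"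
        using norm_triangle_le[of "?X t - P (Suc N) t" "P (Suc N) t - (x0 + integral {0..t} (\<lambda>s. f s (?X s)))"] 1 2
        by simp
      also have "T * (L * \<delta>) + \<delta> = \<delta> * (1 + L * T)" by (simp add: algebra_simps)
      also have "\<dots> = \<epsilon>" using pos by (simp add: \<delta>_def)
      finally show ?thesis by simp
    qed
    then have "norm (?X t - (x0 + integral {0..t} (\<lambda>s. f s (?X s)))) \<le> 0"
      by (rule field_le_epsilon)
    then show ?thesis by simp
  qed
  show thesis
  proof (rule that[of ?X])
    show "?X 0 = x0" using fixpoint[of 0] T by simp
    fix t assume t: "t \<in> {0..T}"
    have "((\<lambda>t. x0 + integral {0..t} (\<lambda>s. f s (?X s))) has_vector_derivative 0 + f t (?X t)) (at t within {0..T})"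
      by (intro has_vector_derivative_add has_vector_derivative_const integral_has_vector_derivative cf cX t)
    then show "(?X has_vector_derivative f t (?X t)) (at t within {0..T})"
      using has_vector_derivative_transform[OF t fixpoint] by simp
  qed
qed

text \<open>Forward existence for the time-reversed field. Prescribing the end point instead of the
  initial point makes the trajectory a function of the point at which a potential at time T is to be
  defined.\<close>

lemma backward_trajectory:
  fixes w :: "'a::euclidean_space \<Rightarrow> real \<Rightarrow> 'a"
  assumes T: "0 \<le> T" and c: "continuous_on (UNIV \<times> {0..T}) (\<lambda>(x, t). w x t)"
    and L: "0 < L" and lip: "\<And>t x y. 0 \<le> t \<Longrightarrow> t \<le> T \<Longrightarrow> norm (w x t - w y t) \<le> L * norm (x - y)"
  obtains X where "X T = x0" "continuous_on {0..T} X"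
    "\<And>t. 0 < t \<Longrightarrow> t < T \<Longrightarrow> (X has_vector_derivative w (X t) t) (at t)"
proof -
  have "continuous_on ({0..T} \<times> UNIV) (\<lambda>(t, x). - w x (T - t))"
    unfolding case_prod_beta
    by (intro continuous_intros continuous_on_compose2[OF c[unfolded case_prod_beta], of _ "\<lambda>p. (snd p, T - fst p)", simplified])
      auto
  then obtain Z where Z: "Z 0 = x0"
    "\<And>t. t \<in> {0..T} \<Longrightarrow> (Z has_vector_derivative - w (Z t) (T - t)) (at t within {0..T})"
    using picard_lindeloef[OF T _ L, of "\<lambda>t x. - w x (T - t)" x0] lip
    by (smt (verit, best) minus_diff_minus norm_minus_cancel)
  have cZ: "continuous_on {0..T} Z"
    using Z(2) by (meson continuous_on_eq_continuous_within has_vector_derivative_continuous)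
  show thesis
  proof (rule that[of "\<lambda>t. Z (T - t)"])
    show "continuous_on {0..T} (\<lambda>t. Z (T - t))"
      by (rule continuous_on_compose2[OF cZ]) (auto intro!: continuous_intros)
    fix t assume t: "0 < t" "t < T"
    have "(Z has_vector_derivative - w (Z (T - t)) t) (at (T - t))"
      using Z(2)[of "T - t"] t by (simp add: at_within_Icc_at)
    moreover have "((\<lambda>t. T - t) has_vector_derivative - 1) (at t)"
      by (auto intro!: derivative_eq_intros)
    ultimately show "((\<lambda>t. Z (T - t)) has_vector_derivative w (Z (T - t)) t) (at t)"
      using vector_diff_chain_at[of "\<lambda>t. T - t" "-1" t Z "- w (Z (T - t)) t"] by (simp add: o_def)
  qed (use Z in simp)
qed

text \<open>Gronwall's inequality in reversed time, started from the end points.\<close>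

lemma trajectory_distance:
  fixes w :: "'a::euclidean_space \<Rightarrow> real \<Rightarrow> 'a"
  assumes lip: "\<And>t x y. 0 \<le> t \<Longrightarrow> t \<le> T \<Longrightarrow> norm (w x t - w y t) \<le> L * norm (x - y)"
    and X: "continuous_on {0..T} X" "\<And>t. 0 < t \<Longrightarrow> t < T \<Longrightarrow> (X has_vector_derivative w (X t) t) (at t)"
    and Y: "continuous_on {0..T} Y" "\<And>t. 0 < t \<Longrightarrow> t < T \<Longrightarrow> (Y has_vector_derivative w (Y t) t) (at t)"
    and s: "0 \<le> s" "s \<le> T" and L: "0 \<le> L"
  shows "norm (Y s - X s) \<le> exp (L * T) * norm (Y T - X T)"
proof -
  let ?f = "\<lambda>t. Y (T - t) - X (T - t)"
  let ?f' = "\<lambda>t. - (w (Y (T - t)) (T - t) - w (X (T - t)) (T - t))"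
  have "norm (?f (T - s)) \<le> exp (L * (T - s - 0)) * norm (?f 0)"
  proof (rule norm_growth)
    show "0 \<le> T - s" using s by simp
    show "continuous_on {0..T - s} ?f"
      using s by (intro continuous_intros continuous_on_compose2[OF X(1)] continuous_on_compose2[OF Y(1)]) auto
    fix t assume t: "0 < t" "t < T - s"
    have d: "((\<lambda>t. Z (T - t)) has_vector_derivative - w (Z (T - t)) (T - t)) (at t)"
      if "(Z has_vector_derivative w (Z (T - t)) (T - t)) (at (T - t))" for Z
    proof -
      have "((\<lambda>t. T - t) has_vector_derivative - 1) (at t)"
        by (auto intro!: derivative_eq_intros)
      then show ?thesis using vector_diff_chain_at[of "\<lambda>t. T - t" "-1" t Z "w (Z (T - t)) (T - t)"] that by (simp add: o_def)
    qed
    show "(?f has_vector_derivative ?f' t) (at t)"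
      using has_vector_derivative_diff[OF d[OF Y(2)] d[OF X(2)]] t s by simp
    show "norm (?f' t) \<le> L * norm (?f t)"
      unfolding norm_minus_cancel using t s by (intro lip) auto
  qed
  also have "\<dots> \<le> exp (L * T) * norm (Y T - X T)"
    using s L by (auto intro!: mult_right_mono mult_left_mono)
  finally show ?thesis by simp
qed

section \<open>Potentials of approximately conservative fields\<close>

text \<open>Cutting the segment into N equal pieces divides the total quadratic error by N and
  leaves the linear one unchanged.\<close>

lemma subdivide_increment_bound:
  fixes G :: "'a::real_normed_vector \<Rightarrow> real"
  assumes S: "convex S" "x \<in> S" "y \<in> S" and a: "0 \<le> a"
    and G: "\<And>x y. x \<in> S \<Longrightarrow> y \<in> S \<Longrightarrow> \<bar>G y - G x\<bar> \<le> a * (norm (y - x))\<^sup>2 + c * norm (y - x)"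
  shows "\<bar>G y - G x\<bar> \<le> c * norm (y - x)"
proof (rule field_le_epsilon)
  fix \<epsilon> :: real assume "0 < \<epsilon>"
  then obtain N :: nat where N: "0 < N" "a * (norm (y - x))\<^sup>2 / \<epsilon> < real N"
    by (metis reals_Archimedean2 gr0I of_nat_0_less_iff not_less_zero order_less_trans linorder_not_le
        divide_nonneg_pos a mult_nonneg_nonneg zero_le_power2 of_nat_0 order_le_less_trans)
  define p where "p k = x + (real k / real N) *\<^sub>R (y - x)" for k
  have p: "p k \<in> S" if "k \<le> N" for k
  proof -
    have "p k = (1 - real k / real N) *\<^sub>R x + (real k / real N) *\<^sub>R y"
      by (simp add: p_def algebra_simps)
    then show ?thesis using S that N by (auto intro!: convexD simp: divide_le_eq_1)
  qed
  have d: "p (Suc k) - p k = (1 / real N) *\<^sub>R (y - x)" for k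
    by (simp add: p_def add_divide_distrib algebra_simps)
  have "G y - G x = (\<Sum>k<N. G (p (Suc k)) - G (p k))"
    using N by (subst sum_lessThan_telescope) (simp add: p_def)
  also have "\<bar>\<dots>\<bar> \<le> (\<Sum>k<N. \<bar>G (p (Suc k)) - G (p k)\<bar>)" by (rule sum_abs)
  also have "\<dots> \<le> (\<Sum>k<N. a * (norm (p (Suc k) - p k))\<^sup>2 + c * norm (p (Suc k) - p k))"
    by (intro sum_mono G p) auto
  also have "\<dots> = a * (norm (y - x))\<^sup>2 / real N + c * norm (y - x)"
  proof -
    have nd: "norm (p (Suc k) - p k) = norm (y - x) / real N" for k
      unfolding d using N by simp
    show ?thesis
      unfolding nd using N by (simp add: power2_eq_square field_simps)
  qed
  also have "a * (norm (y - x))\<^sup>2 / real N \<le> \<epsilon>"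
    using N \<open>0 < \<epsilon>\<close> by (simp add: field_simps)
  finally show "\<bar>G y - G x\<bar> \<le> c * norm (y - x) + \<epsilon>" by simp
qed

text \<open>Two of the approximate potentials on a common ball differ by a function whose increments
  no longer contain w; subdivision removes the quadratic part of the error, so after normalisation
  at 0 the sequence is Cauchy at every point. In the limit the quadratic error survives with the
  same K, while the linear one vanishes.\<close>

lemma potential_limit:
  fixes w :: "'a::euclidean_space \<Rightarrow> 'a"
  assumes K: "0 \<le> K"
    and ex: "\<And>n::nat. \<exists>F. \<forall>x y. norm x \<le> real n \<longrightarrow> norm y \<le> real n \<longrightarrow>
      \<bar>F y - F x - w x \<bullet> (y - x)\<bar> \<le> K * (norm (y - x))\<^sup>2 + norm (y - x) / real (Suc n)"
  obtains F where "\<And>x y. \<bar>F y - F x - w x \<bullet> (y - x)\<bar> \<le> K * (norm (y - x))\<^sup>2"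
proof -
  obtain H where H: "\<And>n x y. norm x \<le> real n \<Longrightarrow> norm y \<le> real n \<Longrightarrow>
      \<bar>H n y - H n x - w x \<bullet> (y - x)\<bar> \<le> K * (norm (y - x))\<^sup>2 + norm (y - x) / real (Suc n)"
    using ex by metis
  define F where "F n x = H n x - H n 0" for n x
  have FH: "F n y - F n x = H n y - H n x" for n x y by (simp add: F_def)
  have diff: "\<bar>F n x - F m x\<bar> \<le> (2 / real (Suc N)) * norm x" if "norm x \<le> real N" "N \<le> n" "N \<le> m" for n m N x
  proof -
    have "\<bar>(H n x - H m x) - (H n 0 - H m 0)\<bar> \<le> (2 / real (Suc N)) * norm (x - 0)"
    proof (rule subdivide_increment_bound[of "cball 0 (real N)" _ _ "2 * K" "\<lambda>x. H n x - H m x"])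
      fix x y :: 'a assume xy: "x \<in> cball 0 (real N)" "y \<in> cball 0 (real N)"
      have b: "norm (y - x) / real (Suc k) \<le> norm (y - x) / real (Suc N)" if "N \<le> k" for k
        using that by (intro divide_left_mono) auto
      have "\<bar>H n y - H n x - w x \<bullet> (y - x)\<bar> \<le> K * (norm (y - x))\<^sup>2 + norm (y - x) / real (Suc N)"
        "\<bar>H m y - H m x - w x \<bullet> (y - x)\<bar> \<le> K * (norm (y - x))\<^sup>2 + norm (y - x) / real (Suc N)"
        using H[of x n y] H[of x m y] b that xy by force+
      then show "\<bar>(H n y - H m y) - (H n x - H m x)\<bar> \<le> 2 * K * (norm (y - x))\<^sup>2 + 2 / real (Suc N) * norm (y - x)"
        by (simp add: abs_le_iff)
    qed (use that K in auto)
    then show ?thesis by (simp add: F_def algebra_simps)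
  qed
  have "Cauchy (\<lambda>n. F n x)" for x
  proof (rule metric_CauchyI)
    fix e :: real assume e: "0 < e"
    obtain N :: nat where N: "max (norm x) (2 * norm x / e) < real N" using reals_Archimedean2 by blast
    show "\<exists>M. \<forall>m\<ge>M. \<forall>n\<ge>M. dist (F m x) (F n x) < e"
    proof (intro exI[of _ N] allI impI)
      fix m n assume mn: "N \<le> m" "N \<le> n"
      have "dist (F m x) (F n x) \<le> (2 / real (Suc N)) * norm x"
        unfolding dist_real_def using N mn by (intro diff) auto
      also have "\<dots> < e" using N e by (simp add: field_simps)
      finally show "dist (F m x) (F n x) < e" .
    qed
  qed
  then have "\<exists>l. (\<lambda>n. F n x) \<longlonglongrightarrow> l" for x
    using Cauchy_convergent convergent_def by blast
  then obtain G where G: "\<And>x. (\<lambda>n. F n x) \<longlonglongrightarrow> G x" by metis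
  show thesis
  proof (rule that[of G])
    fix x y
    have "(\<lambda>n. \<bar>F n y - F n x - w x \<bullet> (y - x)\<bar>) \<longlonglongrightarrow> \<bar>G y - G x - w x \<bullet> (y - x)\<bar>"
      by (intro tendsto_intros G)
    moreover have "(\<lambda>n. K * (norm (y - x))\<^sup>2 + norm (y - x) * inverse (real (Suc n))) \<longlonglongrightarrow>
        K * (norm (y - x))\<^sup>2 + norm (y - x) * 0"
      by (intro tendsto_intros LIMSEQ_inverse_real_of_nat)
    moreover have "\<forall>\<^sub>F n in sequentially. \<bar>F n y - F n x - w x \<bullet> (y - x)\<bar> \<le>
        K * (norm (y - x))\<^sup>2 + norm (y - x) * inverse (real (Suc n))"
    proof -
      obtain N :: nat where N: "max (norm x) (norm y) < real N" using reals_Archimedean2 by blast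
      show ?thesis
        unfolding eventually_sequentially FH
        by (rule exI[of _ N]) (use H N in \<open>force simp: divide_inverse\<close>)
    qed
    ultimately show "\<bar>G y - G x - w x \<bullet> (y - x)\<bar> \<le> K * (norm (y - x))\<^sup>2"
      using tendsto_le[OF sequentially_bot] by fastforce
  qed
qed

section \<open>A Liouville theorem\<close>

text \<open>The radial weight for which \<open>kap z *\<^sub>R z = - \<nabla> rbump z\<close>.\<close>

definition kap :: "'a::euclidean_space \<Rightarrow> real" where
  "kap z = 2 * exp_step (monom 1 2) (1 - z \<bullet> z)"

lemma pd_rbump: "pd b rbump z = - (kap z * (z \<bullet> b))"
proof -
  have "((\<lambda>z. 1 - z \<bullet> z) has_derivative (\<lambda>h. - 2 * (z \<bullet> h))) (at z)"
    by (auto intro!: derivative_eq_intros simp: inner_commute)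
  moreover have "(hfun has_derivative (\<lambda>h. exp_step (monom 1 2) (1 - z \<bullet> z) * h)) (at (1 - z \<bullet> z))"
    using exp_step_deriv[of 1 "1 - z \<bullet> z"] by (simp add: has_field_derivative_def)
  ultimately have "(rbump has_derivative (\<lambda>h. exp_step (monom 1 2) (1 - z \<bullet> z) * (- 2 * (z \<bullet> h)))) (at z)"
    using has_derivative_compose unfolding rbump_def[abs_def] by fast
  from pd_eqI[OF this] show ?thesis by (simp add: kap_def)
qed

lemma kap_test_function: "kap \<in> test_functions UNIV"
proof (rule test_functionsI[of _ "cball 0 1"])
  show "Ck k kap" for k :: nat
    unfolding kap_def[abs_def]
    by (rule Ck_mult[OF Ck_const Ck_compose_real[OF Ck_exp_step Ck_one_minus_inner]])
  show "kap x = 0" if "x \<notin> cball 0 1" for x :: 'a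
  proof -
    have "1 < (norm x)\<^sup>2" using that by (simp add: one_less_power)
    then show ?thesis by (simp add: kap_def exp_step_def power2_norm_eq_inner)
  qed
qed auto

lemma kap_nonneg: "0 \<le> kap z"
  by (simp add: kap_def exp_step_def poly_monom)

lemma kap_eq_0: "1 < norm z \<Longrightarrow> kap z = 0"
proof -
  assume "1 < norm z"
  then have "1 < (norm z)\<^sup>2" by (simp add: one_less_power)
  then show ?thesis by (simp add: kap_def exp_step_def power2_norm_eq_inner)
qed

lemma integral_kap_pos: "0 < (LINT z|lborel. kap (z::'a::euclidean_space))"
  by (rule integral_continuous_pos[of _ 0])
    (simp_all add: kap_nonneg test_functions_continuous[OF kap_test_function]
      test_functions_integrable[OF kap_test_function], simp add: kap_def exp_step_def poly_monom)

lemma test_function_Lipschitz: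
  assumes \<rho>: "\<rho> \<in> test_functions \<Omega>"
  obtains C where "0 \<le> C" "\<And>x y. \<bar>\<rho> x - \<rho> y\<bar> \<le> C * norm (x - y)"
proof -
  have "\<exists>M. 0 \<le> M \<and> (\<forall>x. \<bar>pd b \<rho> x\<bar> \<le> M)" for b
    using test_functions_bounded[OF test_functions_pd[OF \<rho>]] by metis
  then obtain M where M: "\<And>b. 0 \<le> M b" "\<And>b x. \<bar>pd b \<rho> x\<bar> \<le> M b" by metis
  have "\<bar>\<rho> x - \<rho> y\<bar> \<le> (\<Sum>b\<in>Basis. M b) * norm (x - y)" for x y
  proof -
    obtain s where s: "\<rho> (y + 1 *\<^sub>R (x - y)) - \<rho> (y + 0 *\<^sub>R (x - y)) = (1 - 0) * pd (x - y) \<rho> (y + s *\<^sub>R (x - y))"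
      using MVT2[of 0 1 "\<lambda>s. \<rho> (y + s *\<^sub>R (x - y))" "\<lambda>s. pd (x - y) \<rho> (y + s *\<^sub>R (x - y))"]
        has_real_derivative_along_line[OF test_functions_differentiable[OF \<rho>]] by auto
    have "\<bar>pd (x - y) \<rho> (y + s *\<^sub>R (x - y))\<bar> \<le> norm (x - y) * (\<Sum>b\<in>Basis. \<bar>pd b \<rho> (y + s *\<^sub>R (x - y))\<bar>)"
      by (rule abs_pd_le[OF test_functions_differentiable[OF \<rho>]])
    also have "\<dots> \<le> norm (x - y) * (\<Sum>b\<in>Basis. M b)"
      by (intro mult_left_mono sum_mono M) auto
    finally show ?thesis using s by (simp add: mult.commute)
  qed
  then show thesis using that M by (meson sum_nonneg)
qed

text \<open>The bound \<open>pot\<close> makes F differentiable with gradient w, so with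
  \<open>divfree\<close> F is harmonic in the weak sense. No second derivatives of F are assumed;
  the Lipschitz bound on w takes over their role.\<close>

locale quadratic_potential =
  fixes F :: "'a::euclidean_space \<Rightarrow> real" and w :: "'a \<Rightarrow> 'a" and K L :: real
  assumes K: "0 \<le> K" and L: "0 \<le> L"
    and pot: "\<And>y x. \<bar>F y - F x - w x \<bullet> (y - x)\<bar> \<le> K * (norm (y - x))\<^sup>2"
    and lip: "\<And>x y. norm (w x - w y) \<le> L * norm (x - y)"
    and divfree: "\<And>\<phi>. \<phi> \<in> test_functions UNIV \<Longrightarrow> (LINT x|lborel. (\<Sum>b\<in>Basis. (w x \<bullet> b) * pd b \<phi> x)) = 0"
begin

lemma F_has_derivative: "(F has_derivative (\<lambda>h. w x \<bullet> h)) (at x)"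
proof (rule has_derivative_quadratic[where \<delta>=1 and K=K])
  show "norm (F (x + h) - F x - w x \<bullet> h) \<le> K * (norm h)\<^sup>2" for h
    using pot[of "x + h" x] by simp
qed (use K in \<open>auto intro: bounded_linear_inner_right\<close>)

lemma continuous_F: "continuous_on S F"
  by (intro continuous_at_imp_continuous_on ballI has_derivative_continuous[OF F_has_derivative])

lemma continuous_w: "continuous_on S w"
proof (rule continuous_on_iff[THEN iffD2], intro ballI allI impI)
  fix x e assume "x \<in> S" "0 < (e::real)"
  then show "\<exists>d>0. \<forall>x'\<in>S. dist x' x < d \<longrightarrow> dist (w x') (w x) < e"
  proof (intro exI[of _ "e / (L + 1)"] conjI ballI impI)
    fix x' assume "dist x' x < e / (L + 1)"
    then have "(L + 1) * norm (x' - x) < e" using L by (simp add: field_simps dist_norm)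
    moreover have "L * norm (x' - x) \<le> (L + 1) * norm (x' - x)" by (intro mult_right_mono) auto
    ultimately show "dist (w x') (w x) < e" using lip[of x' x] by (simp add: dist_norm)
  qed (use L in auto)
qed

lemma integrable_kap: "continuous_on UNIV g \<Longrightarrow> integrable lborel (\<lambda>z. g z * kap z)"
  by (rule locally_integrable_mult_test[OF continuous_imp_locally_integrable kap_test_function])

text \<open>Averages over balls with a fixed radial weight replace spherical means, and the
  derivative in the radius is a flux. Since \<open>kap\<close> is supported in the unit ball, the
  remainder K |h z|^2 is at most K |h|^2.\<close>

lemma mean_value_derivative:
  "((\<lambda>r. LINT z|lborel. F (x0 + r *\<^sub>R z) * kap z) has_real_derivative
     (LINT z|lborel. (w (x0 + r *\<^sub>R z) \<bullet> z) * kap z)) (at r)"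
proof -
  let ?D = "LINT z|lborel. (w (x0 + r *\<^sub>R z) \<bullet> z) * kap z"
  let ?I = "LINT z|lborel. kap (z::'a)"
  have iF: "integrable lborel (\<lambda>z. F (x0 + s *\<^sub>R z) * kap z)" for s
    by (intro integrable_kap continuous_on_compose2[OF continuous_F[of UNIV]] continuous_intros) auto
  have iw: "integrable lborel (\<lambda>z. (w (x0 + r *\<^sub>R z) \<bullet> z) * kap z)"
    by (intro integrable_kap continuous_on_inner continuous_on_compose2[OF continuous_w[of UNIV]] continuous_intros) auto
  have "((\<lambda>r. LINT z|lborel. F (x0 + r *\<^sub>R z) * kap z) has_derivative (\<lambda>h. h * ?D)) (at r)"
  proof (rule has_derivative_quadratic[where \<delta>=1 and K="K * ?I"])
    fix h :: real
    let ?r = "\<lambda>z. (F (x0 + (r + h) *\<^sub>R z) - F (x0 + r *\<^sub>R z) - h * (w (x0 + r *\<^sub>R z) \<bullet> z)) * kap z"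
    have i: "integrable lborel ?r"
      using iF[of "r + h"] iF[of r] integrable_mult_right[OF iw, of h]
      by (simp add: left_diff_distrib mult.assoc)
    have "(LINT z|lborel. F (x0 + (r + h) *\<^sub>R z) * kap z) - (LINT z|lborel. F (x0 + r *\<^sub>R z) * kap z) - h * ?D
        = (LINT z|lborel. ?r z)"
      using iF[of "r + h"] iF[of r] integrable_mult_right[OF iw, of h] by (simp add: left_diff_distrib mult.assoc)
    moreover have "norm (LINT z|lborel. ?r z) \<le> (LINT z|lborel. K * (norm h)\<^sup>2 * kap (z::'a))"
    proof (rule Bochner_Integration.integral_norm_bound_integral[OF i])
      show "integrable lborel (\<lambda>z::'a. K * (norm h)\<^sup>2 * kap z)"
        by (intro integrable_mult_right test_functions_integrable[OF kap_test_function])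
      fix z :: 'a
      show "norm (?r z) \<le> K * (norm h)\<^sup>2 * kap z"
      proof (cases "norm z \<le> 1")
        case True
        have "\<bar>F (x0 + (r + h) *\<^sub>R z) - F (x0 + r *\<^sub>R z) - h * (w (x0 + r *\<^sub>R z) \<bullet> z)\<bar> \<le> K * (norm (h *\<^sub>R z))\<^sup>2"
          using pot[of "x0 + (r + h) *\<^sub>R z" "x0 + r *\<^sub>R z"] by (simp add: algebra_simps)
        also have "\<dots> \<le> K * (norm h)\<^sup>2"
          using True K by (intro mult_left_mono power_mono) (auto intro: mult_left_le)
        finally show ?thesis
          by (simp add: abs_mult kap_nonneg mult_right_mono)
      next
        case False
        then show ?thesis by (simp add: kap_eq_0)
      qed
    qed
    ultimately show "norm ((LINT z|lborel. F (x0 + (r + h) *\<^sub>R z) * kap z) - (LINT z|lborel. F (x0 + r *\<^sub>R z) * kap z) - h * ?D)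
        \<le> K * ?I * (norm h)\<^sup>2" by (simp add: mult_ac)
  qed (use K integral_kap_pos[where 'a='a] in \<open>auto intro: bounded_linear_mult_left\<close>)
  then show ?thesis by (simp add: has_field_derivative_def mult_commute_abs)
qed

text \<open>The divergence condition is tested with the rescaled \<open>rbump\<close> centred at x0;
  at x0 + r z its gradient is the vector z times -(1/r) \<open>kap z\<close>, which is the weight of
  the flux up to a factor.\<close>

lemma flux_eq_0:
  assumes r: "0 < r"
  shows "(LINT z|lborel. (w (x0 + r *\<^sub>R z) \<bullet> z) * kap z) = 0"
proof -
  define \<phi> where "\<phi> y = rbump ((- (1/r) *\<^sub>R x0) + (1/r) *\<^sub>R y)" for y :: 'a
  have L: "bounded_linear (\<lambda>y::'a. (1/r) *\<^sub>R y)" by (rule bounded_linear_scaleR_right)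
  have \<phi>: "\<phi> \<in> test_functions UNIV"
    unfolding \<phi>_def
  proof (rule test_functions_affine[OF rbump_test_function L compact_cball[of x0 r]])
    fix y assume "y \<notin> cball x0 r"
    then have "1 \<le> (1/r) * norm (y - x0)" using r by (simp add: dist_norm norm_minus_commute field_simps)
    then have "1 \<le> norm ((1/r) *\<^sub>R (y - x0))" using r by simp
    then show "rbump ((- (1/r) *\<^sub>R x0) + (1/r) *\<^sub>R y) = 0" by (intro rbump_eq_0) (simp add: algebra_simps)
  qed simp
  have pd: "pd b \<phi> y = (1/r) * pd b rbump ((- (1/r) *\<^sub>R x0) + (1/r) *\<^sub>R y)" for b y
    unfolding \<phi>_def pd_affine[OF L test_functions_differentiable[OF rbump_test_function]]
    by (simp add: linear_scale[OF pd_linear[OF test_functions_differentiable[OF rbump_test_function]]])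
  let ?f = "\<lambda>y. \<Sum>b\<in>Basis. (w y \<bullet> b) * pd b \<phi> y"
  have "continuous_on UNIV ?f"
    by (intro continuous_intros continuous_w test_functions_continuous[OF test_functions_pd[OF \<phi>]])
  then have m: "?f \<in> borel_measurable borel" by (rule borel_measurable_continuous_onI)
  have "0 = (LINT y|lborel. ?f y)" using divfree[OF \<phi>] by simp
  also have "\<dots> = \<bar>r\<bar> ^ DIM('a) * (LINT z|lborel. ?f (x0 + r *\<^sub>R z))"
    using r by (intro lborel_integral_affine m) auto
  finally have "(LINT z|lborel. ?f (x0 + r *\<^sub>R z)) = 0" using r by simp
  moreover have "?f (x0 + r *\<^sub>R z) = - (1/r) * ((w (x0 + r *\<^sub>R z) \<bullet> z) * kap z)" for z
  proof -
    have "(- (1/r) *\<^sub>R x0) + (1/r) *\<^sub>R (x0 + r *\<^sub>R z) = z" using r by (simp add: algebra_simps)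
    then have "?f (x0 + r *\<^sub>R z) = (\<Sum>b\<in>Basis. - (1/r) * kap z * ((w (x0 + r *\<^sub>R z) \<bullet> b) * (z \<bullet> b)))"
      unfolding pd by (simp add: pd_rbump mult_ac)
    also have "\<dots> = - (1/r) * kap z * (w (x0 + r *\<^sub>R z) \<bullet> z)"
      by (subst (3) euclidean_inner) (rule sum_distrib_left[symmetric])
    finally show ?thesis by (simp add: mult_ac)
  qed
  ultimately show ?thesis using r by simp
qed

text \<open>The average is constant in the radius for r > 0 and continuous up to r = 0, where it is
  F x0 times the mass of the weight.\<close>

lemma mean_value:
  assumes r: "0 < r"
  shows "F x0 * (LINT z|lborel. kap (z::'a)) = (LINT z|lborel. F (x0 + r *\<^sub>R z) * kap z)"
proof -
  let ?M = "\<lambda>r. LINT z|lborel. F (x0 + r *\<^sub>R z) * kap z"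
  have "?M r = ?M 0"
  proof (rule DERIV_isconst_end[OF r])
    show "continuous_on {0..r} ?M"
      by (intro continuous_at_imp_continuous_on ballI DERIV_isCont[OF mean_value_derivative])
    show "(?M has_real_derivative 0) (at s)" if "0 < s" for s
      using mean_value_derivative[of x0 s] flux_eq_0[OF that] by simp
  qed
  then show ?thesis by simp
qed

text \<open>Second differences of \<open>F\<close> are bounded, and inherit the mean value property of \<open>F\<close>.\<close>

lemma second_difference_const:
  "F (x + h + k) - F (x + h) - F (x + k) + F x = F (h + k) - F h - F k + F 0"
proof -
  define u where "u x = F (x + h + k) - F (x + h) - F (x + k) + F x" for x
  \<comment> \<open>The increments of F along k from x + h and from x are compared with w (x + h)
    and w x; this leaves two quadratic remainders and one Lipschitz term.\<close>
  define U where "U = L * norm h * norm k + 2 * K * (norm k)\<^sup>2"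
  have u_bound: "\<bar>u x\<bar> \<le> U" for x
  proof -
    have "\<bar>F (x + h + k) - F (x + h) - w (x + h) \<bullet> k\<bar> \<le> K * (norm k)\<^sup>2"
      using pot[of "x + h + k" "x + h"] by simp
    moreover have "\<bar>F (x + k) - F x - w x \<bullet> k\<bar> \<le> K * (norm k)\<^sup>2"
      using pot[of "x + k" x] by simp
    moreover have "\<bar>(w (x + h) - w x) \<bullet> k\<bar> \<le> L * norm h * norm k"
      using Cauchy_Schwarz_ineq2[of "w (x + h) - w x" k] mult_right_mono[OF lip[of "x + h" x], of "norm k"] by simp
    ultimately show ?thesis by (simp add: u_def U_def inner_diff_left abs_le_iff)
  qed
  have U: "0 \<le> U" using u_bound[of 0] by linarith
  have cu: "continuous_on UNIV u"
    unfolding u_def[abs_def]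
    by (intro continuous_intros continuous_on_compose2[OF continuous_F[of UNIV]]) auto
  have iF: "integrable lborel (\<lambda>z. F (x + r *\<^sub>R z) * kap z)" for x r
    by (intro integrable_kap continuous_on_compose2[OF continuous_F[of UNIV]] continuous_intros) auto
  let ?I = "LINT z|lborel. kap (z::'a)"
  have mv: "u x * ?I = (LINT z|lborel. u (x + r *\<^sub>R z) * kap z)" if "0 < r" for x r
  proof -
    have "u (x + r *\<^sub>R z) * kap z = F (x + h + k + r *\<^sub>R z) * kap z - F (x + h + r *\<^sub>R z) * kap z
        - F (x + k + r *\<^sub>R z) * kap z + F (x + r *\<^sub>R z) * kap z" for z
      by (simp add: u_def algebra_simps)
    then have "(LINT z|lborel. u (x + r *\<^sub>R z) * kap z) = F (x + h + k) * ?I - F (x + h) * ?I - F (x + k) * ?I + F x * ?I"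
      using iF by (simp add: mean_value[OF that])
    then show ?thesis by (simp add: u_def algebra_simps)
  qed
  have mk: "kap \<in> borel_measurable (borel :: 'a measure)"
    using test_functions_continuous[OF kap_test_function] by (rule borel_measurable_continuous_onI)
  have mu: "u \<in> borel_measurable borel" using cu by (rule borel_measurable_continuous_onI)
  \<comment> \<open>Moving x from the argument of u into the kernel: in the difference of two mean
    values only the kernel changes, by a shift of (x - y) / r.\<close>
  have mv': "u x * ?I = (LINT z|lborel. u (r *\<^sub>R z) * kap (z - (1/r) *\<^sub>R x))" if "0 < r" for x r
  proof -
    have [measurable]: "(\<lambda>z. u (r *\<^sub>R z) * kap (z - (1/r) *\<^sub>R x)) \<in> borel_measurable borel"
      using mk mu by measurable
    have "(LINT z|lborel. u (r *\<^sub>R z) * kap (z - (1/r) *\<^sub>R x)) =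
        (LINT z|lborel. u (r *\<^sub>R (z + (1/r) *\<^sub>R x)) * kap (z + (1/r) *\<^sub>R x - (1/r) *\<^sub>R x))"
      by (rule lborel_integral_shift[symmetric]) measurable
    also have "\<dots> = (LINT z|lborel. u (x + r *\<^sub>R z) * kap z)"
      using that by (simp add: algebra_simps)
    finally show ?thesis using mv[OF that] by simp
  qed
  obtain C where C: "0 \<le> C" "\<And>x y::'a. \<bar>kap x - kap y\<bar> \<le> C * norm (x - y)"
    using test_function_Lipschitz[OF kap_test_function] by blast
  let ?V = "measure lborel (cball (0::'a) 2)"
  \<comment> \<open>For |x|, |y| <= r both shifted kernels live in the ball of radius 2, so
    boundedness of u and the Lipschitz bound of \<open>kap\<close> give O(1/r); letting r tend to
    infinity makes u constant, as in Liouville's theorem.\<close>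
  have key: "\<bar>u x - u y\<bar> * ?I \<le> U * C * ?V * norm (x - y) * (1 / r)"
    if r: "0 < r" "norm x \<le> r" "norm y \<le> r" for x y r
  proof -
    let ?g = "\<lambda>x z. u (r *\<^sub>R z) * kap (z - (1/r) *\<^sub>R x)"
    have i: "integrable lborel (?g x)" for x
    proof (rule integrable_continuous_compact_support[of _ "cball ((1/r) *\<^sub>R x) 1"])
      show "continuous_on UNIV (?g x)"
        by (intro continuous_intros continuous_on_compose2[OF cu]
            continuous_on_compose2[OF test_functions_continuous[OF kap_test_function]]) auto
      show "?g x z = 0" if "z \<notin> cball ((1/r) *\<^sub>R x) 1" for z
        using that by (subst kap_eq_0) (auto simp: dist_norm norm_minus_commute)
    qed simp
    have "\<bar>u x - u y\<bar> * ?I = \<bar>(u x - u y) * ?I\<bar>"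
      using integral_kap_pos[where 'a='a] by (simp add: abs_mult)
    also have "(u x - u y) * ?I = (LINT z|lborel. ?g x z - ?g y z)"
      using i by (simp add: left_diff_distrib mv'[OF r(1)])
    also have "\<bar>\<dots>\<bar> \<le> (LINT z|lborel. U * (C * (norm (x - y) / r)) * indicator (cball (0::'a) 2) z)"
    proof (subst real_norm_def[symmetric], rule Bochner_Integration.integral_norm_bound_integral)
      show "integrable lborel (\<lambda>z. ?g x z - ?g y z)" using i by simp
      show "integrable lborel (\<lambda>z. U * (C * (norm (x - y) / r)) * indicator (cball (0::'a) 2) z)"
        by (intro integrable_mult_right integrable_real_indicator)
          (use emeasure_lborel_cball_finite[of "0::'a" 2] in simp_all)
      fix z :: 'a
      have eq: "?g x z - ?g y z = u (r *\<^sub>R z) * (kap (z - (1/r) *\<^sub>R x) - kap (z - (1/r) *\<^sub>R y))"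
        by (simp add: algebra_simps)
      show "norm (?g x z - ?g y z) \<le> U * (C * (norm (x - y) / r)) * indicator (cball 0 2) z"
      proof (cases "norm z \<le> 2")
        case True
        have "\<bar>kap (z - (1/r) *\<^sub>R x) - kap (z - (1/r) *\<^sub>R y)\<bar> \<le> C * norm ((z - (1/r) *\<^sub>R x) - (z - (1/r) *\<^sub>R y))"
          by (rule C)
        also have "(z - (1/r) *\<^sub>R x) - (z - (1/r) *\<^sub>R y) = - ((1/r) *\<^sub>R (x - y))" by (simp add: algebra_simps)
        also have "norm (- ((1/r) *\<^sub>R (x - y))) = norm (x - y) / r" using r by simp
        finally have "\<bar>u (r *\<^sub>R z)\<bar> * \<bar>kap (z - (1/r) *\<^sub>R x) - kap (z - (1/r) *\<^sub>R y)\<bar> \<le> U * (C * norm (x - y) / r)"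
          using U u_bound[of "r *\<^sub>R z"] by (intro mult_mono) auto
        then show ?thesis
          unfolding eq real_norm_def abs_mult using True by simp
      next
        case False
        have "kap (z - (1/r) *\<^sub>R p) = 0" if "norm p \<le> r" for p
        proof (rule kap_eq_0)
          have "norm ((1/r) *\<^sub>R p) \<le> 1" using that r by simp
          then show "1 < norm (z - (1/r) *\<^sub>R p)" using False norm_triangle_ineq2[of z "(1/r) *\<^sub>R p"] by linarith
        qed
        then show ?thesis using r U C by simp
      qed
    qed
    also have "\<dots> = U * C * ?V * norm (x - y) * (1 / r)" by simp
    finally show ?thesis .
  qed
  have "u x = u 0"
  proof -
    have "(\<lambda>n. U * C * ?V * norm (x - 0) * inverse (real (Suc n))) \<longlonglongrightarrow> U * C * ?V * norm (x - 0) * 0"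
      by (intro tendsto_intros LIMSEQ_inverse_real_of_nat)
    moreover have "\<forall>\<^sub>F n in sequentially. \<bar>u x - u 0\<bar> * ?I \<le> U * C * ?V * norm (x - 0) * inverse (real (Suc n))"
    proof -
      obtain N :: nat where N: "norm x < real N" using reals_Archimedean2 by blast
      show ?thesis
        unfolding eventually_sequentially
        by (rule exI[of _ N], intro allI impI)
          (use key[of "real (Suc n)" x 0 for n] N in \<open>simp add: divide_inverse\<close>)
    qed
    ultimately have "\<bar>u x - u 0\<bar> * ?I \<le> U * C * ?V * norm (x - 0) * 0"
      by (intro tendsto_lowerbound[OF _ _ sequentially_bot])
    then have "\<bar>u x - u 0\<bar> * ?I \<le> 0" by simp
    then show ?thesis using integral_kap_pos[where 'a='a] by (simp add: mult_le_0_iff)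
  qed
  then show ?thesis by (simp add: u_def)
qed

text \<open>The additivity defect q is paired with t q: the second-difference identity cancels the
  values of F and leaves four quadratic remainders, so t |q|^2 <= 4 K t^2 |q|^2 for every t > 0,
  whence q = 0.\<close>

lemma w_additive: "w (x + h) - w x = w h - w 0"
proof -
  define q where "q = w (x + h) - w x - w h + w 0"
  have "(norm q)\<^sup>2 \<le> 0 + \<epsilon>" if "0 < \<epsilon>" for \<epsilon>
  proof -
    define t where "t = \<epsilon> / (4 * K * (norm q)\<^sup>2 + 1)"
    have p: "0 < 4 * K * (norm q)\<^sup>2 + 1" using K by (simp add: add_nonneg_pos)
    then have t: "0 < t" using that by (simp add: t_def)
    let ?k = "t *\<^sub>R q"
    have "\<bar>F (x + h + ?k) - F (x + h) - w (x + h) \<bullet> ?k\<bar> \<le> K * (norm ?k)\<^sup>2"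
      "\<bar>F (x + ?k) - F x - w x \<bullet> ?k\<bar> \<le> K * (norm ?k)\<^sup>2"
      "\<bar>F (h + ?k) - F h - w h \<bullet> ?k\<bar> \<le> K * (norm ?k)\<^sup>2"
      "\<bar>F ?k - F 0 - w 0 \<bullet> ?k\<bar> \<le> K * (norm ?k)\<^sup>2"
      using pot[of "x + h + ?k" "x + h"] pot[of "x + ?k" x] pot[of "h + ?k" h] pot[of ?k 0] by simp_all
    moreover have "q \<bullet> ?k = w (x + h) \<bullet> ?k - w x \<bullet> ?k - w h \<bullet> ?k + w 0 \<bullet> ?k"
      by (simp only: q_def inner_diff_left inner_add_left)
    ultimately have "q \<bullet> ?k \<le> 4 * (K * (norm ?k)\<^sup>2)"
      using second_difference_const[of x h ?k] by linarith
    then have "t * (norm q)\<^sup>2 \<le> t * (t * (4 * K * (norm q)\<^sup>2))"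
      by (simp add: power2_norm_eq_inner[symmetric] power_mult_distrib power2_eq_square mult_ac)
    then have "(norm q)\<^sup>2 \<le> t * (4 * K * (norm q)\<^sup>2)" using t by simp
    also have "\<dots> \<le> t * (4 * K * (norm q)\<^sup>2 + 1)" using t by simp
    also have "\<dots> = \<epsilon>" using p by (simp add: t_def)
    finally show ?thesis by simp
  qed
  then have "(norm q)\<^sup>2 \<le> 0" by (rule field_le_epsilon)
  then show ?thesis by (simp add: q_def algebra_simps)
qed

text \<open>Cauchy's functional equation: additivity gives homogeneity over the rationals, and
  continuity extends it to the reals.\<close>

lemma w_linear:
  assumes "w 0 = 0"
  shows "linear w"
proof -
  have add: "w (x + y) = w x + w y" for x y
    using w_additive[of x y] assms by (simp add: algebra_simps)
  have minus: "w (- x) = - w x" for x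
    using add[of x "- x"] assms by (simp add: eq_neg_iff_add_eq_0 add.commute)
  have nat: "w (real n *\<^sub>R x) = real n *\<^sub>R w x" for n x
    by (induction n) (simp_all add: scaleR_left_distrib add assms)
  have int: "w (of_int i *\<^sub>R x) = of_int i *\<^sub>R w x" for i x
  proof (cases i)
    case (nonneg n)
    then show ?thesis using nat by simp
  next
    case (neg n)
    then have "of_int i = - real (Suc n)" by simp
    then show ?thesis
      using nat[of "Suc n" x] minus[of "real (Suc n) *\<^sub>R x"] by (simp only: scaleR_minus_left)
  qed
  have rat: "w (q *\<^sub>R x) = q *\<^sub>R w x" if "q \<in> \<rat>" for q x
  proof -
    from that obtain a b where q: "q = of_int a / of_int b" "b > 0" by (rule Rats_cases') 
    have "of_int b *\<^sub>R w (q *\<^sub>R x) = w (of_int b *\<^sub>R (q *\<^sub>R x))" by (simp only: int)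
    also have "\<dots> = of_int a *\<^sub>R w x" using q int[of a x] by simp
    finally have "(1 / of_int b) *\<^sub>R (of_int b *\<^sub>R w (q *\<^sub>R x)) = (1 / of_int b) *\<^sub>R (of_int a *\<^sub>R w x)" by simp
    then show ?thesis using q by simp
  qed
  have "w (c *\<^sub>R x) = c *\<^sub>R w x" for c x
  proof -
    have "closed {c. w (c *\<^sub>R x) = c *\<^sub>R w x}"
      by (intro closed_Collect_eq continuous_intros continuous_on_compose2[OF continuous_w[of UNIV]]) auto
    moreover have "\<rat> \<subseteq> {c. w (c *\<^sub>R x) = c *\<^sub>R w x}" using rat by auto
    ultimately have "closure \<rat> \<subseteq> {c. w (c *\<^sub>R x) = c *\<^sub>R w x}" by (rule closure_minimal[rotated])
    then show ?thesis by (auto simp: Rats_closure_real)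
  qed
  then show ?thesis by (intro linearI add)
qed

end

section \<open>Linear combinations of weak derivatives\<close>

lemma locally_integrable_sum:
  assumes "\<And>j. j \<in> J \<Longrightarrow> locally_integrable_on (f j) \<Omega>"
  shows "locally_integrable_on (\<lambda>x. \<Sum>j\<in>J. c j * f j x) \<Omega>"
proof -
  have "set_integrable lborel K (\<lambda>x. \<Sum>j\<in>J. c j * f j x)" if "compact K" "K \<subseteq> \<Omega>" for K
  proof -
    have "integrable lborel (\<lambda>x. \<Sum>j\<in>J. c j * (indicator K x *\<^sub>R f j x))"
      using assms that
      by (intro Bochner_Integration.integrable_sum integrable_mult_right)
        (auto simp: locally_integrable_on_def set_integrable_def)
    then show ?thesis by (simp add: set_integrable_def sum_distrib_left mult.left_commute)
  qed
  then show ?thesis by (simp add: locally_integrable_on_def)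
qed

text \<open>Weak derivatives are given along the axes, whereas increments and trajectories need them
  along arbitrary constant directions.\<close>

lemma weak_deriv_sum_dir:
  fixes f :: "'a::euclidean_space \<Rightarrow> real"
  assumes "\<And>j. j \<in> J \<Longrightarrow> weak_deriv \<Omega> (b j) f (g j)" "locally_integrable_on f \<Omega>"
  shows "weak_deriv \<Omega> (\<Sum>j\<in>J. c j *\<^sub>R b j) f (\<lambda>x. \<Sum>j\<in>J. c j * g j x)"
  unfolding weak_deriv_def
proof (intro conjI ballI)
  show "locally_integrable_on (\<lambda>x. \<Sum>j\<in>J. c j * g j x) \<Omega>"
    using assms by (intro locally_integrable_sum) (auto simp: weak_deriv_def)
  fix \<phi> assume \<phi>: "\<phi> \<in> test_functions \<Omega>"
  note l = pd_linear[OF test_functions_differentiable[OF \<phi>]]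
  have pd: "pd (\<Sum>j\<in>J. c j *\<^sub>R b j) \<phi> x = (\<Sum>j\<in>J. c j * pd (b j) \<phi> x)" for x
    using linear_sum[OF l, of "\<lambda>j. c j *\<^sub>R b j" J x] linear_scale[OF l] by simp
  have "(LINT x|lborel. f x * pd (\<Sum>j\<in>J. c j *\<^sub>R b j) \<phi> x) = (LINT x|lborel. (\<Sum>j\<in>J. c j * (f x * pd (b j) \<phi> x)))"
    unfolding pd by (simp add: sum_distrib_left mult.left_commute)
  also have "\<dots> = (\<Sum>j\<in>J. c j * (LINT x|lborel. f x * pd (b j) \<phi> x))"
    by (subst Bochner_Integration.integral_sum)
      (use locally_integrable_mult_test[OF assms(2) test_functions_pd[OF \<phi>]] in auto)
  also have "\<dots> = (\<Sum>j\<in>J. - (c j * (LINT x|lborel. g j x * \<phi> x)))"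
    using assms(1) \<phi> by (intro sum.cong) (auto simp: weak_deriv_def)
  also have "\<dots> = - (LINT x|lborel. (\<Sum>j\<in>J. c j * (g j x * \<phi> x)))"
  proof -
    have "integrable lborel (\<lambda>x. g j x * \<phi> x)" if "j \<in> J" for j
      using locally_integrable_mult_test[OF _ \<phi>, of "g j"] assms(1)[OF that] by (simp add: weak_deriv_def)
    then show ?thesis by (subst Bochner_Integration.integral_sum) (auto simp: sum_negf)
  qed
  finally show "(LINT x|lborel. f x * pd (\<Sum>j\<in>J. c j *\<^sub>R b j) \<phi> x) = - (LINT x|lborel. (\<Sum>j\<in>J. c j * g j x) * \<phi> x)"
    by (simp add: sum_distrib_right mult.assoc)
qed (rule assms(2))

lemma weak_deriv_add_dir:
  fixes f :: "'a::euclidean_space \<Rightarrow> real"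
  assumes "weak_deriv \<Omega> a f g" "weak_deriv \<Omega> b f h"
  shows "weak_deriv \<Omega> (a + b) f (\<lambda>x. g x + h x)"
proof -
  \<comment> \<open>Two directions are indexed by \<open>bool\<close>, so that the statement for
    finite sums applies.\<close>
  have "weak_deriv \<Omega> (\<Sum>j\<in>(UNIV::bool set). 1 *\<^sub>R (if j then a else b)) f
      (\<lambda>x. \<Sum>j\<in>(UNIV::bool set). 1 * (if j then g else h) x)"
    by (rule weak_deriv_sum_dir) (use assms in \<open>auto simp: weak_deriv_def\<close>)
  then show ?thesis by (simp add: UNIV_bool add.commute)
qed

lemma weak_deriv_sum_fun:
  fixes f :: "'j \<Rightarrow> 'a::euclidean_space \<Rightarrow> real"
  assumes "\<And>j. j \<in> J \<Longrightarrow> weak_deriv \<Omega> b (f j) (g j)"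
  shows "weak_deriv \<Omega> b (\<lambda>x. \<Sum>j\<in>J. c j * f j x) (\<lambda>x. \<Sum>j\<in>J. c j * g j x)"
  unfolding weak_deriv_def
proof (intro conjI ballI)
  show "locally_integrable_on (\<lambda>x. \<Sum>j\<in>J. c j * f j x) \<Omega>" "locally_integrable_on (\<lambda>x. \<Sum>j\<in>J. c j * g j x) \<Omega>"
    using assms by (auto intro!: locally_integrable_sum simp: weak_deriv_def)
  fix \<phi> assume \<phi>: "\<phi> \<in> test_functions \<Omega>"
  have "(LINT x|lborel. (\<Sum>j\<in>J. c j * f j x) * pd b \<phi> x) = (LINT x|lborel. (\<Sum>j\<in>J. c j * (f j x * pd b \<phi> x)))"
    by (simp add: sum_distrib_right mult.assoc)
  also have "\<dots> = (\<Sum>j\<in>J. c j * (LINT x|lborel. f j x * pd b \<phi> x))"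
    by (subst Bochner_Integration.integral_sum)
      (use assms locally_integrable_mult_test[OF _ test_functions_pd[OF \<phi>]] in \<open>auto simp: weak_deriv_def\<close>)
  also have "\<dots> = (\<Sum>j\<in>J. - (c j * (LINT x|lborel. g j x * \<phi> x)))"
    using assms \<phi> by (intro sum.cong) (auto simp: weak_deriv_def)
  also have "\<dots> = - (LINT x|lborel. (\<Sum>j\<in>J. c j * (g j x * \<phi> x)))"
  proof -
    have "integrable lborel (\<lambda>x. g j x * \<phi> x)" if "j \<in> J" for j
      using locally_integrable_mult_test[OF _ \<phi>, of "g j"] assms(1)[OF that] by (simp add: weak_deriv_def)
    then show ?thesis by (subst Bochner_Integration.integral_sum) (auto simp: sum_negf)
  qed
  finally show "(LINT x|lborel. (\<Sum>j\<in>J. c j * f j x) * pd b \<phi> x) = - (LINT x|lborel. (\<Sum>j\<in>J. c j * g j x) * \<phi> x)"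
    by (simp add: sum_distrib_right mult.assoc)
qed

section \<open>Derivatives along curves and mollification with a cut-off\<close>

lemma has_real_derivative_curve_comp:
  assumes "(f has_derivative D) (at (\<gamma> t))" "(\<gamma> has_vector_derivative d) (at t)"
  shows "((\<lambda>t. f (\<gamma> t)) has_real_derivative D d) (at t)"
proof -
  from has_derivative_compose[OF assms(2)[unfolded has_vector_derivative_def] assms(1)] show ?thesis
    by (simp add: has_field_derivative_def linear_scale[OF has_derivative_linear[OF assms(1)]] mult_commute_abs)
qed

lemma abs_increment_le:
  fixes f :: "real \<Rightarrow> real"
  assumes "a \<le> b" "continuous_on {a..b} f"
    and "\<And>t. a < t \<Longrightarrow> t < b \<Longrightarrow> \<exists>D. (f has_real_derivative D) (at t) \<and> \<bar>D\<bar> \<le> B"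
  shows "\<bar>f b - f a\<bar> \<le> (b - a) * B"
proof (cases "a < b")
  case True
  then obtain l z where "a < z" "z < b" "DERIV f z :> l" "f b - f a = (b - a) * l"
    using MVT[OF True assms(2)] assms(3) real_differentiable_def by metis
  moreover then have "\<bar>l\<bar> \<le> B" using assms(3)[of z] DERIV_unique by blast
  ultimately show ?thesis using True by (simp add: abs_mult)
qed (use assms in simp)

text \<open>Truncation to a compact \<open>K\<close> makes f integrable and the mollification
  differentiable everywhere; where the kernel stays inside \<open>K\<close> it agrees with the
  untruncated mollification.\<close>

definition cutoff_mol :: "'a::euclidean_space set \<Rightarrow> real \<Rightarrow> ('a \<Rightarrow> real) \<Rightarrow> 'a \<Rightarrow> real" where
  "cutoff_mol K e f z = (LINT y|lborel. indicator K y *\<^sub>R f y * mol e (z - y))"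

lemma cutoff_mol_eq: "0 < e \<Longrightarrow> cball z e \<subseteq> K \<Longrightarrow> cutoff_mol K e f z = (LINT y|lborel. f y * mol e (z - y))"
  unfolding cutoff_mol_def by (rule integral_cutoff) (auto intro: mol_eq_0)

lemma integrable_mult_mol:
  fixes f :: "'a::euclidean_space \<Rightarrow> real"
  assumes f: "locally_integrable_on f \<Omega>" and e: "0 < e" and b: "cball z e \<subseteq> \<Omega>"
  shows "integrable lborel (\<lambda>y. f y * mol e (z - y))"
proof (rule locally_integrable_mult[OF f _ compact_cball b])
  show "continuous_on UNIV (\<lambda>y. mol e (z - y))"
    by (intro continuous_on_compose2[OF test_functions_continuous[OF mol_test_function[OF e]]] continuous_intros) auto
  show "mol e (z - y) = 0" if "y \<notin> cball z e" for y
    using that by (intro mol_eq_0 e) (simp add: dist_norm)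
qed

lemma cutoff_mol_has_derivative:
  fixes f :: "'a::euclidean_space \<Rightarrow> real"
  assumes "locally_integrable_on f \<Omega>" "compact K" "K \<subseteq> \<Omega>" "0 < e" "cball z e \<subseteq> K"
    "\<And>b. b \<in> B \<Longrightarrow> weak_deriv \<Omega> b f (g b)"
  obtains D where "(cutoff_mol K e f has_derivative D) (at z)"
    "\<And>b. b \<in> B \<Longrightarrow> D b = cutoff_mol K e (g b) z"
proof (rule has_derivative_mol_weak[OF assms(1-5), of B g])
  show "weak_deriv \<Omega> b f (g b)" if "b \<in> B" for b using assms(6) that .
  fix D assume D: "((\<lambda>z. LINT y|lborel. indicator K y *\<^sub>R f y * mol e (z - y)) has_derivative D) (at z)"
    "\<And>b. b \<in> B \<Longrightarrow> D b = (LINT y|lborel. g b y * mol e (z - y))"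
  show thesis
    by (rule that[OF D(1)[folded cutoff_mol_def]]) (simp add: D(2) cutoff_mol_eq[OF assms(4,5)])
qed

lemma cutoff_mol_continuous:
  fixes f :: "'a::euclidean_space \<Rightarrow> real"
  assumes "locally_integrable_on f \<Omega>" "compact K" "K \<subseteq> \<Omega>" "0 < e"
  shows "continuous_on S (cutoff_mol K e f)"
proof (intro continuous_at_imp_continuous_on ballI)
  fix z
  have "integrable lborel (\<lambda>y. indicator K y *\<^sub>R f y)"
    using assms by (auto simp: locally_integrable_on_def set_integrable_def)
  from has_derivative_continuous[OF has_derivative_mollify[OF this mol_test_function[OF assms(4)]]]
  show "isCont (cutoff_mol K e f) z" unfolding cutoff_mol_def[abs_def] .
qed

text \<open>The mean value theorem is applied twice along the segment, to the mollifications of f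
  and of its weak derivative g. The bound C on the second weak derivative passes through the kernel,
  so the remainder does not depend on \<open>e\<close>.\<close>

lemma cutoff_mol_Taylor:
  fixes f :: "'a::euclidean_space \<Rightarrow> real"
  assumes K: "compact K" "K \<subseteq> \<Omega>" and e: "0 < e"
    and seg: "\<And>s. 0 \<le> s \<Longrightarrow> s \<le> 1 \<Longrightarrow> cball (z + s *\<^sub>R b) e \<subseteq> K"
    and f: "weak_deriv \<Omega> b f g" and g: "weak_deriv \<Omega> b g k"
    and k: "AE y in lborel. y \<in> \<Omega> \<longrightarrow> \<bar>k y\<bar> \<le> C"
  shows "\<bar>cutoff_mol K e f (z + b) - cutoff_mol K e f z - cutoff_mol K e g z\<bar> \<le> C"
proof -
  have deriv: "((\<lambda>s. cutoff_mol K e u (z + s *\<^sub>R b)) has_real_derivative cutoff_mol K e u' (z + s *\<^sub>R b)) (at s)"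
    if u: "weak_deriv \<Omega> b u u'" and s: "0 \<le> s" "s \<le> 1" for u u' s
  proof -
    have "locally_integrable_on u \<Omega>" using u by (simp add: weak_deriv_def)
    then obtain D where D: "(cutoff_mol K e u has_derivative D) (at (z + s *\<^sub>R b))" "D b = cutoff_mol K e u' (z + s *\<^sub>R b)"
      using cutoff_mol_has_derivative[OF _ K e seg[OF s], of u "{b}" "\<lambda>_. u'" thesis] u by simp
    show ?thesis using has_real_derivative_line_comp[OF D(1)] D(2) by simp
  qed
  obtain s where s: "0 < s" "s < 1"
    "cutoff_mol K e f (z + 1 *\<^sub>R b) - cutoff_mol K e f (z + 0 *\<^sub>R b) = (1 - 0) * cutoff_mol K e g (z + s *\<^sub>R b)"
    using MVT2[of 0 1 "\<lambda>s. cutoff_mol K e f (z + s *\<^sub>R b)" "\<lambda>s. cutoff_mol K e g (z + s *\<^sub>R b)"] deriv[OF f] by auto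
  obtain r where r: "0 < r" "r < s"
    "cutoff_mol K e g (z + s *\<^sub>R b) - cutoff_mol K e g (z + 0 *\<^sub>R b) = (s - 0) * cutoff_mol K e k (z + r *\<^sub>R b)"
    using MVT2[OF s(1), of "\<lambda>s. cutoff_mol K e g (z + s *\<^sub>R b)" "\<lambda>s. cutoff_mol K e k (z + s *\<^sub>R b)"] deriv[OF g] s by auto
  have b: "\<bar>cutoff_mol K e k (z + r *\<^sub>R b)\<bar> \<le> C"
  proof -
    have sub: "cball (z + r *\<^sub>R b) e \<subseteq> K" using seg r s by simp
    have "AE y in lborel. y \<in> cball (z + r *\<^sub>R b) e \<longrightarrow> \<bar>k y\<bar> \<le> C"
      using k by eventually_elim (use sub K in blast)
    from mol_bound[OF e this] show ?thesis by (simp add: cutoff_mol_eq[OF e sub])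
  qed
  have "\<bar>cutoff_mol K e f (z + b) - cutoff_mol K e f z - cutoff_mol K e g z\<bar> = s * \<bar>cutoff_mol K e k (z + r *\<^sub>R b)\<bar>"
    using s r by (simp add: abs_mult)
  also have "\<dots> \<le> 1 * C" using s b by (intro mult_mono) auto
  finally show ?thesis by simp
qed

section \<open>Conservation of circulation\<close>

lemma vec_sum_axis: "(\<Sum>j\<in>UNIV. (h $ j) *\<^sub>R axis j (1::real)) = h"
  using basis_expansion[of h] by (simp add: scalar_mult_eq_scaleR)

lemma abs_matrix_vector_mul_component_le:
  fixes A :: "real^'n^'m"
  shows "\<bar>(A *v h) $ i\<bar> \<le> norm A * norm h"
proof -
  have "\<bar>(A *v h) $ i\<bar> \<le> norm (A $ i) * norm h"
    by (simp add: matrix_vector_mul_component Cauchy_Schwarz_ineq2)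
  also have "\<dots> \<le> norm A * norm h" by (intro mult_right_mono Finite_Cartesian_Product.norm_nth_le) auto
  finally show ?thesis .
qed

lemma norm_matrix_vector_mul_le:
  fixes A :: "real^'n^'m"
  shows "norm (A *v h) \<le> norm A * norm h"
proof -
  have "norm (A *v h) = L2_set (\<lambda>i. \<bar>(A *v h) $ i\<bar>) UNIV"
    by (simp add: norm_vec_def)
  also have "\<dots> \<le> L2_set (\<lambda>i. norm (A $ i) * norm h) UNIV"
    by (intro L2_set_mono) (auto simp: matrix_vector_mul_component Cauchy_Schwarz_ineq2)
  also have "\<dots> = norm A * norm h"
    by (simp add: norm_vec_def[of A] L2_set_left_distrib)
  finally show ?thesis .
qed

lemma has_vector_derivative_componentwise_vec:
  fixes f :: "real \<Rightarrow> real^'n"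
  assumes "\<And>i. ((\<lambda>t. f t $ i) has_real_derivative d $ i) (at t)"
  shows "(f has_vector_derivative d) (at t)"
proof -
  have "((\<lambda>t. \<Sum>i\<in>UNIV. (f t $ i) *\<^sub>R axis i (1::real)) has_vector_derivative
      (\<Sum>i\<in>UNIV. (f t $ i) *\<^sub>R 0 + (d $ i) *\<^sub>R axis i (1::real))) (at t)"
    by (intro has_vector_derivative_sum has_vector_derivative_scaleR assms has_vector_derivative_const)
  then show ?thesis by (simp add: vec_sum_axis)
qed

lemma norm_vec_le_card:
  fixes x :: "real^'n"
  assumes "\<And>i. \<bar>x $ i\<bar> \<le> c"
  shows "norm x \<le> real CARD('n) * c"
  using order_trans[OF norm_le_l1_cart sum_bounded_above[of UNIV "\<lambda>i. \<bar>x $ i\<bar>" c]] assms by simp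

section \<open>Lipschitz bounds and trajectories on a time slab\<close>

text \<open>The weak derivatives whose existence \<open>euler_on\<close> asserts are fixed here
  together with one bound C, so that all estimates on the slab refer to the same functions.\<close>

locale euler_slab =
  fixes v :: "real^'n \<Rightarrow> real \<Rightarrow> real^'n" and \<pi> :: "real^'n \<Rightarrow> real \<Rightarrow> real" and S C :: real
    and Dv :: "(real^'n) \<times> real \<Rightarrow> real^'n^'n" and v_t D\<pi> :: "(real^'n) \<times> real \<Rightarrow> real^'n"
    and D2\<pi> :: "(real^'n) \<times> real \<Rightarrow> real^'n^'n" and \<Omega> :: "((real^'n) \<times> real) set"
  assumes S: "0 < S" and \<Omega>_def: "\<Omega> = UNIV \<times> {0<..<S}"
    and cont: "continuous_on (UNIV \<times> {0..<S}) (\<lambda>(x, t). v x t)"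
    and wDv: "\<And>i j. weak_deriv \<Omega> (axis j 1, 0) (\<lambda>(x, t). v x t $ i) (\<lambda>z. Dv z $ i $ j)"
    and wv_t: "\<And>i. weak_deriv \<Omega> (0, 1) (\<lambda>(x, t). v x t $ i) (\<lambda>z. v_t z $ i)"
    and wD\<pi>: "\<And>j. weak_deriv \<Omega> (axis j 1, 0) (\<lambda>(x, t). \<pi> x t) (\<lambda>z. D\<pi> z $ j)"
    and wD2\<pi>: "\<And>i j. weak_deriv \<Omega> (axis j 1, 0) (\<lambda>z. D\<pi> z $ i) (\<lambda>z. D2\<pi> z $ i $ j)"
    and bound: "AE z in lborel. z \<in> \<Omega> \<longrightarrow> norm (Dv z) \<le> C \<and> norm (D2\<pi> z) \<le> C"
    and euler: "AE z in lborel. z \<in> \<Omega> \<longrightarrow> v_t z + Dv z *v v (fst z) (snd z) = - D\<pi> z"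
    and v0: "\<And>t. 0 \<le> t \<Longrightarrow> t < S \<Longrightarrow> v 0 t = 0"
begin

lemma open_\<Omega>: "open \<Omega>"
  unfolding \<Omega>_def by (intro open_Times open_UNIV open_greaterThanLessThan)

lemma C_nonneg: "0 \<le> C"
proof -
  have "(0, S / 2) \<in> \<Omega>" using S by (simp add: \<Omega>_def)
  then obtain z where "norm (Dv z) \<le> C" using AE_open_obtain[OF bound open_\<Omega>] by blast
  then show ?thesis using norm_ge_zero order_trans by blast
qed

lemma axis_pair: "(\<Sum>j\<in>UNIV. (h $ j) *\<^sub>R (axis j 1, 0)) = (h :: real^'n, 0 :: real)"
  by (simp add: sum_prod vec_sum_axis)

lemma weak_deriv_v_space:
  "weak_deriv \<Omega> (h, 0) (\<lambda>(x, t). v x t $ i) (\<lambda>z. (Dv z *v h) $ i)"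
proof -
  have "weak_deriv \<Omega> (\<Sum>j\<in>UNIV. (h $ j) *\<^sub>R (axis j 1, 0)) (\<lambda>(x, t). v x t $ i) (\<lambda>z. \<Sum>j\<in>UNIV. h $ j * Dv z $ i $ j)"
    by (rule weak_deriv_sum_dir[OF wDv]) (use wDv in \<open>simp add: weak_deriv_def\<close>)
  then show ?thesis by (simp only: axis_pair matrix_vector_mult_def vec_lambda_beta mult.commute)
qed

lemma weak_deriv_v:
  "weak_deriv \<Omega> (h, 1) (\<lambda>(x, t). v x t $ i) (\<lambda>z. (Dv z *v h) $ i + v_t z $ i)"
  using weak_deriv_add_dir[OF weak_deriv_v_space wv_t, of h i] by simp

lemma weak_deriv_\<pi>: "weak_deriv \<Omega> (h, 0) (\<lambda>(x, t). \<pi> x t) (\<lambda>z. D\<pi> z \<bullet> h)"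
proof -
  have "weak_deriv \<Omega> (\<Sum>j\<in>UNIV. (h $ j) *\<^sub>R (axis j 1, 0)) (\<lambda>(x, t). \<pi> x t) (\<lambda>z. \<Sum>j\<in>UNIV. h $ j * D\<pi> z $ j)"
    by (rule weak_deriv_sum_dir[OF wD\<pi>]) (use wD\<pi> in \<open>simp add: weak_deriv_def\<close>)
  then show ?thesis by (simp only: axis_pair inner_vec_def inner_real_def mult.commute)
qed

lemma weak_deriv_D\<pi>: "weak_deriv \<Omega> (h, 0) (\<lambda>z. D\<pi> z \<bullet> h) (\<lambda>z. h \<bullet> (D2\<pi> z *v h))"
proof -
  have "weak_deriv \<Omega> (h, 0) (\<lambda>z. D\<pi> z $ i) (\<lambda>z. (D2\<pi> z *v h) $ i)" for i
  proof -
    have "weak_deriv \<Omega> (\<Sum>j\<in>UNIV. (h $ j) *\<^sub>R (axis j 1, 0)) (\<lambda>z. D\<pi> z $ i) (\<lambda>z. \<Sum>j\<in>UNIV. h $ j * D2\<pi> z $ i $ j)"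
      by (rule weak_deriv_sum_dir[OF wD2\<pi>]) (use wD2\<pi> in \<open>simp add: weak_deriv_def\<close>)
    then show ?thesis by (simp only: axis_pair matrix_vector_mult_def vec_lambda_beta mult.commute)
  qed
  then have "weak_deriv \<Omega> (h, 0) (\<lambda>z. \<Sum>i\<in>UNIV. h $ i * D\<pi> z $ i) (\<lambda>z. \<Sum>i\<in>UNIV. h $ i * (D2\<pi> z *v h) $ i)"
    by (rule weak_deriv_sum_fun)
  then show ?thesis by (simp only: inner_vec_def inner_real_def mult.commute)
qed

text \<open>The factor \<open>CARD('n)\<close> comes from summing the component bounds, and the
  summand 1 makes the constant positive, as the existence of trajectories requires.\<close>

definition Lip :: real where "Lip = real CARD('n) * C + 1"

lemma Lip_pos: "0 < Lip"
  using C_nonneg by (simp add: Lip_def add_nonneg_pos)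

lemma cont_comp:
  assumes "continuous_on A f" "continuous_on A g" "\<And>s. s \<in> A \<Longrightarrow> 0 \<le> g s \<and> g s < S"
  shows "continuous_on A (\<lambda>s. v (f s) (g s))"
  using continuous_on_compose2[OF cont continuous_on_Pair[OF assms(1,2)]] assms(3)
  by (simp add: image_subset_iff)

text \<open>The increment bound is applied to each component in the space-time direction (x - y,
  0).\<close>

lemma v_Lipschitz_interior:
  assumes t: "0 < t" "t < S"
  shows "norm (v x t - v y t) \<le> Lip * norm (x - y)"
proof -
  have "\<bar>(v x t - v y t) $ i\<bar> \<le> C * norm (x - y)" for i
  proof -
    let ?f = "\<lambda>(x, t). v x t $ i"
    have "continuous_on \<Omega> ?f"
      unfolding case_prod_beta
      by (intro continuous_intros cont_comp) (auto simp: \<Omega>_def)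
    moreover have "AE z in lborel. z \<in> \<Omega> \<longrightarrow> \<bar>(Dv z *v (x - y)) $ i\<bar> \<le> C * norm (x - y)"
      using bound
    proof eventually_elim
      case (elim z)
      show ?case
      proof
        assume "z \<in> \<Omega>"
        then have "norm (Dv z) * norm (x - y) \<le> C * norm (x - y)"
          using elim by (intro mult_right_mono) auto
        then show "\<bar>(Dv z *v (x - y)) $ i\<bar> \<le> C * norm (x - y)"
          using abs_matrix_vector_mul_component_le order_trans by blast
      qed
    qed
    ultimately have "\<bar>?f ((y, t) + (x - y, 0)) - ?f (y, t)\<bar> \<le> C * norm (x - y)"
      using t by (intro weak_deriv_bounded_imp_increment_bounded[OF open_\<Omega> weak_deriv_v_space])
        (auto simp: \<Omega>_def)
    then show ?thesis by simp
  qed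
  from norm_vec_le_card[OF this] show ?thesis
    unfolding Lip_def distrib_right mult.assoc using norm_ge_zero[of "x - y"] by linarith
qed

lemma v_Lipschitz:
  assumes t: "0 \<le> t" "t < S"
  shows "norm (v x t - v y t) \<le> Lip * norm (x - y)"
proof (cases "t = 0")
  case True
  have "continuous_on {0..<S} (\<lambda>s. norm (v x s - v y s))"
    by (intro continuous_intros cont_comp) auto
  then have "((\<lambda>s. norm (v x s - v y s)) \<longlongrightarrow> norm (v x 0 - v y 0)) (at 0 within {0..<S})"
    using S by (simp add: continuous_on_def)
  then have "((\<lambda>s. norm (v x s - v y s)) \<longlongrightarrow> norm (v x 0 - v y 0)) (at 0 within {0..S/2})"
    by (rule tendsto_within_subset) (use S in auto)
  then have lim: "((\<lambda>s. norm (v x s - v y s)) \<longlongrightarrow> norm (v x 0 - v y 0)) (at_right 0)"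
    using S by (simp add: at_within_Icc_at_right)
  have "eventually (\<lambda>s. norm (v x s - v y s) \<le> Lip * norm (x - y)) (at_right 0)"
    using S v_Lipschitz_interior by (auto simp: eventually_at_right_field)
  from tendsto_upperbound[OF lim this] True show ?thesis by simp
qed (use assms v_Lipschitz_interior in simp)

text \<open>Since v vanishes at the origin, the particle resting there is a trajectory; comparison
  with it confines all other trajectories to balls of known radius.\<close>

lemma v_zero_trajectory:
  assumes "T < S" "0 < t" "t < T"
  shows "((\<lambda>t. 0) has_vector_derivative v 0 t) (at t)"
  using assms v0[of t] by simp

text \<open>The integrand is the Lagrangian \<open>|v|\<^sup>2/2 - \<pi>\<close> with mollified pressure: its integral along
  trajectories is an approximate potential of \<open>v\<close>, whatever the mollification parameter.\<close>

lemma circulation_estimate: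
  fixes \<phi>0 :: "real^'n \<Rightarrow> real"
  defines "n \<equiv> real CARD('n)"
  assumes t: "0 < t1" "t1 < t0" "t0 < S" and e: "0 < e" and K: "compact K" "K \<subseteq> \<Omega>" and \<eta>: "0 \<le> \<eta>"
    and ball: "\<And>x t. norm x \<le> r \<Longrightarrow> t1 \<le> t \<Longrightarrow> t \<le> t0 \<Longrightarrow> cball (x, t) e \<subseteq> K"
    and osc: "\<And>x t y. norm x \<le> r \<Longrightarrow> t1 \<le> t \<Longrightarrow> t \<le> t0 \<Longrightarrow> y \<in> cball (x, t) e \<Longrightarrow>
       norm (v (fst y) (snd y) - v x t) \<le> \<eta>"
    and ini: "\<And>x. norm x \<le> r \<Longrightarrow> norm (v x t1 - v x 0) \<le> \<eta>"
    and K0: "0 \<le> K0" "\<And>x y. \<bar>\<phi>0 y - \<phi>0 x - v x 0 \<bullet> (y - x)\<bar> \<le> K0 * (norm (y - x))\<^sup>2"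
    and X: "continuous_on {0..t0} X" "\<And>t. 0 < t \<Longrightarrow> t < t0 \<Longrightarrow> (X has_vector_derivative v (X t) t) (at t)"
    and Y: "continuous_on {0..t0} Y" "\<And>t. 0 < t \<Longrightarrow> t < t0 \<Longrightarrow> (Y has_vector_derivative v (Y t) t) (at t)"
    and r: "\<And>t. 0 \<le> t \<Longrightarrow> t \<le> t0 \<Longrightarrow> norm (X t) \<le> r" "\<And>t. 0 \<le> t \<Longrightarrow> t \<le> t0 \<Longrightarrow> norm (Y t) \<le> r"
    and d: "\<And>t. 0 \<le> t \<Longrightarrow> t \<le> t0 \<Longrightarrow> norm (Y t - X t) \<le> d"
  defines "l \<equiv> \<lambda>x t. (v x t \<bullet> v x t) / 2 - cutoff_mol K e (\<lambda>(x, t). \<pi> x t) (x, t)"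
  shows "\<bar>(\<phi>0 (Y t1) + integral {t1..t0} (\<lambda>s. l (Y s) s)) - (\<phi>0 (X t1) + integral {t1..t0} (\<lambda>s. l (X s) s))
      - v (X t0) t0 \<bullet> (Y t0 - X t0)\<bar>
    \<le> (K0 + t0 * (Lip\<^sup>2 / 2 + C)) * d\<^sup>2 + \<eta> * ((1 + n) + t0 * n * (n * C + Lip) + n) * d"
proof -
  let ?m = "\<lambda>f z. cutoff_mol K e f z"
  \<comment> \<open>v is only Lipschitz and its equation holds only almost everywhere, which says
    nothing along a single curve; the mollified velocity W is differentiable along X at every
    time.\<close>
  define W where "W z = (\<chi> i. ?m (\<lambda>(x, t). v x t $ i) z)" for z
  have n0: "0 \<le> n" by (simp add: n_def)
  have d0: "0 \<le> d" using d[of t1] t norm_ge_zero[of "Y t1 - X t1"] by linarith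
  have lv: "locally_integrable_on (\<lambda>(x, t). v x t $ i) \<Omega>" for i using wDv by (simp add: weak_deriv_def)
  have l\<pi>: "locally_integrable_on (\<lambda>(x, t). \<pi> x t) \<Omega>" using wD\<pi> by (simp add: weak_deriv_def)
  have lD\<pi>: "locally_integrable_on (\<lambda>z. D\<pi> z $ i) \<Omega>" for i using wD\<pi> by (simp add: weak_deriv_def)
  have W_approx: "norm (W (x, t) - v x t) \<le> n * \<eta>" if "norm x \<le> r" "t1 \<le> t" "t \<le> t0" for x t
    unfolding n_def
  proof (rule norm_vec_le_card)
    fix i
    note b = ball[OF that]
    have "\<bar>(LINT y|lborel. (\<lambda>(x, t). v x t $ i) y * mol e ((x, t) - y)) - v x t $ i\<bar> \<le> \<eta>"
    proof (rule mol_approx[OF e _ integrable_mult_mol[OF lv e]])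
      show "cball (x, t) e \<subseteq> \<Omega>" using b K by blast
      show "AE y in lborel. y \<in> cball (x, t) e \<longrightarrow> \<bar>(\<lambda>(x, t). v x t $ i) y - v x t $ i\<bar> \<le> \<eta>"
      proof (intro AE_I2 impI)
        fix y assume "y \<in> cball (x, t) e"
        from osc[OF that this] component_le_norm_cart[of "v (fst y) (snd y) - v x t" i]
        show "\<bar>(\<lambda>(x, t). v x t $ i) y - v x t $ i\<bar> \<le> \<eta>" by (simp add: case_prod_beta)
      qed
    qed
    then show "\<bar>(W (x, t) - v x t) $ i\<bar> \<le> \<eta>" by (simp add: W_def cutoff_mol_eq[OF e b])
  qed
  \<comment> \<open>The derivative of W along X mollifies v_t + Dv v(X t, t), with the transporting
    velocity frozen at the centre. Replacing it by v(y), as in the momentum equation, costs Dv (v(X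
    t, t) - v(y)), of size C \<eta>, and leaves the mollified - D\<pi>.\<close>
  have W_deriv: "\<exists>W'. ((\<lambda>t. W (X t, t)) has_vector_derivative W') (at t) \<and>
      norm (W' + (\<chi> i. ?m (\<lambda>z. D\<pi> z $ i) (X t, t))) \<le> n * (C * \<eta>)" if tt: "t1 < t" "t < t0" for t
  proof -
    let ?z = "(X t, t)"
    have nX: "norm (X t) \<le> r" using tt t by (intro r) auto
    have b: "cball ?z e \<subseteq> K" using tt nX by (intro ball) auto
    then have b\<Omega>: "cball ?z e \<subseteq> \<Omega>" using K by blast
    let ?g = "\<lambda>i z. (Dv z *v v (X t) t) $ i + v_t z $ i"
    have curve: "((\<lambda>t. (X t, t)) has_vector_derivative (v (X t) t, 1)) (at t)"
      using tt t by (intro has_vector_derivative_Pair X) (auto intro!: derivative_eq_intros)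
    have comp: "((\<lambda>t. ?m (\<lambda>(x, t). v x t $ i) (X t, t)) has_real_derivative ?m (?g i) ?z) (at t)" for i
    proof -
      obtain D where D: "(?m (\<lambda>(x, t). v x t $ i) has_derivative D) (at ?z)"
        "D (v (X t) t, 1) = ?m (?g i) ?z"
        using cutoff_mol_has_derivative[OF lv K e b, of "{(v (X t) t, 1)}" i "\<lambda>_. ?g i" thesis]
          weak_deriv_v[of "v (X t) t" i] by simp
      from has_real_derivative_curve_comp[OF D(1) curve] D(2) show ?thesis by simp
    qed
    have err: "\<bar>?m (?g i) ?z + ?m (\<lambda>z. D\<pi> z $ i) ?z\<bar> \<le> C * \<eta>" for i
    proof -
      have lg: "locally_integrable_on (?g i) \<Omega>" using weak_deriv_v[of "v (X t) t" i] by (simp add: weak_deriv_def)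
      have "?m (?g i) ?z + ?m (\<lambda>z. D\<pi> z $ i) ?z = (LINT y|lborel. (?g i y + D\<pi> y $ i) * mol e (?z - y))"
        unfolding cutoff_mol_eq[OF e b]
        using integrable_mult_mol[OF lg e b\<Omega>] integrable_mult_mol[OF lD\<pi> e b\<Omega>, of i]
        by (simp add: distrib_right)
      also have "\<bar>\<dots>\<bar> \<le> C * \<eta>"
      proof (rule mol_bound[OF e])
        show "AE y in lborel. y \<in> cball ?z e \<longrightarrow> \<bar>?g i y + D\<pi> y $ i\<bar> \<le> C * \<eta>"
          using bound euler
        proof eventually_elim
          case (elim y)
          show ?case
          proof
            assume y: "y \<in> cball ?z e"
            then have "y \<in> \<Omega>" using b\<Omega> by blast
            with elim have E: "v_t y + Dv y *v v (fst y) (snd y) = - D\<pi> y" "norm (Dv y) \<le> C" by auto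
            have "D\<pi> y = - (v_t y + Dv y *v v (fst y) (snd y))" using E(1) by simp
            then have "?g i y + D\<pi> y $ i = (Dv y *v (v (X t) t - v (fst y) (snd y))) $ i"
              by (simp add: matrix_vector_mult_diff_distrib)
            also have "\<bar>\<dots>\<bar> \<le> norm (Dv y) * norm (v (X t) t - v (fst y) (snd y))"
              by (rule abs_matrix_vector_mul_component_le)
            also have "\<dots> \<le> C * \<eta>"
              using E(2) osc[OF nX _ _ y] tt C_nonneg by (intro mult_mono) (auto simp: norm_minus_commute)
            finally show "\<bar>?g i y + D\<pi> y $ i\<bar> \<le> C * \<eta>" .
          qed
        qed
      qed
      finally show ?thesis .
    qed
    show ?thesis
    proof (intro exI conjI)
      show "((\<lambda>t. W (X t, t)) has_vector_derivative (\<chi> i. ?m (?g i) ?z)) (at t)"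
        unfolding W_def using comp by (intro has_vector_derivative_componentwise_vec) simp
      show "norm ((\<chi> i. ?m (?g i) ?z) + (\<chi> i. ?m (\<lambda>z. D\<pi> z $ i) (X t, t))) \<le> n * (C * \<eta>)"
        unfolding n_def by (rule norm_vec_le_card) (simp add: err)
    qed
  qed
  \<comment> \<open>Here the bound on \<open>D2\<pi>\<close> enters: the remainder is C |y - x|^2
    whatever the mollification parameter.\<close>
  have P_Taylor: "\<bar>?m (\<lambda>(x, t). \<pi> x t) (y, t) - ?m (\<lambda>(x, t). \<pi> x t) (x, t)
      - (\<chi> i. ?m (\<lambda>z. D\<pi> z $ i) (x, t)) \<bullet> (y - x)\<bar> \<le> C * (norm (y - x))\<^sup>2"
    if x: "norm x \<le> r" and y: "norm y \<le> r" and tt: "t1 \<le> t" "t \<le> t0" for x y t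
  proof -
    let ?h = "y - x"
    have seg: "cball ((x, t) + s *\<^sub>R (?h, 0)) e \<subseteq> K" if "0 \<le> s" "s \<le> 1" for s
    proof -
      have "x + s *\<^sub>R ?h = (1 - s) *\<^sub>R x + s *\<^sub>R y" by (simp add: algebra_simps)
      moreover have "(1 - s) *\<^sub>R x + s *\<^sub>R y \<in> cball 0 r"
        using that x y by (intro convexD[OF convex_cball]) auto
      ultimately have "norm (x + s *\<^sub>R ?h) \<le> r" by simp
      from ball[OF this tt] show ?thesis by simp
    qed
    have "AE z in lborel. z \<in> \<Omega> \<longrightarrow> \<bar>?h \<bullet> (D2\<pi> z *v ?h)\<bar> \<le> C * (norm ?h)\<^sup>2"
      using bound
    proof eventually_elim
      case (elim z)
      show ?case
      proof
        assume "z \<in> \<Omega>"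
        then have "norm (D2\<pi> z) \<le> C" using elim by blast
        have "norm (D2\<pi> z *v ?h) \<le> norm (D2\<pi> z) * norm ?h"
          by (rule norm_matrix_vector_mul_le)
        also have "\<dots> \<le> C * norm ?h" using \<open>norm (D2\<pi> z) \<le> C\<close> by (intro mult_right_mono) auto
        finally have "norm ?h * norm (D2\<pi> z *v ?h) \<le> norm ?h * (C * norm ?h)" by (intro mult_left_mono) auto
        then show "\<bar>?h \<bullet> (D2\<pi> z *v ?h)\<bar> \<le> C * (norm ?h)\<^sup>2"
          using Cauchy_Schwarz_ineq2[of ?h "D2\<pi> z *v ?h"] by (simp add: power2_eq_square mult_ac)
      qed
    qed
    from cutoff_mol_Taylor[OF K e seg weak_deriv_\<pi> weak_deriv_D\<pi> this]
    have "\<bar>?m (\<lambda>(x, t). \<pi> x t) ((x, t) + (?h, 0)) - ?m (\<lambda>(x, t). \<pi> x t) (x, t) - ?m (\<lambda>z. D\<pi> z \<bullet> ?h) (x, t)\<bar>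
        \<le> C * (norm ?h)\<^sup>2" by blast
    moreover have "?m (\<lambda>z. D\<pi> z \<bullet> ?h) (x, t) = (\<chi> i. ?m (\<lambda>z. D\<pi> z $ i) (x, t)) \<bullet> ?h"
    proof -
      note b = ball[OF x tt]
      have i: "integrable lborel (\<lambda>y. D\<pi> y $ i * mol e ((x, t) - y))" for i
        using b K by (intro integrable_mult_mol[OF lD\<pi> e]) blast
      have "?m (\<lambda>z. D\<pi> z \<bullet> ?h) (x, t) = (LINT y|lborel. (\<Sum>i\<in>UNIV. ?h $ i * (D\<pi> y $ i * mol e ((x, t) - y))))"
        unfolding cutoff_mol_eq[OF e b] by (simp add: inner_vec_def sum_distrib_left sum_distrib_right mult_ac)
      also have "\<dots> = (\<Sum>i\<in>UNIV. ?h $ i * ?m (\<lambda>z. D\<pi> z $ i) (x, t))"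
        unfolding cutoff_mol_eq[OF e b] using i by (subst Bochner_Integration.integral_sum) auto
      finally show ?thesis by (simp add: inner_vec_def mult.commute)
    qed
    ultimately show ?thesis by simp
  qed
  have cl: "continuous_on {t1..t0} (\<lambda>s. l (Z s) s)" if "continuous_on {0..t0} Z" for Z
  proof -
    have Z: "continuous_on {t1..t0} Z" using that t by (auto intro: continuous_on_subset)
    show ?thesis
      unfolding l_def
      using t by (intro continuous_intros cont_comp Z
          continuous_on_compose2[OF cutoff_mol_continuous[OF l\<pi> K e, of UNIV]]) auto
  qed
  let ?I = "\<lambda>Z t. integral {t1..t} (\<lambda>s. l (Z s) s)"
  have dI: "((\<lambda>t. ?I Z t) has_real_derivative l (Z t) t) (at t)"
    if "continuous_on {0..t0} Z" "t1 < t" "t < t0" for Z t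
  proof -
    have "((\<lambda>t. ?I Z t) has_real_derivative l (Z t) t) (at t within {t1..t0})"
      using that by (intro integral_has_real_derivative cl) auto
    then show ?thesis using that by (simp add: at_within_Icc_at)
  qed
  have cI: "continuous_on {t1..t0} (\<lambda>t. ?I Z t)" if "continuous_on {0..t0} Z" for Z
    by (intro indefinite_integral_continuous_1 integrable_continuous_real cl that)
  \<comment> \<open>The error of the potential identity at time t, with W in place of v. Its
    derivative consists of quadratic terms and of terms of size \<eta>, which are collected in
    B.\<close>
  define H where "H t = (\<phi>0 (Y t1) + ?I Y t) - (\<phi>0 (X t1) + ?I X t) - W (X t, t) \<bullet> (Y t - X t)" for t
  define B where "B = (Lip\<^sup>2 / 2 + C) * d\<^sup>2 + \<eta> * (n * (n * C + Lip)) * d"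
  have "\<bar>H t0 - H t1\<bar> \<le> (t0 - t1) * B"
  proof (rule abs_increment_le)
    show "t1 \<le> t0" using t by simp
    have c: "continuous_on {t1..t0} X" "continuous_on {t1..t0} Y"
      using X(1) Y(1) t by (auto intro: continuous_on_subset)
    show "continuous_on {t1..t0} H"
      unfolding H_def W_def
      by (intro continuous_intros cI X(1) Y(1) c
          continuous_on_compose2[OF cutoff_mol_continuous[OF lv K e, of UNIV]]) auto
    fix t assume tt: "t1 < t" "t < t0"
    then have t': "0 \<le> t" "t \<le> t0" "t < S" "0 < t" using t by auto
    obtain W' where W': "((\<lambda>t. W (X t, t)) has_vector_derivative W') (at t)"
      "norm (W' + (\<chi> i. ?m (\<lambda>z. D\<pi> z $ i) (X t, t))) \<le> n * (C * \<eta>)"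
      using W_deriv[OF tt] by blast
    let ?\<delta> = "Y t - X t" and ?\<delta>v = "v (Y t) t - v (X t) t" and ?p = "\<chi> i. ?m (\<lambda>z. D\<pi> z $ i) (X t, t)"
    let ?P = "\<lambda>x. ?m (\<lambda>(x, t). \<pi> x t) (x, t)"
    let ?D = "l (Y t) t - l (X t) t - (W (X t, t) \<bullet> ?\<delta>v + W' \<bullet> ?\<delta>)"
    have "((\<lambda>t. W (X t, t) \<bullet> (Y t - X t)) has_derivative
        (\<lambda>h. W (X t, t) \<bullet> (h *\<^sub>R ?\<delta>v) + (h *\<^sub>R W') \<bullet> (Y t - X t))) (at t)"
      using W'(1) has_vector_derivative_diff[OF Y(2) X(2), of t] tt t'
      unfolding has_vector_derivative_def by (intro has_derivative_inner) auto
    then have "((\<lambda>t. W (X t, t) \<bullet> (Y t - X t)) has_real_derivative (W (X t, t) \<bullet> ?\<delta>v + W' \<bullet> ?\<delta>)) (at t)"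
      unfolding has_field_derivative_def by (rule has_derivative_eq_rhs) (auto simp: algebra_simps)
    then have "(H has_real_derivative (0 + l (Y t) t) - (0 + l (X t) t) - (W (X t, t) \<bullet> ?\<delta>v + W' \<bullet> ?\<delta>)) (at t)"
      unfolding H_def[abs_def] by (intro DERIV_diff DERIV_add DERIV_const dI X(1) Y(1) tt)
    then have "(H has_real_derivative ?D) (at t)" by simp
    moreover have "\<bar>?D\<bar> \<le> B"
    proof -
      \<comment> \<open>This is where the Lagrangian pays off: |v(Y)|^2/2 - |v(X)|^2/2 - v(X) .
        (v(Y) - v(X)) is the square |v(Y) - v(X)|^2/2, and the linear part of the pressure increment
        cancels against W' up to the error of \<open>W_deriv\<close>.\<close>
      have id: "?D = (?\<delta>v \<bullet> ?\<delta>v) / 2 - (W (X t, t) - v (X t) t) \<bullet> ?\<delta>v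
          - (?P (Y t) - ?P (X t) - ?p \<bullet> ?\<delta>) - (W' + ?p) \<bullet> ?\<delta>"
        unfolding l_def
        by (simp add: inner_diff_left inner_diff_right inner_add_left inner_commute[of "v (Y t) t" "v (X t) t"] field_simps)
      have \<delta>: "norm ?\<delta> \<le> d" using d t' by blast
      have \<delta>v: "norm ?\<delta>v \<le> Lip * d"
        using order_trans[OF v_Lipschitz mult_left_mono[OF \<delta>]] t' Lip_pos by simp
      have "\<bar>(?\<delta>v \<bullet> ?\<delta>v) / 2\<bar> \<le> Lip\<^sup>2 / 2 * d\<^sup>2"
        using power_mono[OF \<delta>v, of 2] by (simp add: power2_norm_eq_inner power_mult_distrib)
      moreover have "\<bar>(W (X t, t) - v (X t) t) \<bullet> ?\<delta>v\<bar> \<le> (n * \<eta>) * (Lip * d)"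
      proof -
        have "\<bar>(W (X t, t) - v (X t) t) \<bullet> ?\<delta>v\<bar> \<le> norm (W (X t, t) - v (X t) t) * norm ?\<delta>v"
          by (rule Cauchy_Schwarz_ineq2)
        also have "\<dots> \<le> (n * \<eta>) * (Lip * d)"
          using W_approx[OF r(1)[OF t'(1,2)]] tt \<delta>v n0 \<eta> by (intro mult_mono) auto
        finally show ?thesis .
      qed
      moreover have "\<bar>?P (Y t) - ?P (X t) - ?p \<bullet> ?\<delta>\<bar> \<le> C * d\<^sup>2"
      proof -
        have "\<bar>?P (Y t) - ?P (X t) - ?p \<bullet> ?\<delta>\<bar> \<le> C * (norm ?\<delta>)\<^sup>2"
          using tt by (intro P_Taylor r t') auto
        also have "\<dots> \<le> C * d\<^sup>2" using \<delta> C_nonneg by (intro mult_left_mono power_mono) auto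
        finally show ?thesis .
      qed
      moreover have "\<bar>(W' + ?p) \<bullet> ?\<delta>\<bar> \<le> (n * (C * \<eta>)) * d"
      proof -
        have "\<bar>(W' + ?p) \<bullet> ?\<delta>\<bar> \<le> norm (W' + ?p) * norm ?\<delta>" by (rule Cauchy_Schwarz_ineq2)
        also have "\<dots> \<le> (n * (C * \<eta>)) * d"
          using W'(2) \<delta> n0 C_nonneg \<eta> by (intro mult_mono) auto
        finally show ?thesis .
      qed
      ultimately have "\<bar>?D\<bar> \<le> Lip\<^sup>2 / 2 * d\<^sup>2 + (n * \<eta>) * (Lip * d) + C * d\<^sup>2 + (n * (C * \<eta>)) * d"
        unfolding id by linarith
      also have "\<dots> \<le> B"
      proof -
        \<comment> \<open>B carries n (n C) where the estimate yields n C; \<open>1 \<le> n\<close>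
          bridges the two.\<close>
        have n1: "1 \<le> n" by (simp add: n_def Suc_le_eq)
        have "(C * \<eta> * d * n) * 1 \<le> (C * \<eta> * d * n) * n"
          using n1 n0 C_nonneg \<eta> d0 by (intro mult_left_mono) auto
        then show ?thesis by (simp add: B_def algebra_simps)
      qed
      finally show ?thesis .
    qed
    ultimately show "\<exists>D. (H has_real_derivative D) (at t) \<and> \<bar>D\<bar> \<le> B" by blast
  qed
  moreover have "(t0 - t1) * B \<le> t0 * B"
    unfolding B_def using t n0 C_nonneg \<eta> d0 Lip_pos
    by (intro mult_right_mono add_nonneg_nonneg mult_nonneg_nonneg) auto
  \<comment> \<open>The integration starts at t1 > 0 so that the kernel fits into \<Omega>; passing
    from the initial velocity to W at time t1 costs (1 + n) \<eta>, and \<phi>0 contributes its own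
    quadratic error.\<close>
  moreover have "\<bar>H t1\<bar> \<le> K0 * d\<^sup>2 + (1 + n) * \<eta> * d"
  proof -
    let ?x = "X t1" and ?y = "Y t1"
    have tt: "0 \<le> t1" "t1 \<le> t0" using t by auto
    have \<delta>: "norm (?y - ?x) \<le> d" using d tt by blast
    have "\<bar>\<phi>0 ?y - \<phi>0 ?x - v ?x 0 \<bullet> (?y - ?x)\<bar> \<le> K0 * d\<^sup>2"
      using order_trans[OF K0(2) mult_left_mono[OF power_mono[OF \<delta>, of 2] K0(1)]] by simp
    moreover have "\<bar>(v ?x 0 - W (?x, t1)) \<bullet> (?y - ?x)\<bar> \<le> ((1 + n) * \<eta>) * d"
    proof -
      have "norm (v ?x 0 - W (?x, t1)) \<le> norm (v ?x t1 - v ?x 0) + norm (W (?x, t1) - v ?x t1)"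
        using norm_triangle_ineq4[of "v ?x 0 - v ?x t1" "W (?x, t1) - v ?x t1"] by (simp add: norm_minus_commute)
      also have "\<dots> \<le> \<eta> + n * \<eta>"
        using ini[OF r(1)[OF tt]] W_approx[OF r(1)[OF tt] order_refl tt(2)] by linarith
      finally have "norm (v ?x 0 - W (?x, t1)) * norm (?y - ?x) \<le> ((1 + n) * \<eta>) * d"
        using \<delta> n0 \<eta> by (intro mult_mono) (auto simp: algebra_simps)
      then show ?thesis using Cauchy_Schwarz_ineq2 order_trans by blast
    qed
    moreover have "H t1 = (\<phi>0 ?y - \<phi>0 ?x - v ?x 0 \<bullet> (?y - ?x)) + (v ?x 0 - W (?x, t1)) \<bullet> (?y - ?x)"
      by (simp add: H_def inner_diff_left)
    ultimately show ?thesis by linarith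
  qed
  moreover have "\<bar>(W (X t0, t0) - v (X t0) t0) \<bullet> (Y t0 - X t0)\<bar> \<le> (n * \<eta>) * d"
  proof -
    have tt: "0 \<le> t0" "t1 \<le> t0" using t by auto
    have "norm (W (X t0, t0) - v (X t0) t0) * norm (Y t0 - X t0) \<le> (n * \<eta>) * d"
      using W_approx[OF r(1)[OF tt(1) order_refl] tt(2) order_refl] d[OF tt(1) order_refl] n0 \<eta>
      by (intro mult_mono) auto
    then show ?thesis using Cauchy_Schwarz_ineq2 order_trans by blast
  qed
  moreover have "(\<phi>0 (Y t1) + ?I Y t0) - (\<phi>0 (X t1) + ?I X t0) - v (X t0) t0 \<bullet> (Y t0 - X t0) =
      (H t0 - H t1) + H t1 + (W (X t0, t0) - v (X t0) t0) \<bullet> (Y t0 - X t0)"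
    by (simp add: H_def inner_diff_left)
  ultimately have "\<bar>(\<phi>0 (Y t1) + ?I Y t0) - (\<phi>0 (X t1) + ?I X t0) - v (X t0) t0 \<bullet> (Y t0 - X t0)\<bar>
      \<le> t0 * B + (K0 * d\<^sup>2 + (1 + n) * \<eta> * d) + (n * \<eta>) * d" by linarith
  also have "\<dots> = (K0 + t0 * (Lip\<^sup>2 / 2 + C)) * d\<^sup>2 + \<eta> * ((1 + n) + t0 * n * (n * C + Lip) + n) * d"
    by (simp add: B_def algebra_simps)
  finally show ?thesis .
qed

end

section \<open>Velocities as gradients, and their linearity\<close>

lemma AE_continuous_eq:
  fixes f :: "'a::euclidean_space \<Rightarrow> 'b::real_normed_vector"
  assumes ae: "AE x in lborel. x \<in> U \<longrightarrow> f x = 0" and U: "open U" and f: "continuous_on U f" and x: "x \<in> U"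
  shows "f x = 0"
proof (rule ccontr)
  assume "f x \<noteq> 0"
  have "open (U \<inter> f -` (- {0}))" using f U by (intro continuous_open_preimage) auto
  then obtain y where "y \<in> U \<inter> f -` (- {0})" "y \<in> U \<longrightarrow> f y = 0"
    using AE_open_obtain[OF ae] x \<open>f x \<noteq> 0\<close> by blast
  then show False by auto
qed

lemma sum_Basis_axis: "(\<Sum>b\<in>(Basis :: (real^'n) set). g b) = (\<Sum>i\<in>UNIV. g (axis i 1))"
proof -
  have "(Basis :: (real^'n) set) = range (\<lambda>i :: 'n. axis i (1::real))"
    by (auto simp: Basis_vec_def)
  moreover have "inj (\<lambda>i :: 'n. axis i (1::real))"
    by (auto simp: inj_on_def axis_eq_axis)
  ultimately show ?thesis by (metis (no_types, lifting) o_def sum.cong sum.reindex)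
qed

lemma divergence_free_weak:
  fixes f :: "real^'n \<Rightarrow> real^'n"
  assumes "divergence_free f" "\<phi> \<in> test_functions UNIV"
  shows "(LINT x|lborel. (\<Sum>b\<in>Basis. (f x \<bullet> b) * pd b \<phi> x)) = 0"
proof -
  obtain Df where Df: "\<And>i j. weak_deriv UNIV (axis j 1) (\<lambda>x. f x $ i) (\<lambda>x. Df x $ i $ j)"
    "AE x in lborel. trace (Df x) = 0"
    using assms(1) by (auto simp: divergence_free_def weak_jacobian_def weak_gradient_def)
  have i: "integrable lborel (\<lambda>x. f x $ i * pd (axis i 1) \<phi> x)" "integrable lborel (\<lambda>x. Df x $ i $ i * \<phi> x)" for i
    using Df(1)[of i i] assms(2)
    by (auto simp: weak_deriv_def intro!: locally_integrable_mult_test test_functions_pd)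
  have "(LINT x|lborel. (\<Sum>b\<in>Basis. (f x \<bullet> b) * pd b \<phi> x)) = (\<Sum>i\<in>UNIV. LINT x|lborel. f x $ i * pd (axis i 1) \<phi> x)"
    unfolding sum_Basis_axis using i by (subst Bochner_Integration.integral_sum) (auto simp: inner_axis)
  also have "\<dots> = (\<Sum>i\<in>UNIV. - (LINT x|lborel. Df x $ i $ i * \<phi> x))"
    using Df(1) assms(2) by (intro sum.cong) (auto simp: weak_deriv_def)
  also have "\<dots> = - (LINT x|lborel. (\<Sum>i\<in>UNIV. Df x $ i $ i * \<phi> x))"
    using i by (subst Bochner_Integration.integral_sum) (auto simp: sum_negf)
  also have "(LINT x|lborel. (\<Sum>i\<in>UNIV. Df x $ i $ i * \<phi> x)) = (LINT (x::real^'n)|lborel. 0)"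
  proof (rule Bochner_Integration.integral_cong_AE)
    show "AE x in lborel. (\<Sum>i\<in>UNIV. Df x $ i $ i * \<phi> x) = 0"
      using Df(2) by eventually_elim (simp add: trace_def sum_distrib_right[symmetric])
  qed (use i in \<open>auto intro!: borel_measurable_sum borel_measurable_integrable\<close>)
  finally show ?thesis by simp
qed

context euler_slab
begin

text \<open>For each radius m the mollification and the starting time are chosen so fine that the
  linear error is at most |y - x| / (m + 1), while the quadratic constant does not depend on m;
  \<open>potential_limit\<close> then removes the linear error. The potential at x is evaluated
  along the trajectory ending at x.\<close>

lemma potential_exists:
  assumes t0: "0 < t0" "t0 < S"
    and K0: "0 \<le> K0" "\<And>x y. \<bar>\<phi>0 y - \<phi>0 x - v x 0 \<bullet> (y - x)\<bar> \<le> K0 * (norm (y - x))\<^sup>2"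
  obtains F K where "0 \<le> K" "\<And>x y. \<bar>F y - F x - v x t0 \<bullet> (y - x)\<bar> \<le> K * (norm (y - x))\<^sup>2"
proof -
  define E where "E = exp (Lip * t0)"
  define n where "n = real CARD('n)"
  \<comment> \<open>Two trajectories stay within distance E |y - x|, so the square of E enters the
    quadratic constant and E itself the linear one.\<close>
  define K where "K = (K0 + t0 * (Lip\<^sup>2 / 2 + C)) * E\<^sup>2"
  define c where "c = ((1 + n) + t0 * n * (n * C + Lip) + n) * E"
  have E: "0 < E" by (simp add: E_def)
  have n: "0 \<le> n" by (simp add: n_def)
  have K: "0 \<le> K"
    unfolding K_def using K0 t0 C_nonneg by (intro mult_nonneg_nonneg add_nonneg_nonneg) auto
  have c: "0 \<le> c"
    unfolding c_def using E n t0 C_nonneg Lip_pos by (intro mult_nonneg_nonneg add_nonneg_nonneg) auto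
  have lip: "norm (v x t - v y t) \<le> Lip * norm (x - y)" if "0 \<le> t" "t \<le> t0" for x y t
    using that t0 by (intro v_Lipschitz) auto
  have ct0: "continuous_on (UNIV \<times> {0..t0}) (\<lambda>(x, t). v x t)"
    by (rule continuous_on_subset[OF cont]) (use t0 in auto)
  have "\<exists>X. X t0 = x \<and> continuous_on {0..t0} X \<and> (\<forall>t. 0 < t \<longrightarrow> t < t0 \<longrightarrow> (X has_vector_derivative v (X t) t) (at t))" for x
    using backward_trajectory[OF less_imp_le[OF t0(1)] ct0 Lip_pos lip, of x] by metis
  then obtain X where X: "\<And>x. X x t0 = x" "\<And>x. continuous_on {0..t0} (X x)"
    "\<And>x t. 0 < t \<Longrightarrow> t < t0 \<Longrightarrow> (X x has_vector_derivative v (X x t) t) (at t)" by metis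
  have dist_X: "norm (X y s - X x s) \<le> E * norm (y - x)" if "0 \<le> s" "s \<le> t0" for x y s
    using trajectory_distance[OF lip X(2,3) X(2,3) that] Lip_pos by (simp add: X(1) E_def)
  have norm_X: "norm (X x s) \<le> E * norm x" if "0 \<le> s" "s \<le> t0" for x s
    using trajectory_distance[OF lip _ _ X(2,3) that, of "\<lambda>_. 0" x] v_zero_trajectory[OF t0(2)] Lip_pos
    by (simp add: X(1) E_def)
  show thesis
  proof (rule potential_limit[OF K, of "\<lambda>x. v x t0"])
    fix m :: nat
    \<comment> \<open>Chosen so that \<eta> c <= 1 / (m + 1); c + 1 replaces c to keep the
      denominator positive.\<close>
    define \<eta> where "\<eta> = 1 / ((c + 1) * real (Suc m))"
    have \<eta>: "0 < \<eta>" using c by (simp add: \<eta>_def)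
    \<comment> \<open>Trajectories ending in the ball of radius m stay in the ball of radius E m, by
      comparison with the one resting at 0.\<close>
    define r where "r = E * real m"
    have r0: "0 \<le> r" using E by (simp add: r_def)
    define S1 where "S1 = (t0 + S) / 2"
    have S1: "t0 < S1" "S1 < S" using t0 by (auto simp: S1_def)
    define Q where "Q = cball (0 :: real^'n) (r + 1) \<times> {0..S1}"
    have "uniformly_continuous_on Q (\<lambda>(x, t). v x t)"
      using S1 by (intro compact_uniformly_continuous continuous_on_subset[OF cont])
        (auto simp: Q_def intro!: compact_Times)
    then obtain \<delta> where \<delta>: "0 < \<delta>" "\<And>x y. x \<in> Q \<Longrightarrow> y \<in> Q \<Longrightarrow> dist x y < \<delta> \<Longrightarrow>
        dist (v (fst x) (snd x)) (v (fst y) (snd y)) < \<eta>"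
      unfolding uniformly_continuous_on_def case_prod_beta using \<eta> by (metis (no_types, lifting))
    define t1 where "t1 = min (t0 / 2) (\<delta> / 2)"
    have t1: "0 < t1" "t1 < t0" "t1 < \<delta>" using \<delta> t0 by (auto simp: t1_def)
    \<comment> \<open>The kernel has to keep away from t = 0 (e <= t1 / 2), from times beyond S1 (e
      <= S1 - t0) and from the exterior of the larger ball (e <= 1), and to respect the modulus of
      continuity (e < \<delta>).\<close>
    define e where "e = min (min (t1 / 2) (\<delta> / 2)) (min 1 (S1 - t0))"
    have e: "0 < e" "e \<le> t1 / 2" "e < \<delta>" "e \<le> 1" "e \<le> S1 - t0" unfolding e_def using t1 \<delta>(1) S1 by linarith+
    define Kc where "Kc = cball (0 :: real^'n) (r + 1) \<times> {t1 / 2..S1}"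
    have Kc: "compact Kc" "Kc \<subseteq> \<Omega>" "Kc \<subseteq> Q"
      using S1 t1 by (auto simp: Kc_def \<Omega>_def Q_def intro!: compact_Times)
    have ball: "cball (x, t) e \<subseteq> Kc" if "norm x \<le> r" "t1 \<le> t" "t \<le> t0" for x t
    proof
      fix y assume y: "y \<in> cball (x, t) e"
      have "dist x (fst y) \<le> e" "dist t (snd y) \<le> e"
        using dist_fst_le[of "(x, t)" y] dist_snd_le[of "(x, t)" y] y by auto
      then have a: "norm (x - fst y) \<le> e" "\<bar>t - snd y\<bar> \<le> e" by (auto simp: dist_norm)
      then have "norm (fst y) \<le> r + 1" using norm_triangle_ineq2[of "fst y" x] that e by (simp add: norm_minus_commute)
      moreover have "t1 / 2 \<le> snd y" "snd y \<le> S1" using a that e by linarith+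
      ultimately show "y \<in> Kc" by (cases y) (simp add: Kc_def)
    qed
    have osc: "norm (v (fst y) (snd y) - v x t) \<le> \<eta>"
      if "norm x \<le> r" "t1 \<le> t" "t \<le> t0" "y \<in> cball (x, t) e" for x t y
    proof -
      have "(x, t) \<in> cball (x, t) e" using e by simp
      then have "(x, t) \<in> Q" "y \<in> Q" using ball[OF that(1-3)] Kc(3) that(4) by blast+
      moreover have "dist y (x, t) < \<delta>" using that(4) e by (simp add: dist_commute)
      ultimately show ?thesis using \<delta>(2)[of y "(x, t)"] by (simp add: dist_norm)
    qed
    have ini: "norm (v x t1 - v x 0) \<le> \<eta>" if "norm x \<le> r" for x
    proof -
      have "dist (x, t1) (x, 0) < \<delta>" using t1 by (simp add: dist_Pair_Pair dist_norm)
      then show ?thesis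
        using \<delta>(2)[of "(x, t1)" "(x, 0)"] that t1 S1 by (simp add: dist_norm Q_def)
    qed
    let ?l = "\<lambda>x t. (v x t \<bullet> v x t) / 2 - cutoff_mol Kc e (\<lambda>(x, t). \<pi> x t) (x, t)"
    let ?F = "\<lambda>x. \<phi>0 (X x t1) + integral {t1..t0} (\<lambda>s. ?l (X x s) s)"
    show "\<exists>F. \<forall>x y. norm x \<le> real m \<longrightarrow> norm y \<le> real m \<longrightarrow>
        \<bar>F y - F x - v x t0 \<bullet> (y - x)\<bar> \<le> K * (norm (y - x))\<^sup>2 + norm (y - x) / real (Suc m)"
    proof (intro exI[of _ ?F] allI impI)
      fix x y :: "real^'n" assume xy: "norm x \<le> real m" "norm y \<le> real m"
      have r: "norm (X z t) \<le> r" if "norm z \<le> real m" "0 \<le> t" "t \<le> t0" for z t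
        using order_trans[OF norm_X[OF that(2,3)] mult_left_mono[OF that(1)]] E by (simp add: r_def)
      have "\<bar>?F y - ?F x - v (X x t0) t0 \<bullet> (X y t0 - X x t0)\<bar>
        \<le> (K0 + t0 * (Lip\<^sup>2 / 2 + C)) * (E * norm (y - x))\<^sup>2
          + \<eta> * ((1 + n) + t0 * n * (n * C + Lip) + n) * (E * norm (y - x))"
        unfolding n_def
        by (rule circulation_estimate[OF t1(1,2) t0(2) e(1) Kc(1,2) less_imp_le[OF \<eta>] ball osc ini K0
              X(2,3) X(2,3) r[OF xy(1)] r[OF xy(2)] dist_X])
      also have "\<dots> = K * (norm (y - x))\<^sup>2 + (\<eta> * c) * norm (y - x)"
        by (simp add: K_def c_def power_mult_distrib algebra_simps)
      also have "(\<eta> * c) * norm (y - x) \<le> (1 / real (Suc m)) * norm (y - x)"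
      proof (rule mult_right_mono)
        have "\<eta> * c = (c / (c + 1)) * (1 / real (Suc m))" by (simp add: \<eta>_def)
        also have "\<dots> \<le> 1 * (1 / real (Suc m))" using c by (intro mult_right_mono) auto
        finally show "\<eta> * c \<le> 1 / real (Suc m)" by simp
      qed simp
      finally show "\<bar>?F y - ?F x - v x t0 \<bullet> (y - x)\<bar> \<le> K * (norm (y - x))\<^sup>2 + norm (y - x) / real (Suc m)"
        by (simp add: X(1))
    qed
  next
    fix F assume "\<And>x y. \<bar>F y - F x - v x t0 \<bullet> (y - x)\<bar> \<le> K * (norm (y - x))\<^sup>2"
    then show thesis by (rule that[OF K])
  qed
qed

text \<open>Incompressibility is known for almost every time only, and at those times the Liouville
  theorem gives linearity; additivity and homogeneity are equations between functions continuous in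
  t, so they extend to all times.\<close>

lemma v_linear:
  assumes t: "0 < t" "t < S"
    and K0: "0 \<le> K0" "\<And>x y. \<bar>\<phi>0 y - \<phi>0 x - v x 0 \<bullet> (y - x)\<bar> \<le> K0 * (norm (y - x))\<^sup>2"
    and div: "AE t in lborel. 0 < t \<and> t < S \<longrightarrow> divergence_free (\<lambda>x. v x t)"
  shows "linear (\<lambda>x. v x t)"
proof -
  have lin: "AE t in lborel. 0 < t \<and> t < S \<longrightarrow> linear (\<lambda>x. v x t)"
    using div
  proof eventually_elim
    case (elim t)
    show ?case
    proof
      assume t: "0 < t \<and> t < S"
      then have t': "0 < t" "t < S" by auto
      obtain F K where F: "0 \<le> K" "\<And>x y. \<bar>F y - F x - v x t \<bullet> (y - x)\<bar> \<le> K * (norm (y - x))\<^sup>2"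
        by (rule potential_exists[OF t' K0]) (rule that)
      interpret quadratic_potential F "\<lambda>x. v x t" K Lip
        using t F elim Lip_pos v_Lipschitz[of t]
        by unfold_locales (auto intro: divergence_free_weak)
      show "linear (\<lambda>x. v x t)" using t v0 by (intro w_linear) auto
    qed
  qed
  have c: "continuous_on {0<..<S} (\<lambda>t. v x t)" for x
    by (intro cont_comp continuous_intros) auto
  have "v (x + y) t - (v x t + v y t) = 0" for x y
  proof (rule AE_continuous_eq[of "{0<..<S}" "\<lambda>t. v (x + y) t - (v x t + v y t)"])
    show "AE t in lborel. t \<in> {0<..<S} \<longrightarrow> v (x + y) t - (v x t + v y t) = 0"
      using lin by eventually_elim (use linear_add[of "\<lambda>x. v x t" x y for t] in auto)
  qed (use t in \<open>auto intro!: continuous_intros c\<close>)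
  moreover have "v (a *\<^sub>R x) t - a *\<^sub>R v x t = 0" for a x
  proof (rule AE_continuous_eq[of "{0<..<S}" "\<lambda>t. v (a *\<^sub>R x) t - a *\<^sub>R v x t"])
    show "AE t in lborel. t \<in> {0<..<S} \<longrightarrow> v (a *\<^sub>R x) t - a *\<^sub>R v x t = 0"
      using lin by eventually_elim (use linear_scale[of "\<lambda>x. v x t" a x for t] in auto)
  qed (use t in \<open>auto intro!: continuous_intros c\<close>)
  ultimately show ?thesis by (intro linearI) auto
qed

end

section \<open>Asymptotic polynomials\<close>

lemma bump_eq_rbump: "bump = rbump"
proof
  fix x :: "real^'n"
  have "norm x < 1 \<longleftrightarrow> x \<bullet> x < 1" by (simp add: norm_eq_sqrt_inner)
  then show "bump x = rbump x"
    by (auto simp: bump_def rbump_def exp_step_def power2_norm_eq_inner)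
qed

lemma mollifier_scaled_eq_mol:
  assumes r: "0 < r"
  shows "mollifier_scaled r = (mol r :: real^'n \<Rightarrow> real)"
proof
  fix x :: "real^'n"
  have m: "(\<lambda>y::real^'n. rbump ((1 / r) *\<^sub>R y)) \<in> borel_measurable borel"
    using test_functions_continuous[OF rbump_scaled_test_function[OF r]] by (rule borel_measurable_continuous_onI)
  have "(LINT y|lborel. rbump ((1 / r) *\<^sub>R (y::real^'n))) = r ^ CARD('n) * (LINT y|lborel. rbump (y::real^'n))"
    using lborel_integral_affine[OF m, of r 0] r by simp
  then show "mollifier_scaled r x = mol r x"
    by (simp add: mollifier_scaled_def mollifier_def mol_def bump_eq_rbump)
qed

lemma mol_minus: "mol e (- x) = mol e x"
  by (simp add: mol_def rbump_minus)

lemma locally_integrable_measurable: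
  fixes f :: "'a::euclidean_space \<Rightarrow> real"
  assumes "locally_integrable_on f UNIV"
  shows "f \<in> borel_measurable lborel"
proof (rule borel_measurable_LIMSEQ_real)
  show "(\<lambda>x. indicator (cball 0 (real n)) x *\<^sub>R f x) \<in> borel_measurable lborel" for n
    using assms by (intro borel_measurable_integrable) (auto simp: locally_integrable_on_def set_integrable_def)
  show "(\<lambda>n. indicator (cball 0 (real n)) x *\<^sub>R f x) \<longlonglongrightarrow> f x" for x
  proof (rule tendsto_eventually)
    obtain N :: nat where "norm x < real N" using reals_Archimedean2 by blast
    then show "eventually (\<lambda>n. indicator (cball 0 (real n)) x *\<^sub>R f x = f x) sequentially"
      unfolding eventually_sequentially by (intro exI[of _ N]) auto
  qed
qed

lemma convolution_AE_const:
  assumes "g \<in> borel_measurable lborel" "AE x in lborel. g x = c" "0 < r"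
  shows "convolution g (mollifier_scaled r) x0 = c"
proof -
  have [measurable]: "mol r \<in> borel_measurable borel" by (rule mol_measurable[OF assms(3)])
  have [measurable]: "g \<in> borel_measurable borel" using assms(1) by simp
  have "convolution g (mollifier_scaled r) x0 = (LINT y|lborel. c * mol r (x0 - y))"
    unfolding convolution_def mollifier_scaled_eq_mol[OF assms(3)]
  proof (rule Bochner_Integration.integral_cong_AE)
    show "AE y in lborel. g y * mol r (x0 - y) = c * mol r (x0 - y)"
      using assms(2) by eventually_elim simp
  qed measurable
  then show ?thesis using assms(3) by (simp add: integral_mol)
qed

lemma P0_infty_AE_const:
  assumes "g \<in> borel_measurable lborel" "AE x in lborel. g x = c"
  shows "P0_infty g c"
  unfolding P0_infty_def
proof
  fix x0
  have "eventually (\<lambda>r. c = convolution g (mollifier_scaled r) x0) at_top"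
    using eventually_gt_at_top[of 0] by eventually_elim (simp add: convolution_AE_const[OF assms])
  then show "((\<lambda>r. convolution g (mollifier_scaled r) x0) \<longlongrightarrow> c) at_top"
    by (rule tendsto_eventually[THEN Lim_transform_eventually, rotated]) (simp add: eventually_True)
qed

lemma P0_infty_unique: "P0_infty g c \<Longrightarrow> P0_infty g d \<Longrightarrow> c = d"
  unfolding P0_infty_def using tendsto_unique[OF trivial_limit_at_top_linorder] by blast

lemma has_real_derivative_linear_line:
  fixes A :: "real^'n^'m"
  shows "((\<lambda>s. (A *v (x + s *\<^sub>R axis j 1)) $ i) has_real_derivative A $ i $ j) (at s)"
proof -
  have "(\<lambda>s. (A *v (x + s *\<^sub>R axis j 1)) $ i) = (\<lambda>s. (A *v x) $ i + s * A $ i $ j)"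
    by (simp add: matrix_vector_right_distrib scaleR_matrix_vector_assoc[symmetric] matrix_vector_mult_scaleR
        matrix_vector_mult_basis column_def)
  then show ?thesis by (auto intro!: derivative_eq_intros)
qed

lemma continuous_on_linear_component: "continuous_on S (\<lambda>x. ((A :: real^'n^'m) *v x) $ i)"
  by (intro continuous_intros linear_continuous_on matrix_vector_mul_bounded_linear)

lemma weak_deriv_matrix_vector:
  fixes A :: "real^'n^'m"
  shows "weak_deriv UNIV (axis j 1) (\<lambda>x. (A *v x) $ i) (\<lambda>x. A $ i $ j)"
  using has_real_derivative_linear_line[where s=0]
  by (intro weak_deriv_classical continuous_on_linear_component) simp_all

lemma integral_linear_pd:
  fixes A :: "real^'n^'m"
  assumes "\<mu> \<in> test_functions UNIV"
  shows "(LINT x|lborel. (A *v x) $ i * pd (axis j 1) \<mu> x) = - A $ i $ j * (LINT x|lborel. \<mu> x)"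
  using weak_deriv_matrix_vector[of j A i] assms by (simp add: weak_deriv_def)

text \<open>The pressure enters the evolution of a linear velocity only through its second derivatives in
  the mean, and these are prescribed by the condition on \<open>P1dot_infty\<close>.\<close>

lemma is_Pi_linear_limit:
  fixes B :: "real^'n^'n"
  assumes "is_Pi p (\<lambda>x. B *v x) q"
  shows "(\<lambda>m. LINT x|lborel. q x * pd (axis i 1) (pd (axis j 1) (mol (real (Suc m)))) x) \<longlonglongrightarrow>
     (if i = j then - (1 / real CARD('n)) * (\<Sum>a\<in>UNIV. \<Sum>b\<in>UNIV. B $ b $ a * B $ a $ b) else 0)"
proof -
  from assms obtain G Dv c where G: "weak_gradient q G"
    and Dv: "weak_jacobian (\<lambda>x. B *v x) Dv"
    and c: "P0_infty (\<lambda>x. \<Sum>i\<in>UNIV. \<Sum>j\<in>UNIV. Dv x $ j $ i * Dv x $ i $ j) c"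
    and P1: "P1dot_infty G (\<lambda>x. (- (1 / real CARD('n)) * c) *\<^sub>R x)"
    unfolding is_Pi_def by blast
  obtain DG M where DG: "weak_jacobian G DG" "\<And>i j. P0_infty (\<lambda>x. DG x $ i $ j) (M $ i $ j)"
    and M: "(\<lambda>x. (- (1 / real CARD('n)) * c) *\<^sub>R x) = (\<lambda>x. M *v x)"
    using P1 unfolding P1dot_infty_def by blast
  have wDv: "weak_deriv UNIV (axis b 1) (\<lambda>x. (B *v x) $ a) (\<lambda>x. Dv x $ a $ b)" for a b
    using Dv by (simp add: weak_jacobian_def weak_gradient_def)
  \<comment> \<open>\<open>is_Pi\<close> provides some weak Jacobian; by uniqueness it is B almost
    everywhere, which makes the asymptotic value c equal to the trace of B^2.\<close>
  have "AE x in lborel. Dv x $ a $ b = B $ a $ b" for a b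
    using weak_deriv_unique[OF open_UNIV wDv weak_deriv_matrix_vector] by simp
  then have "AE x in lborel. \<forall>a b. Dv x $ a $ b = B $ a $ b"
    by (simp add: AE_all_countable)
  then have "AE x in lborel. (\<Sum>i\<in>UNIV. \<Sum>j\<in>UNIV. Dv x $ j $ i * Dv x $ i $ j) =
      (\<Sum>a\<in>UNIV. \<Sum>b\<in>UNIV. B $ b $ a * B $ a $ b)"
    by eventually_elim simp
  moreover have "(\<lambda>x. \<Sum>i\<in>UNIV. \<Sum>j\<in>UNIV. Dv x $ j $ i * Dv x $ i $ j) \<in> borel_measurable lborel"
    using wDv locally_integrable_measurable
    by (intro borel_measurable_sum borel_measurable_times) (auto simp: weak_deriv_def)
  ultimately have c_eq: "c = (\<Sum>a\<in>UNIV. \<Sum>b\<in>UNIV. B $ b $ a * B $ a $ b)"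
    using P0_infty_unique[OF c P0_infty_AE_const] by blast
  have M_eq: "M $ i $ j = (if i = j then - (1 / real CARD('n)) * c else 0)"
  proof -
    have "M *v axis j 1 = (- (1 / real CARD('n)) * c) *\<^sub>R axis j 1" using fun_cong[OF M, of "axis j 1"] by simp
    then have "(M *v axis j 1) $ i = (- (1 / real CARD('n)) * c) * axis j 1 $ i" by simp
    moreover have "(M *v axis j 1) $ i = M $ i $ j"
      by (simp add: matrix_vector_mult_basis column_def)
    moreover have "axis j (1::real) $ i = (if i = j then 1 else 0)" by (simp add: axis_def)
    ultimately show ?thesis by simp
  qed
  \<comment> \<open>Two weak integrations by parts move both derivatives to q; the kernel is even,
    so the result is a convolution evaluated at 0.\<close>
  have "(LINT x|lborel. q x * pd (axis i 1) (pd (axis j 1) (mol r)) x) =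
      convolution (\<lambda>x. DG x $ i $ j) (mollifier_scaled r) 0" if r: "0 < r" for r
  proof -
    note t = mol_test_function[OF r, where 'a="real^'n"]
    have "(LINT x|lborel. q x * pd (axis i 1) (pd (axis j 1) (mol r)) x) =
        - (LINT x|lborel. G x $ i * pd (axis j 1) (mol r) x)"
      using G test_functions_pd[OF t] by (simp add: weak_gradient_def weak_deriv_def)
    also have "\<dots> = (LINT x|lborel. DG x $ i $ j * mol r x)"
      using DG(1) t by (simp add: weak_jacobian_def weak_gradient_def weak_deriv_def)
    finally show ?thesis
      by (simp add: convolution_def mollifier_scaled_eq_mol[OF r] mol_minus)
  qed
  \<comment> \<open>Integer radii give the limit as well, and a sequence of radii keeps the
    exceptional null sets in time countable later.\<close>
  moreover have "(\<lambda>m. convolution (\<lambda>x. DG x $ i $ j) (mollifier_scaled (real (Suc m))) 0) \<longlonglongrightarrow> M $ i $ j"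
  proof -
    have "filterlim (\<lambda>m. real (Suc m)) at_top sequentially"
      using filterlim_real_sequentially by (simp add: filterlim_sequentially_Suc del: of_nat_Suc)
    from filterlim_compose[OF DG(2)[unfolded P0_infty_def, rule_format] this] show ?thesis .
  qed
  ultimately have "(\<lambda>m. LINT x|lborel. q x * pd (axis i 1) (pd (axis j 1) (mol (real (Suc m)))) x) \<longlonglongrightarrow> M $ i $ j"
    by (simp del: of_nat_Suc)
  then show ?thesis unfolding M_eq c_eq .
qed

section \<open>Weak derivatives on an interval\<close>

lemma locally_integrable_mono: "locally_integrable_on f \<Omega> \<Longrightarrow> \<Omega>' \<subseteq> \<Omega> \<Longrightarrow> locally_integrable_on f \<Omega>'"
  unfolding locally_integrable_on_def by (meson order_trans)

lemma weak_deriv_mono: "weak_deriv \<Omega> b f g \<Longrightarrow> \<Omega>' \<subseteq> \<Omega> \<Longrightarrow> weak_deriv \<Omega>' b f g"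
  unfolding weak_deriv_def using locally_integrable_mono test_functions_mono by (metis subsetD)

lemma weak_deriv_cong_AE:
  fixes f :: "'a::euclidean_space \<Rightarrow> real"
  assumes w: "weak_deriv \<Omega> b f g" and h: "locally_integrable_on h \<Omega>" and ae: "AE x in lborel. x \<in> \<Omega> \<longrightarrow> g x = h x"
  shows "weak_deriv \<Omega> b f h"
  unfolding weak_deriv_def
proof (intro conjI ballI)
  show "locally_integrable_on f \<Omega>" using w by (simp add: weak_deriv_def)
  fix \<phi> assume \<phi>: "\<phi> \<in> test_functions \<Omega>"
  then obtain K where K: "K \<subseteq> \<Omega>" "\<And>x. x \<notin> K \<Longrightarrow> \<phi> x = 0" by (metis test_functionsE)
  have "(LINT x|lborel. g x * \<phi> x) = (LINT x|lborel. h x * \<phi> x)"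
  proof (rule Bochner_Integration.integral_cong_AE)
    show "AE x in lborel. g x * \<phi> x = h x * \<phi> x"
      using ae by eventually_elim (use K in \<open>metis mult_zero_right subsetD\<close>)
    show "(\<lambda>x. g x * \<phi> x) \<in> borel_measurable lborel" "(\<lambda>x. h x * \<phi> x) \<in> borel_measurable lborel"
      using w by (auto simp: weak_deriv_def simp del: measurable_lborel2
          intro!: borel_measurable_integrable locally_integrable_mult_test[OF _ \<phi>] h)
  qed
  then show "(LINT x|lborel. f x * pd b \<phi> x) = - (LINT x|lborel. h x * \<phi> x)"
    using w \<phi> by (simp add: weak_deriv_def)
qed (rule h)

text \<open>The difference of f and a primitive of g has weak derivative 0, hence is constant by the
  increment bound with C = 0. The interval is shrunk to [c, d] so that g is continuous on a compact
  interval and has a primitive there.\<close>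

lemma weak_deriv_continuous_imp_classical:
  fixes f g :: "real \<Rightarrow> real"
  assumes w: "weak_deriv {a<..<b} 1 f g" and f: "continuous_on {a<..<b} f" and g: "continuous_on {a<..<b} g"
    and t: "a < t" "t < b"
  shows "(f has_real_derivative g t) (at t)"
proof -
  define c d where "c = (a + t) / 2" and "d = (t + b) / 2"
  have cd: "a < c" "c < t" "t < d" "d < b" using t by (auto simp: c_def d_def)
  have cg: "continuous_on {c..d} g" using g cd by (auto intro: continuous_on_subset)
  let ?Q = "\<lambda>s. integral {c..s} g"
  have dQ: "(?Q has_real_derivative g s) (at s)" if "c < s" "s < d" for s
    using integral_has_real_derivative[OF cg, of s] that by (simp add: at_within_Icc_at)
  have "weak_deriv {c<..<d} 1 ?Q g"
  proof (rule weak_deriv_classical)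
    show "continuous_on {c<..<d} ?Q"
      by (rule continuous_on_subset[OF indefinite_integral_continuous_1[OF integrable_continuous_real[OF cg]]]) auto
    show "continuous_on {c<..<d} g" using cg by (rule continuous_on_subset) auto
    show "((\<lambda>s. ?Q (x + s *\<^sub>R 1)) has_real_derivative g x) (at 0)" if "x \<in> {c<..<d}" for x
      using DERIV_shift[of ?Q "g x" 0 x] dQ[of x] that by (simp add: add.commute)
  qed simp
  moreover have wfg: "weak_deriv {c<..<d} 1 f g"
    by (rule weak_deriv_mono[OF w]) (use cd in auto)
  ultimately have "weak_deriv {c<..<d} 1 (\<lambda>s. \<Sum>k\<in>(UNIV::bool set). (if k then 1 else - 1) * (if k then f else ?Q) s)
      (\<lambda>s. \<Sum>k\<in>(UNIV::bool set). (if k then 1 else - 1) * g s)"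
    by (intro weak_deriv_sum_fun) auto
  then have w0: "weak_deriv {c<..<d} 1 (\<lambda>s. f s - ?Q s) (\<lambda>s. 0)"
    by (simp add: UNIV_bool)
  have cont: "continuous_on {c<..<d} (\<lambda>s. f s - ?Q s)"
  proof (intro continuous_on_diff)
    show "continuous_on {c<..<d} f" using f cd by (auto intro: continuous_on_subset)
    show "continuous_on {c<..<d} ?Q"
      by (rule continuous_on_subset[OF indefinite_integral_continuous_1[OF integrable_continuous_real[OF cg]]]) auto
  qed
  have const: "f s - ?Q s = f t - ?Q t" if s: "c < s" "s < d" for s
  proof -
    have "\<bar>(\<lambda>s. f s - ?Q s) (t + (s - t)) - (\<lambda>s. f s - ?Q s) t\<bar> \<le> 0"
    proof (rule weak_deriv_bounded_imp_increment_bounded[OF open_greaterThanLessThan _ cont])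
      \<comment> \<open>A one-term sum rescales the direction from 1 to s - t.\<close>
      have "weak_deriv {c<..<d} (\<Sum>k\<in>{()}. (s - t) *\<^sub>R 1) (\<lambda>s. f s - ?Q s) (\<lambda>x. \<Sum>k\<in>{()}. (s - t) * 0)"
        by (rule weak_deriv_sum_dir) (use w0 in \<open>auto simp: weak_deriv_def\<close>)
      then show "weak_deriv {c<..<d} (s - t) (\<lambda>s. f s - ?Q s) (\<lambda>x. 0)" by simp
      fix r :: real assume r: "0 \<le> r" "r \<le> 1"
      have "(1 - r) *\<^sub>R t + r *\<^sub>R s \<in> {c<..<d}"
        using r s cd by (intro convexD) auto
      then show "t + r *\<^sub>R (s - t) \<in> {c<..<d}" by (simp add: algebra_simps)
    qed simp
    then show ?thesis by simp
  qed
  have "((\<lambda>s. ?Q s + (f t - ?Q t)) has_real_derivative g t) (at t)"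
    using dQ[of t] cd by (auto intro!: derivative_eq_intros)
  then show ?thesis
  proof (rule has_field_derivative_transform_within_open[where S="{c<..<d}"])
    show "?Q s + (f t - ?Q t) = f s" if "s \<in> {c<..<d}" for s using const[of s] that by simp
  qed (use cd in auto)
qed

section \<open>The evolution of a linear velocity field\<close>

lemma lborel_Fubini:
  fixes f :: "'a::euclidean_space \<times> 'b::euclidean_space \<Rightarrow> real"
  assumes "integrable lborel f"
  shows "(LINT z|lborel. f z) = (LINT t|lborel. LINT x|lborel. f (x, t))"
    and "integrable lborel (\<lambda>t. LINT x|lborel. f (x, t))"
proof -
  have "integrable (lborel \<Otimes>\<^sub>M lborel) (case_prod (\<lambda>x t. f (x, t)))"
    using assms by (simp add: lborel_prod)
  from lborel_pair.integral_snd[OF this] lborel_pair.integrable_snd[OF this]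
  show "(LINT z|lborel. f z) = (LINT t|lborel. LINT x|lborel. f (x, t))"
    "integrable lborel (\<lambda>t. LINT x|lborel. f (x, t))"
    by (simp_all add: lborel_prod)
qed

lemma test_functions_product:
  fixes \<rho> :: "'a::euclidean_space \<Rightarrow> real" and \<theta> :: "real \<Rightarrow> real"
  assumes \<rho>: "\<rho> \<in> test_functions UNIV" and \<theta>: "\<theta> \<in> test_functions I"
  shows "(\<lambda>z. \<rho> (fst z) * \<theta> (snd z)) \<in> test_functions (UNIV \<times> I)"
proof -
  obtain K where K: "compact K" "\<And>x. x \<notin> K \<Longrightarrow> \<rho> x = 0" using \<rho> by (metis test_functionsE)
  obtain J where J: "compact J" "J \<subseteq> I" "\<And>x. x \<notin> J \<Longrightarrow> \<theta> x = 0" using \<theta> by (metis test_functionsE)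
  show ?thesis
  proof (rule test_functionsI[of _ "K \<times> J"])
    show "Ck k (\<lambda>z. \<rho> (fst z) * \<theta> (snd z))" for k
      using Ck_mult[OF Ck_affine[OF bounded_linear_fst test_functions_Ck[OF \<rho>], of k 0]
          Ck_affine[OF bounded_linear_snd test_functions_Ck[OF \<theta>], of k 0]] by simp
    show "\<rho> (fst z) * \<theta> (snd z) = 0" if "z \<notin> K \<times> J" for z
      using that K(2)[of "fst z"] J(3)[of "snd z"] by (cases z) auto
  qed (use K J in \<open>auto intro: compact_Times\<close>)
qed

lemma pd_product:
  fixes \<rho> :: "'a::euclidean_space \<Rightarrow> real" and \<theta> :: "real \<Rightarrow> real"
  assumes \<rho>: "\<rho> \<in> test_functions UNIV" and \<theta>: "\<theta> \<in> test_functions I"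
  shows "pd (h, \<tau>) (\<lambda>z. \<rho> (fst z) * \<theta> (snd z)) z = \<rho> (fst z) * (\<tau> * pd 1 \<theta> (snd z)) + pd h \<rho> (fst z) * \<theta> (snd z)"
proof -
  note d\<rho> = has_derivative_compose[OF has_derivative_fst[OF has_derivative_ident]
      has_derivative_pd[OF test_functions_differentiable[OF \<rho>]]]
  note d\<theta> = has_derivative_compose[OF has_derivative_snd[OF has_derivative_ident]
      has_derivative_pd[OF test_functions_differentiable[OF \<theta>]]]
  have "pd (h, \<tau>) (\<lambda>z. \<rho> (fst z) * \<theta> (snd z)) z = \<rho> (fst z) * pd \<tau> \<theta> (snd z) + pd h \<rho> (fst z) * \<theta> (snd z)"
    using pd_eqI[OF has_derivative_mult[OF d\<rho> d\<theta>], of "(h, \<tau>)" z] by simp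
  moreover have "pd \<tau> \<theta> (snd z) = \<tau> * pd 1 \<theta> (snd z)"
    using pd_Basis_sum[OF test_functions_differentiable[OF \<theta>], of \<tau>] by simp
  ultimately show ?thesis by simp
qed

locale linear_euler_slab = euler_slab v \<pi> S C Dv v_t D\<pi> D2\<pi> \<Omega>
  for v :: "real^'n \<Rightarrow> real \<Rightarrow> real^'n" and \<pi> S C Dv v_t D\<pi> D2\<pi> \<Omega> +
  fixes B :: "real \<Rightarrow> real^'n^'n" and p :: real
  assumes v_B: "\<And>x t. 0 < t \<Longrightarrow> t < S \<Longrightarrow> v x t = B t *v x"
    and cont_B: "continuous_on {0<..<S} B"
    and is_Pi: "AE t in lborel. 0 < t \<and> t < S \<longrightarrow> is_Pi p (\<lambda>x. v x t) (\<lambda>x. \<pi> x t)"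
begin

lemma cont_B_comp: "continuous_on \<Omega> (\<lambda>z. B (snd z))"
  by (rule continuous_on_compose2[OF cont_B]) (auto simp: \<Omega>_def intro!: continuous_intros)

lemma Dv_eq_B: "AE z in lborel. z \<in> \<Omega> \<longrightarrow> Dv z = B (snd z)"
proof -
  have "weak_deriv \<Omega> (axis j 1, 0) (\<lambda>(x, t). v x t $ i) (\<lambda>z. B (snd z) $ i $ j)" for i j
  proof (rule weak_deriv_classical[OF open_\<Omega>])
    show "continuous_on \<Omega> (\<lambda>(x, t). v x t $ i)"
      unfolding case_prod_beta by (intro continuous_intros cont_comp) (auto simp: \<Omega>_def)
    show "continuous_on \<Omega> (\<lambda>z. B (snd z) $ i $ j)"
      by (intro continuous_intros cont_B_comp)
    fix z assume "z \<in> \<Omega>"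
    then have t: "0 < snd z" "snd z < S" by (auto simp: \<Omega>_def)
    then show "((\<lambda>s. (\<lambda>(x, t). v x t $ i) (z + s *\<^sub>R (axis j 1, 0))) has_real_derivative B (snd z) $ i $ j) (at 0)"
      using has_real_derivative_linear_line[of "B (snd z)" "fst z" j i 0] by (cases z) (simp add: v_B)
  qed
  from weak_deriv_unique[OF open_\<Omega> wDv this]
  have "AE z in lborel. z \<in> \<Omega> \<longrightarrow> Dv z $ i $ j = B (snd z) $ i $ j" for i j .
  then have "AE z in lborel. \<forall>i j. z \<in> \<Omega> \<longrightarrow> Dv z $ i $ j = B (snd z) $ i $ j"
    by (simp only: AE_all_countable) simp
  then show ?thesis by eventually_elim (simp add: vec_eq_iff)
qed

text \<open>The weighted mean, at scale r around the origin, of a second derivative of the pressure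
  at time t, with both derivatives moved to the kernel so that only \<pi> itself occurs.\<close>

definition gam :: "real \<Rightarrow> 'n \<Rightarrow> 'n \<Rightarrow> real \<Rightarrow> real" where
  "gam r i j t = (LINT x|lborel. \<pi> x t * pd (axis i 1) (pd (axis j 1) (mol r)) x)"

lemma gam_limit:
  "AE t in lborel. 0 < t \<and> t < S \<longrightarrow> (\<forall>i j. (\<lambda>m. gam (real (Suc m)) i j t) \<longlonglongrightarrow>
    (if i = j then - (1 / real CARD('n)) * (\<Sum>a\<in>UNIV. \<Sum>b\<in>UNIV. B t $ b $ a * B t $ a $ b) else 0))"
  using is_Pi
proof eventually_elim
  case (elim t)
  show ?case
  proof (intro impI allI)
    fix i j assume t: "0 < t \<and> t < S"
    then have "(\<lambda>x. v x t) = (\<lambda>x. B t *v x)" using v_B by auto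
    then have "is_Pi p (\<lambda>x. B t *v x) (\<lambda>x. \<pi> x t)" using elim t by simp
    from is_Pi_linear_limit[OF this]
    show "(\<lambda>m. gam (real (Suc m)) i j t) \<longlonglongrightarrow>
      (if i = j then - (1 / real CARD('n)) * (\<Sum>a\<in>UNIV. \<Sum>b\<in>UNIV. B t $ b $ a * B t $ a $ b) else 0)"
      unfolding gam_def .
  qed
qed

text \<open>Needed for \<open>gam\<close> to occur in a weak derivative in time; Fubini's theorem is
  applied to \<pi> cut off to the support of the kernel times K.\<close>

lemma locally_integrable_gam:
  assumes r: "0 < r"
  shows "locally_integrable_on (gam r i j) {0<..<S}"
  unfolding locally_integrable_on_def
proof (intro allI impI, elim conjE)
  fix K :: "real set" assume K: "compact K" "K \<subseteq> {0<..<S}"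
  let ?\<rho> = "pd (axis i 1) (pd (axis j 1) (mol r)) :: real^'n \<Rightarrow> real"
  have \<rho>: "?\<rho> \<in> test_functions UNIV" by (intro test_functions_pd mol_test_function r)
  obtain Q where Q: "compact Q" "\<And>x. x \<notin> Q \<Longrightarrow> ?\<rho> x = 0" using \<rho> by (metis test_functionsE)
  obtain M where M: "0 \<le> M" "\<And>x. \<bar>?\<rho> x\<bar> \<le> M" using test_functions_bounded[OF \<rho>] by blast
  have "compact (Q \<times> K)" "Q \<times> K \<subseteq> \<Omega>" using K Q by (auto simp: \<Omega>_def intro: compact_Times)
  then have i: "integrable lborel (\<lambda>z. indicator (Q \<times> K) z *\<^sub>R (\<lambda>(x, t). \<pi> x t) z)"
    using wD\<pi> by (auto simp: weak_deriv_def locally_integrable_on_def set_integrable_def)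
  have [measurable]: "?\<rho> \<in> borel_measurable borel"
    using test_functions_continuous[OF \<rho>] by (rule borel_measurable_continuous_onI)
  let ?F = "\<lambda>z. (indicator (Q \<times> K) z *\<^sub>R (\<lambda>(x, t). \<pi> x t) z) * ?\<rho> (fst z)"
  have m: "(\<lambda>z :: (real^'n) \<times> real. ?\<rho> (fst z)) \<in> borel_measurable lborel"
    by (simp add: borel_prod[symmetric])
  have "integrable lborel ?F"
  proof (rule Bochner_Integration.integrable_bound[OF integrable_mult_right[OF i, of M]])
    show "?F \<in> borel_measurable lborel" by (intro borel_measurable_times borel_measurable_integrable i m)
    show "AE z in lborel. norm (?F z) \<le> norm (M * (indicator (Q \<times> K) z *\<^sub>R (\<lambda>(x, t). \<pi> x t) z))"
    proof (rule AE_I2)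
      fix z :: "(real^'n) \<times> real"
      let ?a = "indicator (Q \<times> K) z *\<^sub>R (\<lambda>(x, t). \<pi> x t) z"
      have "\<bar>?a\<bar> * \<bar>?\<rho> (fst z)\<bar> \<le> \<bar>?a\<bar> * M" by (intro mult_left_mono M) auto
      then show "norm (?F z) \<le> norm (M * ?a)" using M(1) by (simp only: real_norm_def abs_mult) (simp add: mult.commute)
    qed
  qed
  from lborel_Fubini(2)[OF this] have "integrable lborel (\<lambda>t. LINT x|lborel. ?F (x, t))" .
  moreover have "(LINT x|lborel. ?F (x, t)) = indicator K t *\<^sub>R gam r i j t" for t
  proof -
    have "?F (x, t) = indicator K t * (\<pi> x t * ?\<rho> x)" for x
      using Q(2)[of x] by (auto simp: indicator_def)
    then have "(LINT x|lborel. ?F (x, t)) = (LINT x|lborel. indicator K t * (\<pi> x t * ?\<rho> x))"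
      by (intro Bochner_Integration.integral_cong refl)
    then show ?thesis by (simp add: gam_def)
  qed
  ultimately show "set_integrable lborel K (gam r i j)" by (simp add: set_integrable_def)
qed

text \<open>The i-th momentum equation is tested with the product of the j-th derivative of the
  kernel in space and \<theta> in time. Since v and (v . grad) v are linear in space, their
  integrals against the kernel derivative are minus matrix entries, whatever r; the pressure
  contributes \<open>gam\<close>.\<close>

lemma weak_deriv_B:
  assumes r: "0 < r"
  shows "weak_deriv {0<..<S} 1 (\<lambda>t. B t $ i $ j) (\<lambda>t. - (gam r i j t + (B t ** B t) $ i $ j))"
  unfolding weak_deriv_def
proof (intro conjI ballI)
  have cB: "continuous_on {0<..<S} (\<lambda>t. B t $ i $ j)" for i j
    by (intro continuous_intros cont_B)
  have cBB: "continuous_on {0<..<S} (\<lambda>t. (B t ** B t) $ i $ j)"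
    unfolding matrix_matrix_mult_def by (auto intro!: continuous_intros cB)
  show lB: "locally_integrable_on (\<lambda>t. B t $ i $ j) {0<..<S}"
    by (intro continuous_imp_locally_integrable cB)
  have lBB: "locally_integrable_on (\<lambda>t. (B t ** B t) $ i $ j) {0<..<S}"
    by (intro continuous_imp_locally_integrable cBB)
  note lg = locally_integrable_gam[OF r, of i j]
  show "locally_integrable_on (\<lambda>t. - (gam r i j t + (B t ** B t) $ i $ j)) {0<..<S}"
    using locally_integrable_sum[of "UNIV::bool set" "\<lambda>k. if k then gam r i j else (\<lambda>t. (B t ** B t) $ i $ j)" _ "\<lambda>_. - 1"] lg lBB
    by (simp add: UNIV_bool algebra_simps)
  fix \<theta> assume \<theta>: "\<theta> \<in> test_functions {0<..<S}"
  obtain J where J: "J \<subseteq> {0<..<S}" "\<And>t. t \<notin> J \<Longrightarrow> \<theta> t = 0" "\<And>b t. t \<notin> J \<Longrightarrow> pd b \<theta> t = 0"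
    using \<theta> by (metis test_functionsE)
  define \<rho> where "\<rho> = (pd (axis j 1) (mol r) :: real^'n \<Rightarrow> real)"
  have \<rho>: "\<rho> \<in> test_functions UNIV" unfolding \<rho>_def by (intro test_functions_pd mol_test_function r)
  define \<phi> where "\<phi> = (\<lambda>z. \<rho> (fst z) * \<theta> (snd z))"
  have \<phi>: "\<phi> \<in> test_functions \<Omega>" unfolding \<phi>_def \<Omega>_def by (rule test_functions_product[OF \<rho> \<theta>])
  have pd_t: "pd (0, 1) \<phi> z = \<rho> (fst z) * pd 1 \<theta> (snd z)" for z
    unfolding \<phi>_def pd_product[OF \<rho> \<theta>]
    by (simp add: linear_0[OF pd_linear[OF test_functions_differentiable[OF \<rho>]]])
  have pd_i: "pd (axis i 1, 0) \<phi> z = pd (axis i 1) \<rho> (fst z) * \<theta> (snd z)" for z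
    unfolding \<phi>_def pd_product[OF \<rho> \<theta>] by simp
  have lv: "locally_integrable_on (\<lambda>(x, t). v x t $ i) \<Omega>" "locally_integrable_on (\<lambda>z. v_t z $ i) \<Omega>"
    using wv_t[of i] by (auto simp: weak_deriv_def)
  have l\<pi>: "locally_integrable_on (\<lambda>(x, t). \<pi> x t) \<Omega>" "locally_integrable_on (\<lambda>z. D\<pi> z $ i) \<Omega>"
    using wD\<pi>[of i] by (auto simp: weak_deriv_def)
  let ?h = "\<lambda>z. ((B (snd z) ** B (snd z)) *v fst z) $ i"
  have "continuous_on \<Omega> ?h"
    unfolding matrix_vector_mult_def matrix_matrix_mult_def vec_lambda_beta
    by (intro continuous_intros cont_B_comp)
  then have lh: "locally_integrable_on ?h \<Omega>" by (rule continuous_imp_locally_integrable)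
  note ivt = locally_integrable_mult_test[OF lv(2) \<phi>] and i\<pi> = locally_integrable_mult_test[OF l\<pi>(2) \<phi>]
    and ih = locally_integrable_mult_test[OF lh \<phi>]
  have mean: "(LINT x|lborel. (A *v x) $ i * \<rho> x) = - A $ i $ j" for A :: "real^'n^'n"
    using integral_linear_pd[OF mol_test_function[OF r], of A i j] integral_mol[OF r, of "0::real^'n"]
    by (simp add: \<rho>_def mol_minus)
  have sum0: "(LINT z|lborel. v_t z $ i * \<phi> z) + (LINT z|lborel. D\<pi> z $ i * \<phi> z) + (LINT z|lborel. ?h z * \<phi> z) = 0"
  proof -
    have "(LINT z|lborel. v_t z $ i * \<phi> z + D\<pi> z $ i * \<phi> z + ?h z * \<phi> z) = (LINT (z :: (real^'n) \<times> real)|lborel. 0)"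
    proof (rule Bochner_Integration.integral_cong_AE)
      show "AE z in lborel. v_t z $ i * \<phi> z + D\<pi> z $ i * \<phi> z + ?h z * \<phi> z = 0"
        using euler Dv_eq_B
      proof eventually_elim
        case (elim z)
        show ?case
        proof (cases "z \<in> \<Omega>")
          case True
          then have t: "0 < snd z" "snd z < S" by (auto simp: \<Omega>_def)
          have "v_t z + Dv z *v v (fst z) (snd z) = - D\<pi> z" "Dv z = B (snd z)" using elim True by auto
          then have "v_t z + D\<pi> z + (B (snd z) ** B (snd z)) *v fst z = 0"
            using v_B[OF t] by (simp add: matrix_vector_mul_assoc eq_neg_iff_add_eq_0 algebra_simps)
          then have "v_t z $ i + D\<pi> z $ i + ?h z = 0" by (metis vector_add_component zero_index)
          then have "(v_t z $ i + D\<pi> z $ i + ?h z) * \<phi> z = 0" by simp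
          then show ?thesis by (simp only: distrib_right)
        next
          case False
          then have "snd z \<notin> J" using J(1) by (cases z) (auto simp: \<Omega>_def)
          then have "\<phi> z = 0" using J(2) by (simp add: \<phi>_def)
          then show ?thesis by simp
        qed
      qed
    qed (use ivt i\<pi> ih in \<open>auto intro!: borel_measurable_add borel_measurable_integrable\<close>)
    then show ?thesis using ivt i\<pi> ih by simp
  qed
  have A1: "(LINT t|lborel. - (B t $ i $ j * pd 1 \<theta> t)) = - (LINT z|lborel. v_t z $ i * \<phi> z)"
  proof -
    have "- (LINT z|lborel. v_t z $ i * \<phi> z) = (LINT z|lborel. (\<lambda>(x, t). v x t $ i) z * pd (0, 1) \<phi> z)"
      using wv_t[of i] \<phi> by (simp add: weak_deriv_def)
    also have "\<dots> = (LINT t|lborel. LINT x|lborel. (\<lambda>(x, t). v x t $ i) (x, t) * pd (0, 1) \<phi> (x, t))"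
      by (rule lborel_Fubini(1)[OF locally_integrable_mult_test[OF lv(1) test_functions_pd[OF \<phi>]]])
    also have "\<dots> = (LINT t|lborel. - (B t $ i $ j * pd 1 \<theta> t))"
    proof (intro Bochner_Integration.integral_cong refl)
      fix t
      have "(LINT x|lborel. v x t $ i * \<rho> x) * pd 1 \<theta> t = - (B t $ i $ j * pd 1 \<theta> t)"
      proof (cases "t \<in> J")
        case True
        then show ?thesis using J(1) by (auto simp: v_B mean)
      qed (simp add: J)
      then show "(LINT x|lborel. (\<lambda>(x, t). v x t $ i) (x, t) * pd (0, 1) \<phi> (x, t)) = - (B t $ i $ j * pd 1 \<theta> t)"
        by (simp add: pd_t mult.assoc[symmetric])
    qed
    finally show ?thesis by simp
  qed
  have A2: "(LINT t|lborel. gam r i j t * \<theta> t) = - (LINT z|lborel. D\<pi> z $ i * \<phi> z)"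
  proof -
    have "- (LINT z|lborel. D\<pi> z $ i * \<phi> z) = (LINT z|lborel. (\<lambda>(x, t). \<pi> x t) z * pd (axis i 1, 0) \<phi> z)"
      using wD\<pi>[of i] \<phi> by (simp add: weak_deriv_def)
    also have "\<dots> = (LINT t|lborel. LINT x|lborel. (\<lambda>(x, t). \<pi> x t) (x, t) * pd (axis i 1, 0) \<phi> (x, t))"
      by (rule lborel_Fubini(1)[OF locally_integrable_mult_test[OF l\<pi>(1) test_functions_pd[OF \<phi>]]])
    also have "\<dots> = (LINT t|lborel. gam r i j t * \<theta> t)"
      by (simp add: pd_i mult.assoc[symmetric] gam_def \<rho>_def)
    finally show ?thesis by simp
  qed
  have A3: "(LINT t|lborel. - ((B t ** B t) $ i $ j * \<theta> t)) = (LINT z|lborel. ?h z * \<phi> z)"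
  proof -
    have "(LINT z|lborel. ?h z * \<phi> z) = (LINT t|lborel. LINT x|lborel. ?h (x, t) * \<phi> (x, t))"
      by (rule lborel_Fubini(1)[OF ih])
    also have "\<dots> = (LINT t|lborel. - ((B t ** B t) $ i $ j * \<theta> t))"
      by (simp add: \<phi>_def mult.assoc[symmetric] mean)
    finally show ?thesis by simp
  qed
  have "(LINT t|lborel. B t $ i $ j * pd 1 \<theta> t) = (LINT t|lborel. gam r i j t * \<theta> t) + (LINT t|lborel. (B t ** B t) $ i $ j * \<theta> t)"
    using sum0 A1 A2 A3 by simp
  also have "\<dots> = - (LINT t|lborel. - (gam r i j t + (B t ** B t) $ i $ j) * \<theta> t)"
    using locally_integrable_mult_test[OF lg \<theta>] locally_integrable_mult_test[OF lBB \<theta>]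
    by (simp add: left_diff_distrib)
  finally show "(LINT t|lborel. B t $ i $ j * pd 1 \<theta> t) = - (LINT t|lborel. - (gam r i j t + (B t ** B t) $ i $ j) * \<theta> t)" .
qed

text \<open>B does not depend on r, so by uniqueness of weak derivatives neither does
  \<open>gam\<close>, for almost every t; it therefore equals its limit for r to infinity, which the
  asymptotic condition prescribes. The right-hand side is then continuous in t, and the weak
  derivative becomes classical.\<close>

lemma B_ode:
  assumes t: "0 < t" "t < S"
  shows "((\<lambda>t. B t $ i $ j) has_real_derivative
    (if i = j then 1 / real CARD('n) * (\<Sum>a\<in>UNIV. \<Sum>b\<in>UNIV. B t $ b $ a * B t $ a $ b) else 0)
      - (B t ** B t) $ i $ j) (at t)"
proof -
  let ?R = "\<lambda>t. (if i = j then 1 / real CARD('n) * (\<Sum>a\<in>UNIV. \<Sum>b\<in>UNIV. B t $ b $ a * B t $ a $ b) else 0)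
      - (B t ** B t) $ i $ j"
  have cB: "continuous_on {0<..<S} (\<lambda>t. B t $ i $ j)" for i j
    by (intro continuous_intros cont_B)
  have cR: "continuous_on {0<..<S} ?R"
    unfolding matrix_matrix_mult_def by (cases "i = j") (auto intro!: continuous_intros cB)
  have "AE t in lborel. t \<in> {0<..<S} \<longrightarrow> - (gam (real (Suc m)) i j t + (B t ** B t) $ i $ j) = - (gam 1 i j t + (B t ** B t) $ i $ j)" for m
    by (rule weak_deriv_unique[OF open_greaterThanLessThan weak_deriv_B weak_deriv_B]) auto
  then have "AE t in lborel. \<forall>m. t \<in> {0<..<S} \<longrightarrow> gam (real (Suc m)) i j t = gam 1 i j t"
    unfolding AE_all_countable by simp
  then have "AE t in lborel. t \<in> {0<..<S} \<longrightarrow> - (gam 1 i j t + (B t ** B t) $ i $ j) = ?R t"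
    using gam_limit
  proof eventually_elim
    case (elim t)
    show ?case
    proof
      assume "t \<in> {0<..<S}"
      with elim have eq: "gam (real (Suc m)) i j t = gam 1 i j t" for m by blast
      have lim: "(\<lambda>m. gam (real (Suc m)) i j t) \<longlonglongrightarrow>
          (if i = j then - (1 / real CARD('n)) * (\<Sum>a\<in>UNIV. \<Sum>b\<in>UNIV. B t $ b $ a * B t $ a $ b) else 0)"
        by (rule mp[OF elim(2), rule_format]) (use \<open>t \<in> {0<..<S}\<close> in simp)
      have "gam 1 i j t = (if i = j then - (1 / real CARD('n)) * (\<Sum>a\<in>UNIV. \<Sum>b\<in>UNIV. B t $ b $ a * B t $ a $ b) else 0)"
        using lim unfolding eq by (simp add: LIMSEQ_const_iff)
      then show "- (gam 1 i j t + (B t ** B t) $ i $ j) = ?R t" by simp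
    qed
  qed
  from weak_deriv_cong_AE[OF weak_deriv_B[OF zero_less_one] continuous_imp_locally_integrable[OF cR] this]
  show ?thesis by (rule weak_deriv_continuous_imp_classical[OF _ cB cR t])
qed

end

section \<open>Linear fields in the function spaces\<close>

lemma Lp_norm_le:
  fixes f :: "'a::euclidean_space \<Rightarrow> 'b::real_normed_vector"
  assumes p: "0 < p" and S: "S \<in> sets borel" "emeasure lborel S < \<infinity>" and M: "0 \<le> M" "\<And>x. x \<in> S \<Longrightarrow> norm (f x) \<le> M"
  shows "Lp_norm p S f \<le> ennreal ((M powr p * measure lborel S) powr (1 / p))"
proof -
  let ?I = "\<integral>\<^sup>+x\<in>S. ennreal (norm (f x) powr p) \<partial>lborel"
  have "?I \<le> (\<integral>\<^sup>+x\<in>S. ennreal (M powr p) \<partial>lborel)"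
    using M p by (intro nn_integral_mono) (auto simp: indicator_def intro!: ennreal_leI powr_mono2)
  also have "\<dots> = ennreal (M powr p) * emeasure lborel S"
    using S by (simp add: nn_integral_cmult_indicator)
  also have "\<dots> = ennreal (M powr p * measure lborel S)"
    using S by (subst emeasure_eq_ennreal_measure) (auto simp: ennreal_mult)
  finally have I: "?I \<le> ennreal (M powr p * measure lborel S)" .
  then have fin: "?I \<noteq> \<infinity>" using ennreal_less_top by (metis infinity_ennreal_def leD)
  have "enn2real ?I \<le> M powr p * measure lborel S"
    using I by (intro enn2real_leI) auto
  then have "enn2real ?I powr (1 / p) \<le> (M powr p * measure lborel S) powr (1 / p)"
    using p by (intro powr_mono2) auto
  then show ?thesis using fin by (simp add: Lp_norm_def Let_def ennreal_leI)
qed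

lemma Lp_norm_0: "Lp_norm p S (\<lambda>x. 0) = 0"
  by (simp add: Lp_norm_def)

lemma continuous_imp_Lp_loc:
  fixes f :: "'a::euclidean_space \<Rightarrow> real"
  assumes "continuous_on UNIV f" "0 < p"
  shows "f \<in> Lp_loc p"
proof -
  have "Lp_norm p (ball 0 R) f < \<infinity>" for R
  proof -
    have "bounded (f ` cball 0 R)"
      by (intro compact_imp_bounded compact_continuous_image continuous_on_subset[OF assms(1)]) auto
    then obtain M where M: "\<forall>y\<in>f ` cball 0 R. norm y \<le> M" unfolding bounded_iff by blast
    have "Lp_norm p (ball 0 R) f \<le> ennreal ((max 0 M powr p * measure lborel (ball (0::'a) R)) powr (1 / p))"
      using assms(2) M by (intro Lp_norm_le) (auto simp: emeasure_lborel_ball_finite[unfolded infinity_ennreal_def] le_max_iff_disj)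
    then show ?thesis using ennreal_less_top le_less_trans by (metis infinity_ennreal_def)
  qed
  moreover have "f \<in> borel_measurable borel" using assms(1) by (rule borel_measurable_continuous_onI)
  ultimately show ?thesis by (simp add: Lp_loc_def)
qed

lemma inner_in_poly_space: "(\<lambda>x :: real^'n. a \<bullet> x) \<in> poly_space 1"
proof -
  \<comment> \<open>The unit multi-indices; c puts the coefficient \<open>a $ i\<close> on the i-th
    one and 0 on all others.\<close>
  define E where "E i = (\<lambda>k. if k = i then 1 else 0 :: nat)" for i :: 'n
  define c where "c \<alpha> = (\<Sum>i\<in>UNIV. if \<alpha> = E i then a $ i else 0)" for \<alpha>
  let ?A = "{\<alpha> :: 'n \<Rightarrow> nat. (\<Sum>i\<in>UNIV. \<alpha> i) \<le> 1}"
  \<comment> \<open>Finiteness of the set of multi-indices matters: a sum over an infinite set would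
    be 0 by default.\<close>
  have "?A \<subseteq> PiE UNIV (\<lambda>_. {..1})"
    by (auto simp: PiE_def extensional_def) (metis finite UNIV_I member_le_sum order_trans zero_le One_nat_def)
  then have fin: "finite ?A" by (rule finite_subset) (auto intro: finite_PiE)
  have E: "E i \<in> ?A" for i by (simp add: E_def)
  have mono: "(\<Prod>k\<in>UNIV. (x $ k) ^ E i k) = x $ i" for x :: "real^'n" and i
  proof -
    have "(\<Prod>k\<in>UNIV. (x $ k) ^ E i k) = (\<Prod>k\<in>UNIV. if k = i then x $ k else 1)"
      by (intro prod.cong) (auto simp: E_def)
    then show ?thesis by simp
  qed
  have "a \<bullet> x = (\<Sum>\<alpha>\<in>?A. c \<alpha> * (\<Prod>i\<in>UNIV. (x $ i) ^ \<alpha> i))" for x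
  proof -
    have "(\<Sum>\<alpha>\<in>?A. c \<alpha> * (\<Prod>i\<in>UNIV. (x $ i) ^ \<alpha> i)) =
        (\<Sum>\<alpha>\<in>?A. \<Sum>i\<in>UNIV. if \<alpha> = E i then a $ i * (\<Prod>k\<in>UNIV. (x $ k) ^ \<alpha> k) else 0)"
      unfolding c_def sum_distrib_right by (intro sum.cong refl) auto
    also have "\<dots> = (\<Sum>i\<in>UNIV. \<Sum>\<alpha>\<in>?A. if \<alpha> = E i then a $ i * (\<Prod>k\<in>UNIV. (x $ k) ^ \<alpha> k) else 0)"
      by (rule sum.swap)
    also have "\<dots> = (\<Sum>i\<in>UNIV. a $ i * x $ i)"
      using fin E by (intro sum.cong refl) (simp add: sum.delta mono)
    finally show ?thesis by (simp add: inner_vec_def)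
  qed
  then show ?thesis unfolding poly_space_def by blast
qed

text \<open>A linear function is its own approximation of degree 1. Hence only the norm on the unit
  ball sees linear fields, and the norm of the explicit solution follows its coefficient.\<close>

lemma L_seminorm_inner: "L_seminorm p (\<lambda>x :: real^'n. a \<bullet> x) = 0"
proof -
  have "osc p 1 (\<lambda>x :: real^'n. a \<bullet> x) x0 r = 0" for x0 r
  proof -
    have "(INF P\<in>poly_space 1. Lp_norm p (ball x0 r) (\<lambda>x. a \<bullet> x - P x)) \<le> Lp_norm p (ball x0 r) (\<lambda>x. a \<bullet> x - a \<bullet> x)"
      by (rule INF_lower2[OF inner_in_poly_space[of a]]) simp
    then show ?thesis by (simp add: osc_def Lp_norm_0)
  qed
  then show ?thesis by (simp add: L_seminorm_def)
qed

lemma L_space_inner: "0 < p \<Longrightarrow> (\<lambda>x :: real^'n. a \<bullet> x) \<in> L_space p"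
  by (auto simp: L_space_def L_seminorm_inner intro!: continuous_imp_Lp_loc continuous_intros)

lemma L_vec_space_linear: "0 < p \<Longrightarrow> (\<lambda>x. (A :: real^'n^'n) *v x) \<in> L_vec_space p"
  by (simp add: L_vec_space_def matrix_vector_mul_component L_space_inner)

lemma weak_jacobian_linear: "weak_jacobian (\<lambda>x. (A :: real^'n^'n) *v x) (\<lambda>x. A)"
  by (simp add: weak_jacobian_def weak_gradient_def weak_deriv_matrix_vector)

lemma divergence_free_linear: "trace (A :: real^'n^'n) = 0 \<Longrightarrow> divergence_free (\<lambda>x. A *v x)"
  unfolding divergence_free_def by (intro exI[of _ "\<lambda>x. A"]) (simp add: weak_jacobian_linear)

lemma P0_infty_const: "P0_infty (\<lambda>x. c) c"
  by (rule P0_infty_AE_const) auto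

section \<open>The pressure of a linear velocity field\<close>

lemma integral_quadratic_pd:
  fixes A :: "real^'n^'n"
  assumes \<phi>: "\<phi> \<in> test_functions UNIV"
  shows "(LINT x|lborel. (A *v x) $ i * (A *v x) $ j * pd (axis i 1) (pd (axis j 1) \<phi>) x) =
    (A $ i $ i * A $ j $ j + A $ j $ i * A $ i $ j) * (LINT x|lborel. \<phi> x)"
proof -
  have "weak_deriv UNIV (axis i 1) (\<lambda>x. (A *v x) $ i * (A *v x) $ j) (\<lambda>x. A $ i $ i * (A *v x) $ j + A $ j $ i * (A *v x) $ i)"
  proof (rule weak_deriv_classical)
    show "((\<lambda>s. (A *v (x + s *\<^sub>R axis i 1)) $ i * (A *v (x + s *\<^sub>R axis i 1)) $ j) has_real_derivative
        A $ i $ i * (A *v x) $ j + A $ j $ i * (A *v x) $ i) (at 0)" for x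
      using DERIV_mult[OF has_real_derivative_linear_line[of A x i i 0] has_real_derivative_linear_line[of A x i j 0]]
      by simp
  qed (auto intro!: continuous_intros continuous_on_linear_component)
  then have "(LINT x|lborel. (A *v x) $ i * (A *v x) $ j * pd (axis i 1) (pd (axis j 1) \<phi>) x) =
      - (LINT x|lborel. (A $ i $ i * (A *v x) $ j + A $ j $ i * (A *v x) $ i) * pd (axis j 1) \<phi> x)"
    using test_functions_pd[OF \<phi>] by (simp add: weak_deriv_def)
  also have "(LINT x|lborel. (A $ i $ i * (A *v x) $ j + A $ j $ i * (A *v x) $ i) * pd (axis j 1) \<phi> x) =
      A $ i $ i * (LINT x|lborel. (A *v x) $ j * pd (axis j 1) \<phi> x) + A $ j $ i * (LINT x|lborel. (A *v x) $ i * pd (axis j 1) \<phi> x)"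
  proof -
    have int: "integrable lborel (\<lambda>x. (A *v x) $ k * pd (axis j 1) \<phi> x)" for k
      by (rule locally_integrable_mult_test[OF continuous_imp_locally_integrable[OF continuous_on_linear_component] test_functions_pd[OF \<phi>]])
    show ?thesis
      using integrable_mult_right[OF int[of j], of "A $ i $ i"] integrable_mult_right[OF int[of i], of "A $ j $ i"]
      by (simp add: distrib_right mult.assoc)
  qed
  also have "\<dots> = - (A $ i $ i * A $ j $ j + A $ j $ i * A $ i $ j) * (LINT x|lborel. \<phi> x)"
    by (simp add: integral_linear_pd[OF \<phi>] algebra_simps)
  finally show ?thesis by (simp add: algebra_simps)
qed

text \<open>Both sides of the pressure equation are constants: minus the Laplacian of -(s / (2n))
  |x|^2 is s, and the double divergence of v tensor v is (tr A)^2 + tr(A^2), which is s for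
  trace-free A.\<close>

lemma is_Pi_linear:
  fixes A :: "real^'n^'n"
  defines "s \<equiv> \<Sum>a\<in>UNIV. \<Sum>b\<in>UNIV. A $ b $ a * A $ a $ b"
  assumes p: "0 < p" and tr: "trace A = 0"
  shows "is_Pi p (\<lambda>x. A *v x) (\<lambda>x. - (s / (2 * real CARD('n))) * (x \<bullet> x))"
proof -
  let ?n = "real CARD('n)" and ?q = "\<lambda>x :: real^'n. - (s / (2 * real CARD('n))) * (x \<bullet> x)"
  define G where "G = (mat (- (s / ?n)) :: real^'n^'n)"
  have Gx: "G *v x = (- (s / ?n)) *\<^sub>R x" for x
    by (simp add: G_def vec_eq_iff matrix_vector_mult_def mat_def if_distrib[of "\<lambda>a. a * _"] sum.delta cong: if_cong)
  have Gij: "G $ i $ j = (if i = j then - (s / ?n) else 0)" for i j by (simp add: G_def mat_def)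
  have wG: "weak_gradient ?q (\<lambda>x. G *v x)"
    unfolding weak_gradient_def
  proof (intro allI weak_deriv_classical)
    fix j x
    have "(\<lambda>s'. ?q (x + s' *\<^sub>R axis j 1)) = (\<lambda>s'. - (s / (2 * ?n)) * (x \<bullet> x + 2 * s' * x $ j + s' ^ 2))"
      by (simp add: inner_add_left inner_add_right inner_axis inner_axis' inner_axis_axis power2_eq_square algebra_simps)
    then show "((\<lambda>s'. ?q (x + s' *\<^sub>R axis j 1)) has_real_derivative (G *v x) $ j) (at 0)"
      by (auto intro!: derivative_eq_intros simp: Gx)
  qed (auto intro!: continuous_intros simp: Gx)
  have dist: "- (LINT x|lborel. ?q x * (\<Sum>i\<in>UNIV. pd (axis i 1) (pd (axis i 1) \<phi>) x)) =
      (LINT x|lborel. (\<Sum>i\<in>UNIV. \<Sum>j\<in>UNIV. (A *v x) $ i * (A *v x) $ j * pd (axis i 1) (pd (axis j 1) \<phi>) x))"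
    if \<phi>: "\<phi> \<in> test_functions UNIV" for \<phi>
  proof -
    let ?J = "LINT x|lborel. \<phi> x"
    have t: "pd (axis i 1) (pd (axis j 1) \<phi>) \<in> test_functions UNIV" for i j
      by (intro test_functions_pd \<phi>)
    have i1: "integrable lborel (\<lambda>x. ?q x * pd (axis i 1) (pd (axis i 1) \<phi>) x)" for i
      by (rule locally_integrable_mult_test[OF continuous_imp_locally_integrable t]) (intro continuous_intros)
    have i2: "integrable lborel (\<lambda>x. (A *v x) $ i * (A *v x) $ j * pd (axis i 1) (pd (axis j 1) \<phi>) x)" for i j
      by (rule locally_integrable_mult_test[OF continuous_imp_locally_integrable t])
        (intro continuous_intros continuous_on_linear_component)
    have "(LINT x|lborel. ?q x * (\<Sum>i\<in>UNIV. pd (axis i 1) (pd (axis i 1) \<phi>) x)) =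
        (\<Sum>i\<in>UNIV. LINT x|lborel. ?q x * pd (axis i 1) (pd (axis i 1) \<phi>) x)"
      unfolding sum_distrib_left by (rule Bochner_Integration.integral_sum[OF i1])
    also have "\<dots> = (\<Sum>i\<in>UNIV. - (LINT x|lborel. (G *v x) $ i * pd (axis i 1) \<phi> x))"
      using wG test_functions_pd[OF \<phi>] by (intro sum.cong refl) (simp add: weak_gradient_def weak_deriv_def)
    also have "\<dots> = - s * ?J"
      by (simp add: integral_linear_pd[OF \<phi>] Gij)
    finally have L: "(LINT x|lborel. ?q x * (\<Sum>i\<in>UNIV. pd (axis i 1) (pd (axis i 1) \<phi>) x)) = - s * ?J" .
    have "(LINT x|lborel. (\<Sum>i\<in>UNIV. \<Sum>j\<in>UNIV. (A *v x) $ i * (A *v x) $ j * pd (axis i 1) (pd (axis j 1) \<phi>) x)) =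
        (\<Sum>i\<in>UNIV. \<Sum>j\<in>UNIV. LINT x|lborel. (A *v x) $ i * (A *v x) $ j * pd (axis i 1) (pd (axis j 1) \<phi>) x)"
      using i2 by (simp add: Bochner_Integration.integral_sum)
    also have "\<dots> = (\<Sum>i\<in>UNIV. \<Sum>j\<in>UNIV. (A $ i $ i * A $ j $ j + A $ j $ i * A $ i $ j) * ?J)"
      by (simp add: integral_quadratic_pd[OF \<phi>])
    also have "\<dots> = (trace A * trace A + s) * ?J"
      by (simp add: s_def trace_def sum_product sum.distrib sum_distrib_right[symmetric])
    finally show ?thesis using L tr by simp
  qed
  have lp: "?q \<in> Lp_loc p" "(\<lambda>x. (G *v x) $ i) \<in> Lp_loc p" for i
    using p by (auto intro!: continuous_imp_Lp_loc continuous_intros continuous_on_linear_component)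
  have P1: "P1dot_infty (\<lambda>x. G *v x) (\<lambda>x. (- (1 / ?n) * s) *\<^sub>R x)"
    unfolding P1dot_infty_def
    by (intro exI[of _ "\<lambda>x. G"] exI[of _ G]) (auto simp: weak_jacobian_linear P0_infty_const Gx)
  have c: "continuous_on UNIV (\<lambda>x. G *v x)"
    by (intro linear_continuous_on matrix_vector_mul_bounded_linear)
  show ?thesis
    unfolding is_Pi_def
    apply (intro conjI L_vec_space_linear[OF p] divergence_free_linear[OF tr] exI[of _ "\<lambda>x. G *v x"] allI ballI wG lp c)
      apply (rule dist, assumption)
     apply (simp add: Gx)
    apply (intro exI[of _ "\<lambda>x. A"] exI[of _ s] conjI weak_jacobian_linear P1)
    apply (unfold s_def, rule P0_infty_const)
    done
qed

section \<open>The matrix Riccati equation\<close>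

lemma has_vector_derivative_vec_lambda:
  fixes f :: "real \<Rightarrow> 'a::real_normed_vector^'n"
  assumes "\<And>i. ((\<lambda>t. f t $ i) has_vector_derivative d $ i) (at t)"
  shows "(f has_vector_derivative d) (at t)"
proof -
  have ax: "bounded_linear (\<lambda>x :: 'a. axis i x)" for i :: 'n
  proof (rule bounded_linear_intro[where K=1])
    fix x :: 'a
    have "(\<Sum>j\<in>UNIV. (norm (axis i x $ j))\<^sup>2) = (\<Sum>j\<in>UNIV. if j = i then (norm x)\<^sup>2 else 0)"
      by (intro sum.cong) (auto simp: axis_def)
    then show "norm (axis i x) \<le> norm x * 1" by (simp add: norm_vec_def L2_set_def)
  qed (auto simp: axis_def vec_eq_iff)
  have eq: "x = (\<Sum>i\<in>UNIV. axis i (x $ i))" for x :: "'a^'n"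
    by (simp add: vec_eq_iff axis_def sum.delta)
  have "((\<lambda>t. \<Sum>i\<in>UNIV. axis i (f t $ i)) has_vector_derivative (\<Sum>i\<in>UNIV. axis i (d $ i))) (at t)"
    by (intro has_vector_derivative_sum bounded_linear.has_vector_derivative[OF ax] assms)
  then show ?thesis by (simp flip: eq)
qed

lemma matrix_component_le_norm:
  fixes X :: "real^'n^'m"
  shows "\<bar>X $ i $ j\<bar> \<le> norm X"
  using order_trans[OF component_le_norm_cart Finite_Cartesian_Product.norm_nth_le] .

lemma norm_matrix_le_card:
  fixes X :: "real^'n^'m"
  assumes "\<And>i j. \<bar>X $ i $ j\<bar> \<le> c"
  shows "norm X \<le> real CARD('m) * (real CARD('n) * c)"
proof -
  have "norm X \<le> (\<Sum>i\<in>UNIV. norm (X $ i))"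
    unfolding norm_vec_def[of X] by (rule L2_set_le_sum) simp
  also have "\<dots> \<le> (\<Sum>i\<in>(UNIV::'m set). real CARD('n) * c)"
    by (intro sum_mono norm_vec_le_card assms)
  finally show ?thesis by simp
qed

text \<open>The field tr(X^2)/n I - X^2 of the matrix Riccati equation, written entrywise in the
  form delivered by \<open>B_ode\<close>.\<close>

definition riccati_rhs :: "real^'n^'n \<Rightarrow> real^'n^'n" where
  "riccati_rhs X = (\<chi> i j. (if i = j then 1 / real CARD('n) * (\<Sum>a\<in>UNIV. \<Sum>b\<in>UNIV. X $ b $ a * X $ a $ b) else 0)
      - (X ** X) $ i $ j)"

text \<open>Each product of two entries changes by at most 2 M |X - Y|; an entry collects n of these
  from X^2 and another n from the trace term, and summing over the n^2 entries gives 4 n^3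
  M.\<close>

lemma riccati_rhs_Lipschitz:
  fixes X Y :: "real^'n^'n"
  assumes "norm X \<le> M" "norm Y \<le> M"
  shows "norm (riccati_rhs X - riccati_rhs Y) \<le> (4 * real CARD('n) ^ 3 * M) * norm (X - Y)"
proof -
  let ?n = "real CARD('n)" and ?\<Delta> = "norm (X - Y)"
  have n: "0 < ?n" by simp
  have M: "0 \<le> M" using assms norm_ge_zero order_trans by blast
  have prod: "\<bar>X $ a $ b * X $ c $ d - Y $ a $ b * Y $ c $ d\<bar> \<le> 2 * M * ?\<Delta>" for a b c d
  proof -
    have "X $ a $ b * X $ c $ d - Y $ a $ b * Y $ c $ d = X $ a $ b * (X - Y) $ c $ d + (X - Y) $ a $ b * Y $ c $ d"
      by (simp add: algebra_simps)
    also have "\<bar>\<dots>\<bar> \<le> \<bar>X $ a $ b\<bar> * \<bar>(X - Y) $ c $ d\<bar> + \<bar>(X - Y) $ a $ b\<bar> * \<bar>Y $ c $ d\<bar>"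
      using abs_triangle_ineq[of "X $ a $ b * (X - Y) $ c $ d" "(X - Y) $ a $ b * Y $ c $ d"]
      by (simp only: abs_mult)
    also have "\<dots> \<le> M * ?\<Delta> + ?\<Delta> * M"
      using M order_trans[OF matrix_component_le_norm assms(1)] order_trans[OF matrix_component_le_norm assms(2)]
      by (intro add_mono mult_mono matrix_component_le_norm) auto
    finally show ?thesis by simp
  qed
  have tr: "\<bar>(\<Sum>a\<in>UNIV. \<Sum>b\<in>UNIV. X $ b $ a * X $ a $ b) - (\<Sum>a\<in>UNIV. \<Sum>b\<in>UNIV. Y $ b $ a * Y $ a $ b)\<bar> \<le> ?n * (?n * (2 * M * ?\<Delta>))"
  proof -
    have "\<bar>(\<Sum>a\<in>UNIV. \<Sum>b\<in>UNIV. X $ b $ a * X $ a $ b) - (\<Sum>a\<in>UNIV. \<Sum>b\<in>UNIV. Y $ b $ a * Y $ a $ b)\<bar>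
        = \<bar>\<Sum>a\<in>UNIV. \<Sum>b\<in>UNIV. (X $ b $ a * X $ a $ b - Y $ b $ a * Y $ a $ b)\<bar>"
      by (simp add: sum_subtractf)
    also have "\<dots> \<le> (\<Sum>a\<in>UNIV. \<Sum>b\<in>UNIV. \<bar>X $ b $ a * X $ a $ b - Y $ b $ a * Y $ a $ b\<bar>)"
      by (rule order_trans[OF sum_abs], rule sum_mono, rule sum_abs)
    also have "\<dots> \<le> (\<Sum>a\<in>(UNIV::'n set). \<Sum>b\<in>(UNIV::'n set). 2 * M * ?\<Delta>)" by (intro sum_mono prod)
    finally show ?thesis by simp
  qed
  have sq: "\<bar>(X ** X) $ i $ j - (Y ** Y) $ i $ j\<bar> \<le> ?n * (2 * M * ?\<Delta>)" for i j
  proof -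
    have "\<bar>(X ** X) $ i $ j - (Y ** Y) $ i $ j\<bar> = \<bar>\<Sum>k\<in>UNIV. X $ i $ k * X $ k $ j - Y $ i $ k * Y $ k $ j\<bar>"
      by (simp add: matrix_matrix_mult_def sum_subtractf)
    also have "\<dots> \<le> (\<Sum>k\<in>(UNIV::'n set). 2 * M * ?\<Delta>)"
      by (rule order_trans[OF sum_abs]) (intro sum_mono prod)
    finally show ?thesis by simp
  qed
  have "\<bar>(riccati_rhs X - riccati_rhs Y) $ i $ j\<bar> \<le> 4 * ?n * M * ?\<Delta>" for i j
  proof (cases "i = j")
    case True
    have "\<bar>1 / ?n * (\<Sum>a\<in>UNIV. \<Sum>b\<in>UNIV. X $ b $ a * X $ a $ b) - 1 / ?n * (\<Sum>a\<in>UNIV. \<Sum>b\<in>UNIV. Y $ b $ a * Y $ a $ b)\<bar>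
        = 1 / ?n * \<bar>(\<Sum>a\<in>UNIV. \<Sum>b\<in>UNIV. X $ b $ a * X $ a $ b) - (\<Sum>a\<in>UNIV. \<Sum>b\<in>UNIV. Y $ b $ a * Y $ a $ b)\<bar>"
      by (simp only: right_diff_distrib[symmetric] abs_mult) simp
    also have "\<dots> \<le> 1 / ?n * (?n * (?n * (2 * M * ?\<Delta>)))" by (intro mult_left_mono tr) simp
    also have "\<dots> = ?n * (2 * M * ?\<Delta>)" using n by simp
    finally show ?thesis
      using sq[of i j] True by (simp only: riccati_rhs_def vector_minus_component vec_lambda_beta simp_thms if_True)
  next
    case False
    have "0 \<le> ?n * (2 * M * ?\<Delta>)" using M by simp
    then show ?thesis
      using sq[of i j] False by (simp only: riccati_rhs_def vector_minus_component vec_lambda_beta if_False)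
  qed
  from norm_matrix_le_card[OF this] show ?thesis
    by (simp add: power3_eq_cube mult_ac)
qed

text \<open>The quadratic field is Lipschitz on the bounded set swept out by both solutions, so
  Gronwall's inequality applies to their difference.\<close>

lemma riccati_unique:
  fixes A B :: "real \<Rightarrow> real^'n^'n"
  assumes T: "0 \<le> T" and c: "continuous_on {0..T} A" "continuous_on {0..T} B" and ini: "A 0 = B 0"
    and A: "\<And>t. 0 < t \<Longrightarrow> t < T \<Longrightarrow> (A has_vector_derivative riccati_rhs (A t)) (at t)"
    and B: "\<And>t. 0 < t \<Longrightarrow> t < T \<Longrightarrow> (B has_vector_derivative riccati_rhs (B t)) (at t)"
  shows "A T = B T"
proof -
  have "bounded (A ` {0..T} \<union> B ` {0..T})"
    by (intro bounded_Un[THEN iffD2] conjI compact_imp_bounded compact_continuous_image c compact_Icc)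
  then obtain M where M: "\<forall>X\<in>A ` {0..T} \<union> B ` {0..T}. norm X \<le> M" unfolding bounded_iff by blast
  have "norm (A T - B T) \<le> exp ((4 * real CARD('n) ^ 3 * M) * (T - 0)) * norm (A 0 - B 0)"
  proof (rule norm_growth[OF T])
    show "continuous_on {0..T} (\<lambda>t. A t - B t)" by (intro continuous_intros c)
    fix t assume t: "0 < t" "t < T"
    show "((\<lambda>t. A t - B t) has_vector_derivative riccati_rhs (A t) - riccati_rhs (B t)) (at t)"
      by (intro has_vector_derivative_diff A B t)
    show "norm (riccati_rhs (A t) - riccati_rhs (B t)) \<le> (4 * real CARD('n) ^ 3 * M) * norm (A t - B t)"
      using M t by (intro riccati_rhs_Lipschitz) auto
  qed
  then show ?thesis using ini by simp
qed

text \<open>Gronwall's inequality with f^2 - g^2 = (f + g) (f - g), the first factor being bounded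
  on the compact interval.\<close>

lemma riccati_scalar_unique:
  fixes f g :: "real \<Rightarrow> real"
  assumes T: "0 \<le> T" and c: "continuous_on {0..T} f" "continuous_on {0..T} g" and ini: "f 0 = g 0"
    and f: "\<And>t. 0 < t \<Longrightarrow> t < T \<Longrightarrow> (f has_real_derivative (f t)\<^sup>2) (at t)"
    and g: "\<And>t. 0 < t \<Longrightarrow> t < T \<Longrightarrow> (g has_real_derivative (g t)\<^sup>2) (at t)"
  shows "f T = g T"
proof -
  have "bounded ((\<lambda>t. f t + g t) ` {0..T})"
    by (intro compact_imp_bounded compact_continuous_image continuous_intros c compact_Icc)
  then obtain M where M: "\<forall>x\<in>(\<lambda>t. f t + g t) ` {0..T}. norm x \<le> M" unfolding bounded_iff by blast
  have "norm (f T - g T) \<le> exp (M * (T - 0)) * norm (f 0 - g 0)"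
  proof (rule norm_growth[OF T])
    show "continuous_on {0..T} (\<lambda>t. f t - g t)" by (intro continuous_intros c)
    fix t assume t: "0 < t" "t < T"
    show "((\<lambda>t. f t - g t) has_vector_derivative (f t)\<^sup>2 - (g t)\<^sup>2) (at t)"
      unfolding has_real_derivative_iff_has_vector_derivative[symmetric] by (intro DERIV_diff f g t)
    have "\<bar>f t + g t\<bar> \<le> M" using M t by auto
    then have "\<bar>f t + g t\<bar> * \<bar>f t - g t\<bar> \<le> M * \<bar>f t - g t\<bar>" by (rule mult_right_mono) simp
    then show "norm ((f t)\<^sup>2 - (g t)\<^sup>2) \<le> M * norm (f t - g t)"
      by (simp add: abs_mult[symmetric] power2_eq_square square_diff_square_factored)
  qed
  then show ?thesis using ini by simp
qed

section \<open>The explicit solution\<close>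

definition Dm :: "real^3^3" where
  "Dm = (\<chi> i j. if i = j then (vector [1, 1, - 2] :: real^3) $ i else 0)"

text \<open>The solution of lambda' = lambda^2 with value \<open>lam0\<close> at 0; its pole lies at
  1 / lam0.\<close>

definition lamf :: "real \<Rightarrow> real \<Rightarrow> real" where
  "lamf lam0 t = lam0 / (1 - lam0 * t)"

lemma Dm_mult: "Dm *v x = (\<chi> i. (vector [1, 1, - 2] :: real^3) $ i * x $ i)"
  by (simp add: Dm_def vec_eq_iff matrix_vector_mult_def if_distrib[of "\<lambda>a. a * _"] sum.delta cong: if_cong)

lemma Dm_facts:
  "trace Dm = 0" "(\<Sum>a\<in>UNIV. \<Sum>b\<in>UNIV. Dm $ b $ a * Dm $ a $ b) = 6"
  "(Dm ** Dm) $ i $ j = (if i = j then 2 else 0) - Dm $ i $ j"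
proof -
  show "trace Dm = 0" by (simp add: trace_def Dm_def sum_3)
  show "(\<Sum>a\<in>UNIV. \<Sum>b\<in>UNIV. Dm $ b $ a * Dm $ a $ b) = 6" by (simp add: Dm_def sum_3)
  have "\<forall>i j. (Dm ** Dm) $ i $ j = (if i = j then 2 else 0) - Dm $ i $ j"
    by (simp add: matrix_matrix_mult_def Dm_def sum_3 forall_3)
  then show "(Dm ** Dm) $ i $ j = (if i = j then 2 else 0) - Dm $ i $ j" by blast
qed

text \<open>Dm^2 = 2 I - Dm and tr(Dm^2) = 6, so tr(Dm^2)/3 I - Dm^2 = Dm: the line through Dm is
  invariant, and on it the matrix equation reduces to lambda' = lambda^2.\<close>

lemma riccati_rhs_Dm: "riccati_rhs (l *\<^sub>R Dm) = l\<^sup>2 *\<^sub>R Dm"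
proof -
  have "(\<Sum>a\<in>UNIV. \<Sum>b\<in>UNIV. (l *\<^sub>R Dm) $ b $ a * (l *\<^sub>R Dm) $ a $ b) = l\<^sup>2 * (\<Sum>a\<in>UNIV. \<Sum>b\<in>UNIV. Dm $ b $ a * Dm $ a $ b)"
    by (simp add: sum_distrib_left power2_eq_square mult_ac)
  moreover have "((l *\<^sub>R Dm) ** (l *\<^sub>R Dm)) $ i $ j = l\<^sup>2 * (Dm ** Dm) $ i $ j" for i j
    by (simp add: matrix_matrix_mult_def sum_distrib_left power2_eq_square mult_ac)
  ultimately show ?thesis
    unfolding riccati_rhs_def Dm_facts(2) by (simp add: vec_eq_iff Dm_facts(3) algebra_simps)
qed

lemma trace_scaleR: "trace (c *\<^sub>R (A :: real^'n^'n)) = c * trace A"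
  by (simp add: trace_def sum_distrib_left)

lemma scaleR_mult_vec: "(c *\<^sub>R (A :: real^'n^'m)) *v x = c *\<^sub>R (A *v x)"
  by (simp add: scaleR_matrix_vector_assoc)

lemma Linf_L2loc_continuous:
  fixes f :: "real^'n \<Rightarrow> real \<Rightarrow> 'b::euclidean_space"
  assumes c: "continuous_on (UNIV \<times> {0..T}) (\<lambda>(x, t). f x t)"
  shows "Linf_L2loc T f"
  unfolding Linf_L2loc_def
proof (intro conjI allI impI)
  have "(UNIV :: (real^'n) set) \<times> {0<..<T} \<in> sets borel" by (intro borel_open open_Times) auto
  then have "(\<lambda>z. indicator (UNIV \<times> {0<..<T}) z *\<^sub>R (\<lambda>(x, t). f x t) z) \<in> borel_measurable borel"
    by (rule borel_measurable_continuous_on_indicator[OF _ continuous_on_subset[OF c]]) auto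
  then show "set_borel_measurable lborel (UNIV \<times> {0<..<T}) (\<lambda>(x, t). f x t)"
    by (simp add: set_borel_measurable_def)
  fix R :: real assume "R > 0"
  have "bounded ((\<lambda>(x, t). f x t) ` (cball 0 R \<times> {0..T}))"
    by (intro compact_imp_bounded compact_continuous_image continuous_on_subset[OF c] compact_Times) auto
  then obtain M where M: "\<forall>y\<in>(\<lambda>(x, t). f x t) ` (cball 0 R \<times> {0..T}). norm y \<le> M" unfolding bounded_iff by blast
  have fin: "emeasure lborel (ball (0::real^'n) R) < \<infinity>" by (rule emeasure_lborel_ball_finite)
  show "\<exists>C. AE t in lborel. 0 < t \<and> t < T \<longrightarrow> Lp_norm 2 (ball 0 R) (\<lambda>x. f x t) \<le> ennreal C"
  proof (intro exI AE_I2 impI)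
    fix t assume t: "0 < t \<and> t < T"
    show "Lp_norm 2 (ball 0 R) (\<lambda>x. f x t) \<le> ennreal ((max 0 M powr 2 * measure lborel (ball (0::real^'n) R)) powr (1 / 2))"
    proof (rule Lp_norm_le[OF _ _ fin])
      fix x :: "real^'n" assume "x \<in> ball 0 R"
      then have "f x t \<in> (\<lambda>(x, t). f x t) ` (cball 0 R \<times> {0..T})" using t by force
      then show "norm (f x t) \<le> max 0 M" using M by force
    qed auto
  qed
qed

context
  fixes lam0 :: real
  assumes lam0: "0 < lam0"
begin

abbreviation l :: "real \<Rightarrow> real" where "l \<equiv> lamf lam0"

lemma den_pos: "t < 1 / lam0 \<Longrightarrow> 0 < 1 - lam0 * t"
  using lam0 by (simp add: field_simps)

lemma l_deriv: "t < 1 / lam0 \<Longrightarrow> (l has_real_derivative (l t)\<^sup>2) (at t)"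
  unfolding lamf_def[abs_def] using den_pos[of t]
  by (auto intro!: derivative_eq_intros simp: power2_eq_square field_simps)

lemma l_continuous: "continuous_on {..<1 / lam0} l"
  by (intro continuous_at_imp_continuous_on ballI DERIV_isCont[OF l_deriv]) auto

lemma l_continuous_comp: "continuous_on S f \<Longrightarrow> (\<And>z. z \<in> S \<Longrightarrow> f z < 1 / lam0) \<Longrightarrow> continuous_on S (\<lambda>z. l (f z))"
  by (rule continuous_on_compose2[OF l_continuous]) auto

lemma l_mono: "s \<le> t \<Longrightarrow> t < 1 / lam0 \<Longrightarrow> l s \<le> l t"
  unfolding lamf_def using den_pos[of t] den_pos[of s] lam0
  by (intro divide_left_mono mult_pos_pos) auto

lemma l_pos: "t < 1 / lam0 \<Longrightarrow> 0 < l t"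
  unfolding lamf_def using den_pos[of t] lam0 by simp

lemma l_at_top: "filterlim l at_top (at_left (1 / lam0))"
proof -
  have "((\<lambda>t. 1 - lam0 * t) \<longlongrightarrow> 1 - lam0 * (1 / lam0)) (at_left (1 / lam0))"
    by (intro tendsto_intros)
  then have "((\<lambda>t. 1 - lam0 * t) \<longlongrightarrow> 0) (at_left (1 / lam0))" using lam0 by simp
  moreover have "\<forall>\<^sub>F t in at_left (1 / lam0). 0 < 1 - lam0 * t"
    using den_pos by (auto simp: eventually_at_left_field intro!: exI[of _ "1 / lam0 - 1"])
  ultimately have "filterlim (\<lambda>t. 1 - lam0 * t) (at_right 0) (at_left (1 / lam0))"
    by (simp add: filterlim_at eventually_mono)
  from filterlim_compose[OF filterlim_inverse_at_top_right this]
  have "filterlim (\<lambda>t. lam0 * inverse (1 - lam0 * t)) at_top (at_left (1 / lam0))"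
    by (rule filterlim_tendsto_pos_mult_at_top[OF tendsto_const lam0])
  then show ?thesis unfolding lamf_def[abs_def] by (simp add: divide_inverse)
qed

section \<open>The explicit velocity and pressure\<close>

definition vsol :: "real^3 \<Rightarrow> real \<Rightarrow> real^3" where "vsol x t = (l t *\<^sub>R Dm) *v x"
text \<open>The pressure -(s / (2n)) |x|^2 of \<open>is_Pi_linear\<close> with n = 3 and s = tr((l
  Dm)^2) = 6 l^2.\<close>

definition psol :: "real^3 \<Rightarrow> real \<Rightarrow> real" where "psol x t = - (l t)\<^sup>2 * (x \<bullet> x)"

lemma vsol_component: "vsol x t $ i = l t * (Dm *v x) $ i"
  by (simp add: vsol_def scaleR_mult_vec)

lemma vsol_continuous:
  assumes "\<And>x t. (x, t) \<in> S \<Longrightarrow> t < 1 / lam0"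
  shows "continuous_on S (\<lambda>(x, t). vsol x t)"
proof -
  have "continuous_on S (\<lambda>z. l (snd z) *\<^sub>R (Dm *v fst z))"
  proof (intro continuous_on_scaleR)
    show "continuous_on S (\<lambda>z. l (snd z))"
      using assms by (intro l_continuous_comp continuous_intros) auto
    show "continuous_on S (\<lambda>z. Dm *v fst z)"
      by (intro bounded_linear.continuous_on[OF matrix_vector_mul_bounded_linear] continuous_intros)
  qed
  then show ?thesis by (simp add: vsol_def scaleR_mult_vec case_prod_beta)
qed

lemma psol_continuous:
  assumes "\<And>x t. (x, t) \<in> S \<Longrightarrow> t < 1 / lam0"
  shows "continuous_on S (\<lambda>(x, t). psol x t)"
  unfolding psol_def case_prod_beta
  using assms by (intro continuous_intros l_continuous_comp) auto

lemma euler_on_vsol: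
  assumes S: "0 < S" "S < 1 / lam0"
  shows "euler_on vsol psol S"
proof -
  define \<Omega> where "\<Omega> = (UNIV :: (real^3) set) \<times> {0<..<S}"
  have \<Omega>: "open \<Omega>" unfolding \<Omega>_def by (intro open_Times) auto
  have t: "snd z < 1 / lam0" "0 < snd z" if "z \<in> \<Omega>" for z using that S by (auto simp: \<Omega>_def)
  define Dv where "Dv z = l (snd z) *\<^sub>R Dm" for z :: "(real^3) \<times> real"
  define v_t where "v_t z = (l (snd z))\<^sup>2 *\<^sub>R (Dm *v fst z)" for z :: "(real^3) \<times> real"
  define D\<pi> where "D\<pi> z = (- 2 * (l (snd z))\<^sup>2) *\<^sub>R fst z" for z :: "(real^3) \<times> real"
  define D2\<pi> where "D2\<pi> z = (- 2 * (l (snd z))\<^sup>2) *\<^sub>R (mat 1 :: real^3^3)" for z :: "(real^3) \<times> real"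
  have cl: "continuous_on \<Omega> (\<lambda>z. l (snd z))"
    using t by (intro l_continuous_comp continuous_intros)
  have cDm: "continuous_on \<Omega> (\<lambda>z. (Dm *v fst z) $ i)" for i
    by (intro continuous_on_component bounded_linear.continuous_on[OF matrix_vector_mul_bounded_linear] continuous_intros)
  have cv: "continuous_on \<Omega> (\<lambda>(x, t). vsol x t $ i)" for i
    unfolding vsol_component case_prod_beta by (intro continuous_intros cl cDm)
  have w1: "weak_deriv \<Omega> (axis j 1, 0) (\<lambda>(x, t). vsol x t $ i) (\<lambda>z. Dv z $ i $ j)" for i j
  proof (rule weak_deriv_classical[OF \<Omega> cv])
    show "continuous_on \<Omega> (\<lambda>z. Dv z $ i $ j)" unfolding Dv_def by (auto intro!: continuous_intros cl)
    fix z assume "z \<in> \<Omega>"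
    show "((\<lambda>s. (\<lambda>(x, t). vsol x t $ i) (z + s *\<^sub>R (axis j 1, 0))) has_real_derivative Dv z $ i $ j) (at 0)"
      using DERIV_cmult[OF has_real_derivative_linear_line[of Dm "fst z" j i 0], of "l (snd z)"]
      by (cases z) (simp add: vsol_component Dv_def)
  qed
  have w2: "weak_deriv \<Omega> (0, 1) (\<lambda>(x, t). vsol x t $ i) (\<lambda>z. v_t z $ i)" for i
  proof (rule weak_deriv_classical[OF \<Omega> cv])
    show "continuous_on \<Omega> (\<lambda>z. v_t z $ i)" unfolding v_t_def by (auto intro!: continuous_intros cl cDm)
    fix z assume z: "z \<in> \<Omega>"
    have "((\<lambda>s. l (snd z + s)) has_real_derivative (l (snd z))\<^sup>2) (at 0)"
      using DERIV_shift[of l "(l (snd z))\<^sup>2" 0 "snd z"] l_deriv[OF t(1)[OF z]] by (simp add: add.commute)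
    then have "((\<lambda>s. l (snd z + s) * (Dm *v fst z) $ i) has_real_derivative (l (snd z))\<^sup>2 * (Dm *v fst z) $ i) (at 0)"
      by (rule DERIV_cmult_right)
    then show "((\<lambda>s. (\<lambda>(x, t). vsol x t $ i) (z + s *\<^sub>R (0, 1))) has_real_derivative v_t z $ i) (at 0)"
      by (cases z) (simp add: vsol_component v_t_def)
  qed
  have w3: "weak_deriv \<Omega> (axis j 1, 0) (\<lambda>(x, t). psol x t) (\<lambda>z. D\<pi> z $ j)" for j
  proof (rule weak_deriv_classical[OF \<Omega>])
    show "continuous_on \<Omega> (\<lambda>(x, t). psol x t)" using t by (intro psol_continuous) auto
    show "continuous_on \<Omega> (\<lambda>z. D\<pi> z $ j)" unfolding D\<pi>_def by (auto intro!: continuous_intros cl)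
    fix z
    have "(\<lambda>s. (\<lambda>(x, t). psol x t) (z + s *\<^sub>R (axis j 1, 0))) =
        (\<lambda>s. - (l (snd z))\<^sup>2 * (fst z \<bullet> fst z + 2 * s * fst z $ j + s ^ 2))"
      by (cases z) (simp add: psol_def inner_add_left inner_add_right inner_axis inner_axis' inner_axis_axis
          power2_eq_square algebra_simps)
    then show "((\<lambda>s. (\<lambda>(x, t). psol x t) (z + s *\<^sub>R (axis j 1, 0))) has_real_derivative D\<pi> z $ j) (at 0)"
      by (auto intro!: derivative_eq_intros simp: D\<pi>_def)
  qed
  have w4: "weak_deriv \<Omega> (axis j 1, 0) (\<lambda>z. D\<pi> z $ i) (\<lambda>z. D2\<pi> z $ i $ j)" for i j
  proof (rule weak_deriv_classical[OF \<Omega>])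
    show "continuous_on \<Omega> (\<lambda>z. D\<pi> z $ i)" unfolding D\<pi>_def by (auto intro!: continuous_intros cl)
    show "continuous_on \<Omega> (\<lambda>z. D2\<pi> z $ i $ j)" unfolding D2\<pi>_def by (auto intro!: continuous_intros cl)
    fix z
    show "((\<lambda>s. D\<pi> (z + s *\<^sub>R (axis j 1, 0)) $ i) has_real_derivative D2\<pi> z $ i $ j) (at 0)"
      by (auto intro!: derivative_eq_intros simp: D\<pi>_def D2\<pi>_def mat_def axis_def)
  qed
  have bd: "norm (Dv z) \<le> l S * norm Dm + 2 * (l S)\<^sup>2 * norm (mat 1 :: real^3^3) \<and>
      norm (D2\<pi> z) \<le> l S * norm Dm + 2 * (l S)\<^sup>2 * norm (mat 1 :: real^3^3)" if z: "z \<in> \<Omega>" for z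
  proof -
    have a: "0 \<le> l (snd z)" "l (snd z) \<le> l S" "0 \<le> l S"
      using z S t[OF z] l_mono[of "snd z" S] l_pos[of "snd z"] l_pos[of S] by (auto simp: \<Omega>_def less_imp_le)
    have "norm (Dv z) \<le> l S * norm Dm" using a by (simp add: Dv_def mult_right_mono)
    moreover have "norm (D2\<pi> z) \<le> 2 * (l S)\<^sup>2 * norm (mat 1 :: real^3^3)"
      using a by (simp add: D2\<pi>_def abs_mult mult_right_mono power_mono)
    moreover have "0 \<le> l S * norm Dm" "0 \<le> 2 * (l S)\<^sup>2 * norm (mat 1 :: real^3^3)" using a by auto
    ultimately show ?thesis by linarith
  qed
  \<comment> \<open>Because Dm^2 = 2 I - Dm, the Dm terms of \<open>v_t\<close> and of the
    convective term cancel and 2 l^2 x remains, which is minus the pressure gradient.\<close>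
  have eq: "v_t z + Dv z *v vsol (fst z) (snd z) = - D\<pi> z" for z
  proof -
    have DD: "Dm *v (Dm *v x) = 2 *\<^sub>R x - Dm *v x" for x
      by (simp add: Dm_mult vec_eq_iff forall_3)
    have "Dv z *v vsol (fst z) (snd z) = (l (snd z))\<^sup>2 *\<^sub>R (Dm *v (Dm *v fst z))"
      by (simp add: Dv_def vsol_def scaleR_mult_vec matrix_vector_mult_scaleR power2_eq_square)
    then show ?thesis by (simp add: v_t_def D\<pi>_def DD algebra_simps)
  qed
  have tr: "trace (Dv z) = 0" for z by (simp add: Dv_def trace_scaleR Dm_facts)
  have "Linf_L2loc S vsol" "Linf_L2loc S psol"
    using S by (auto intro!: Linf_L2loc_continuous vsol_continuous psol_continuous)
  moreover have "\<exists>C. AE z in lborel. z \<in> \<Omega> \<longrightarrow> norm (Dv z) \<le> C \<and> norm (D2\<pi> z) \<le> C"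
    using bd by (intro exI AE_I2) blast
  ultimately show ?thesis
    unfolding euler_on_def Let_def \<Omega>_def[symmetric]
    by (intro conjI exI[of _ Dv] exI[of _ v_t] exI[of _ D\<pi>] exI[of _ D2\<pi>] allI w1 w2 w3 w4) (auto simp: eq tr)
qed

section \<open>Norms of the explicit solution and their blow-up\<close>

lemma vsol_L_vec_space: "0 < p \<Longrightarrow> (\<lambda>x. vsol x t) \<in> L_vec_space p"
  unfolding vsol_def by (rule L_vec_space_linear)

lemma vsol_is_Pi: "0 < p \<Longrightarrow> is_Pi p (\<lambda>x. vsol x t) (\<lambda>x. psol x t)"
proof -
  assume p: "0 < p"
  have "(\<Sum>a\<in>UNIV. \<Sum>b\<in>UNIV. (l t *\<^sub>R Dm) $ b $ a * (l t *\<^sub>R Dm) $ a $ b) = (l t)\<^sup>2 * (\<Sum>a\<in>UNIV. \<Sum>b\<in>UNIV. Dm $ b $ a * Dm $ a $ b)"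
    by (simp add: sum_distrib_left power2_eq_square mult_ac)
  then show ?thesis
    using is_Pi_linear[OF p, of "l t *\<^sub>R Dm"] by (simp add: trace_scaleR Dm_facts vsol_def psol_def)
qed

lemma L_vec_norm_vsol: "L_vec_norm p (\<lambda>x. vsol x t) = (\<Sum>i\<in>UNIV. Lp_norm p (ball 0 1) (\<lambda>x. vsol x t $ i))"
proof -
  have "(\<lambda>x. vsol x t $ i) = (\<lambda>x. (l t *\<^sub>R Dm) $ i \<bullet> x)" for i
    by (simp add: vsol_def matrix_vector_mul_component)
  then have "L_seminorm p (\<lambda>x. vsol x t $ i) = 0" for i using L_seminorm_inner[of p "(l t *\<^sub>R Dm) $ i"] by metis
  then show ?thesis by (simp add: L_vec_norm_def L_norm_def)
qed

lemma L_vec_norm_vsol_bounded: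
  assumes p: "0 < p" and S: "S < 1 / lam0"
  shows "\<exists>C::real. AE t in lborel. 0 < t \<and> t < S \<longrightarrow> L_vec_norm p (\<lambda>x. vsol x t) \<le> ennreal C"
proof -
  define c where "c = ((l S * norm Dm) powr p * measure lborel (ball (0::real^3) 1)) powr (1 / p)"
  have "L_vec_norm p (\<lambda>x. vsol x t) \<le> ennreal (3 * c)" if t: "0 < t" "t < S" for t
  proof -
    have l: "0 \<le> l t" "l t \<le> l S" using l_pos[of t] l_mono[of t S] t S by auto
    have "Lp_norm p (ball 0 1) (\<lambda>x. vsol x t $ i) \<le> ennreal c" for i
      unfolding c_def
    proof (rule Lp_norm_le[OF p])
      show "emeasure lborel (ball (0::real^3) 1) < \<infinity>" by (rule emeasure_lborel_ball_finite)
      show "0 \<le> l S * norm Dm" using l by simp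
      fix x :: "real^3" assume "x \<in> ball 0 1"
      then have "norm (Dm *v x) \<le> norm Dm * 1"
        by (intro order_trans[OF norm_matrix_vector_mul_le] mult_left_mono) auto
      then have "\<bar>(Dm *v x) $ i\<bar> \<le> norm Dm" using component_le_norm_cart[of "Dm *v x" i] by linarith
      then show "norm (vsol x t $ i) \<le> l S * norm Dm"
        using l by (simp add: vsol_component abs_mult mult_mono)
    qed auto
    then have "(\<Sum>i\<in>(UNIV::3 set). Lp_norm p (ball 0 1) (\<lambda>x. vsol x t $ i)) \<le> (\<Sum>i\<in>(UNIV::3 set). ennreal c)"
      by (intro sum_mono)
    also have "\<dots> = ennreal (3 * c)" by (simp add: c_def sum_ennreal[symmetric] ennreal_mult)
    finally show ?thesis by (simp add: L_vec_norm_vsol)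
  qed
  then show ?thesis by (intro exI[of _ "3 * c"] AE_I2) simp
qed

lemma euler_solution_vsol:
  assumes p: "0 < p"
  shows "euler_solution p (\<lambda>x. vsol x 0) (ereal (1 / lam0)) vsol psol"
  unfolding euler_solution_def
proof (intro conjI allI impI)
  show "continuous_on (UNIV \<times> {t. 0 \<le> t \<and> ereal t < ereal (1 / lam0)}) (\<lambda>(x, t). vsol x t)"
    by (rule vsol_continuous) auto
  show "AE t in lborel. 0 < t \<and> ereal t < ereal (1 / lam0) \<longrightarrow>
      (\<lambda>x. vsol x t) \<in> L_vec_space p \<and> is_Pi p (\<lambda>x. vsol x t) (\<lambda>x. psol x t)"
    by (simp add: vsol_L_vec_space[OF p] vsol_is_Pi[OF p])
  show "vsol 0 t = 0" for t by (simp add: vsol_def)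
qed (auto intro: euler_on_vsol L_vec_norm_vsol_bounded[OF p])

text \<open>The first component l(t) x_1 alone bounds the norm from below by l(t) N, where N > 0 is
  the norm of x_1 on the unit ball.\<close>

lemma L_vec_norm_vsol_blowup:
  assumes p: "0 < p"
  shows "((\<lambda>t. L_vec_norm p (\<lambda>x. vsol x t)) \<longlongrightarrow> \<infinity>) (at_left (1 / lam0))"
proof -
  let ?B = "ball (0::real^3) 1"
  define I where "I = (\<integral>\<^sup>+x\<in>?B. ennreal (norm ((x::real^3) $ 1) powr p) \<partial>lborel)"
  define N where "N = enn2real I powr (1 / p)"
  have "(\<lambda>x::real^3. ennreal (norm (x $ 1) powr p)) \<in> borel_measurable borel" by measurable
  then have m: "(\<lambda>x::real^3. ennreal (norm (x $ 1) powr p) * indicator ?B x) \<in> borel_measurable lborel"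
    by (intro borel_measurable_times_ennreal borel_measurable_indicator) simp_all
  have fin: "I \<noteq> \<infinity>"
  proof -
    have "I \<le> (\<integral>\<^sup>+x\<in>?B. 1 \<partial>lborel)"
      unfolding I_def
    proof (intro nn_integral_mono)
      fix x :: "real^3"
      have "norm (x $ 1) powr p \<le> 1 powr p" if "x \<in> ?B"
        using that component_le_norm_cart[of x 1] p by (intro powr_mono2) auto
      then show "ennreal (norm (x $ 1) powr p) * indicator ?B x \<le> 1 * indicator ?B x"
        by (auto simp: indicator_def)
    qed
    also have "\<dots> < \<infinity>" using emeasure_lborel_ball_finite[of "0::real^3" 1] by simp
    finally show ?thesis by simp
  qed
  \<comment> \<open>x_1 is positive on a nonempty open part of the ball, so it cannot vanish almost
    everywhere there.\<close>
  have pos: "I \<noteq> 0"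
  proof
    assume "I = 0"
    with m have "AE x in lborel. ennreal (norm ((x::real^3) $ 1) powr p) * indicator ?B x = 0"
      unfolding I_def by (simp only: nn_integral_0_iff_AE)
    moreover have "open (?B \<inter> {x. 0 < x $ 1})"
      by (intro open_Int open_ball open_Collect_less continuous_intros)
    moreover have "axis 1 (1/2) \<in> ?B \<inter> {x. 0 < x $ 1}" by (simp add: axis_def norm_vec_def L2_set_def sum_3)
    ultimately obtain x :: "real^3" where "x \<in> ?B \<inter> {x. 0 < x $ 1}" "ennreal (norm (x $ 1) powr p) * indicator ?B x = 0"
      using AE_open_obtain by blast
    then show False by (auto simp: ennreal_eq_0_iff)
  qed
  have N: "0 < N"
  proof -
    have "0 < enn2real I"
      using fin pos by (simp add: enn2real_positive_iff top.not_eq_extremum zero_less_iff_neq_zero)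
    then show ?thesis by (simp add: N_def)
  qed
  have lower: "ennreal (l t * N) \<le> L_vec_norm p (\<lambda>x. vsol x t)" if t: "t < 1 / lam0" for t
  proof -
    have lt: "0 < l t" using l_pos[OF t] .
    have comp: "vsol x t $ 1 = l t * x $ 1" for x by (simp add: vsol_component Dm_mult)
    have "(\<integral>\<^sup>+x\<in>?B. ennreal (norm (vsol x t $ 1) powr p) \<partial>lborel) = (\<integral>\<^sup>+x. ennreal (l t powr p) * (ennreal (norm (x $ 1) powr p) * indicator ?B x) \<partial>lborel)"
      using lt by (intro nn_integral_cong) (simp add: comp abs_mult powr_mult ennreal_mult mult.assoc)
    also have "\<dots> = ennreal (l t powr p) * I"
      unfolding I_def by (rule nn_integral_cmult[OF m])
    finally have eq: "(\<integral>\<^sup>+x\<in>?B. ennreal (norm (vsol x t $ 1) powr p) \<partial>lborel) = ennreal (l t powr p) * I" .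
    have "Lp_norm p ?B (\<lambda>x. vsol x t $ 1) = ennreal (enn2real (ennreal (l t powr p) * I) powr (1 / p))"
      unfolding Lp_norm_def eq Let_def using fin by (simp add: ennreal_mult_eq_top_iff)
    also have "enn2real (ennreal (l t powr p) * I) powr (1 / p) = l t * N"
      using lt p by (simp add: enn2real_mult powr_mult powr_powr N_def)
    finally have "ennreal (l t * N) = Lp_norm p ?B (\<lambda>x. vsol x t $ 1)" by simp
    also have "\<dots> \<le> (\<Sum>i\<in>UNIV. Lp_norm p ?B (\<lambda>x. vsol x t $ i))"
      by (rule member_le_sum) auto
    finally show ?thesis by (simp add: L_vec_norm_vsol)
  qed
  have "((\<lambda>t. ennreal (l t * N)) \<longlongrightarrow> \<infinity>) (at_left (1 / lam0))"
  proof -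
    have "filterlim (\<lambda>t. l t * N) at_top (at_left (1 / lam0))"
      using filterlim_tendsto_pos_mult_at_top[OF tendsto_const N l_at_top] by (simp add: mult.commute)
    then show ?thesis by (simp add: ennreal_tendsto_top_eq_at_top)
  qed
  moreover have "\<forall>\<^sub>F t in at_left (1 / lam0). ennreal (l t * N) \<le> L_vec_norm p (\<lambda>x. vsol x t)"
    using lower by (auto simp: eventually_at_left_field intro!: exI[of _ "1 / lam0 - 1"])
  ultimately show ?thesis
    by (rule tendsto_sandwich[OF _ always_eventually _ tendsto_const, rotated 2]) auto
qed

section \<open>Uniqueness\<close>

text \<open>No relation between S and the blow-up time is assumed: the comparison runs on [0, t]
  with t below both, and \<open>euler_solution_time_le\<close> uses it to bound S.\<close>

lemma euler_solution_eq_vsol: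
  assumes sol: "euler_solution p (\<lambda>x. vsol x 0) S w q" and t: "0 \<le> t" "ereal t < S" "t < 1 / lam0"
  shows "w x t = vsol x t"
proof (cases "t = 0")
  case True
  then show ?thesis using sol by (simp add: euler_solution_def)
next
  case False
  \<comment> \<open>A slab of finite height strictly between t and S: S may be infinite, and
    \<open>euler_on\<close> is available only below S.\<close>
  obtain S0 where S0: "ereal t < ereal S0" "ereal S0 < S" using ereal_dense2[OF t(2)] by blast
  then have S0': "t < S0" "0 < S0" using t by auto
  have ini: "w x 0 = (lam0 *\<^sub>R Dm) *v x" for x
    using sol by (simp add: euler_solution_def vsol_def lamf_def)
  have lt: "ereal s < S" if "s < S0" for s using that S0(2) by (meson ereal_less_eq(3) less_imp_le order_le_less_trans)
  define \<Omega> where "\<Omega> = (UNIV :: (real^3) set) \<times> {0<..<S0}"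
  have eo: "euler_on w q S0" using sol S0 S0' by (simp add: euler_solution_def)
  then obtain Dv v_t D\<pi> D2\<pi> C where E:
    "\<And>i j. weak_deriv \<Omega> (axis j 1, 0) (\<lambda>(x, t). w x t $ i) (\<lambda>z. Dv z $ i $ j)"
    "\<And>i. weak_deriv \<Omega> (0, 1) (\<lambda>(x, t). w x t $ i) (\<lambda>z. v_t z $ i)"
    "\<And>j. weak_deriv \<Omega> (axis j 1, 0) (\<lambda>(x, t). q x t) (\<lambda>z. D\<pi> z $ j)"
    "\<And>i j. weak_deriv \<Omega> (axis j 1, 0) (\<lambda>z. D\<pi> z $ i) (\<lambda>z. D2\<pi> z $ i $ j)"
    "AE z in lborel. z \<in> \<Omega> \<longrightarrow> norm (Dv z) \<le> C \<and> norm (D2\<pi> z) \<le> C"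
    "AE z in lborel. z \<in> \<Omega> \<longrightarrow> v_t z + Dv z *v w (fst z) (snd z) = - D\<pi> z \<and> trace (Dv z) = 0"
    unfolding euler_on_def Let_def \<Omega>_def by blast
  have cont: "continuous_on (UNIV \<times> {0..<S0}) (\<lambda>(x, t). w x t)"
    by (rule continuous_on_subset[of "UNIV \<times> {t. 0 \<le> t \<and> ereal t < S}"])
      (use sol lt in \<open>auto simp: euler_solution_def\<close>)
  have E6: "AE z in lborel. z \<in> \<Omega> \<longrightarrow> v_t z + Dv z *v w (fst z) (snd z) = - D\<pi> z"
    using E(6) by eventually_elim blast
  interpret slab: euler_slab w q S0 C Dv v_t D\<pi> D2\<pi> \<Omega>
    using S0'(2) \<Omega>_def cont E(1-5) E6
    by unfold_locales (use sol lt in \<open>auto simp: euler_solution_def\<close>)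
  have Pi: "AE t in lborel. 0 < t \<and> t < S0 \<longrightarrow> is_Pi p (\<lambda>x. w x t) (\<lambda>x. q x t)"
  proof -
    have "AE t in lborel. 0 < t \<and> ereal t < S \<longrightarrow> (\<lambda>x. w x t) \<in> L_vec_space p \<and> is_Pi p (\<lambda>x. w x t) (\<lambda>x. q x t)"
      using sol by (simp add: euler_solution_def)
    then show ?thesis by eventually_elim (use lt in blast)
  qed
  have div: "AE t in lborel. 0 < t \<and> t < S0 \<longrightarrow> divergence_free (\<lambda>x. w x t)"
    using Pi by eventually_elim (simp add: is_Pi_def)
  \<comment> \<open>The quadratic form is a potential of the initial velocity because Dm is
    symmetric; its Taylor remainder is half the form at y - x.\<close>
  define \<phi>0 where "\<phi>0 x = (x \<bullet> ((lam0 *\<^sub>R Dm) *v x)) / 2" for x :: "real^3"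
  have pot: "\<bar>\<phi>0 y - \<phi>0 x - w x 0 \<bullet> (y - x)\<bar> \<le> (norm (lam0 *\<^sub>R Dm) / 2) * (norm (y - x))\<^sup>2" for x y
  proof -
    let ?A = "lam0 *\<^sub>R Dm"
    have sym: "x \<bullet> (Dm *v y) = y \<bullet> (Dm *v x)" for x y
      by (simp add: Dm_mult inner_vec_def sum_3 mult_ac)
    have eq: "\<phi>0 y - \<phi>0 x - w x 0 \<bullet> (y - x) = ((y - x) \<bullet> (?A *v (y - x))) / 2"
      using sym[of x y]
      by (simp add: \<phi>0_def ini scaleR_mult_vec matrix_vector_mult_diff_distrib inner_diff_left inner_diff_right
          inner_commute[of "Dm *v x"] field_simps)
    have b: "\<bar>(y - x) \<bullet> (?A *v (y - x))\<bar> \<le> norm (y - x) * (norm ?A * norm (y - x))"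
      using Cauchy_Schwarz_ineq2 mult_left_mono[OF norm_matrix_vector_mul_le norm_ge_zero] order_trans by blast
    show ?thesis unfolding eq using b by (simp only: abs_divide power2_eq_square) (simp add: mult_ac)
  qed
  have lin: "linear (\<lambda>x. w x s)" if "0 < s" "s < S0" for s
    using slab.v_linear[OF that _ pot div] by simp
  \<comment> \<open>The columns are the values on the axes; at s = 0, where linearity comes from the
    initial datum, the same formula gives lam0 Dm.\<close>
  define B where "B s = (\<chi> i j. w (axis j 1) s $ i)" for s
  have wB: "w x s = B s *v x" if "0 \<le> s" "s < S0" for x s
  proof (cases "s = 0")
    case True
    moreover have "B 0 = lam0 *\<^sub>R Dm"
      by (simp add: B_def ini vec_eq_iff matrix_vector_mult_basis column_def)
    ultimately show ?thesis by (simp add: ini)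
  next
    case False
    then have "linear (\<lambda>x. w x s)" using lin that by simp
    from fun_cong[OF matrix_vector_mul(2)[OF this], of x] have "matrix (\<lambda>x. w x s) *v x = w x s" .
    then show ?thesis by (simp add: B_def matrix_def)
  qed
  have cB: "continuous_on {0..<S0} B"
    unfolding B_def by (intro continuous_intros slab.cont_comp) auto
  interpret lin: linear_euler_slab w q S0 C Dv v_t D\<pi> D2\<pi> \<Omega> B p
    using wB cB Pi by unfold_locales (auto intro: continuous_on_subset)
  have "B t = l t *\<^sub>R Dm"
  proof (rule riccati_unique[OF t(1)])
    show "continuous_on {0..t} B" using cB by (rule continuous_on_subset) (use S0' in auto)
    show "continuous_on {0..t} (\<lambda>t. l t *\<^sub>R Dm)"
      using t(3) by (intro continuous_intros l_continuous_comp) auto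
    show "B 0 = l 0 *\<^sub>R Dm"
      by (simp add: B_def ini vec_eq_iff matrix_vector_mult_basis column_def lamf_def)
    fix s assume s: "0 < s" "s < t"
    show "(B has_vector_derivative riccati_rhs (B s)) (at s)"
      using lin.B_ode[of s] s S0'
      by (intro has_vector_derivative_vec_lambda)
        (simp add: riccati_rhs_def has_real_derivative_iff_has_vector_derivative)
    have "((\<lambda>t. l t *\<^sub>R Dm) has_vector_derivative (l s *\<^sub>R 0 + (l s)\<^sup>2 *\<^sub>R Dm)) (at s)"
      using s t(3) by (intro has_vector_derivative_scaleR l_deriv has_vector_derivative_const) auto
    then show "((\<lambda>t. l t *\<^sub>R Dm) has_vector_derivative riccati_rhs (l s *\<^sub>R Dm)) (at s)"
      by (simp add: riccati_rhs_Dm)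
  qed
  then show ?thesis using wB[OF t(1) S0'(1)] by (simp add: vsol_def)
qed

text \<open>A solution living beyond 1 / lam0 would be continuous in time, hence bounded, up to and
  including 1 / lam0 at the fixed point \<open>axis 1 1\<close>; before that time its first
  component there is l, which is unbounded.\<close>

lemma euler_solution_time_le:
  assumes sol: "euler_solution p (\<lambda>x. vsol x 0) S w q"
  shows "S \<le> ereal (1 / lam0)"
proof (rule ccontr)
  assume "\<not> ?thesis"
  then have S: "ereal (1 / lam0) < S" by simp
  let ?f = "\<lambda>t. w (axis 1 1) t $ 1"
  have lt: "ereal t < S" if "t \<le> 1 / lam0" for t using that S by (meson ereal_less_eq(3) order_le_less_trans)
  have cw: "continuous_on (UNIV \<times> {t. 0 \<le> t \<and> ereal t < S}) (\<lambda>(x, t). w x t)"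
    using sol by (simp add: euler_solution_def)
  have "continuous_on {0..1 / lam0} (\<lambda>t. (\<lambda>(x, t). w x t) (axis 1 1, t))"
    by (rule continuous_on_compose2[OF cw]) (use lt in \<open>auto intro!: continuous_intros\<close>)
  then have "continuous_on {0..1 / lam0} ?f" by (auto intro!: continuous_intros)
  then have "bounded (?f ` {0..1 / lam0})" by (intro compact_imp_bounded compact_continuous_image compact_Icc)
  then obtain M where M: "\<forall>y\<in>?f ` {0..1 / lam0}. norm y \<le> M" unfolding bounded_iff by blast
  have "\<forall>\<^sub>F t in at_left (1 / lam0). M + 1 \<le> l t"
    using l_at_top by (simp add: filterlim_at_top)
  moreover have "\<forall>\<^sub>F t in at_left (1 / lam0). 0 < t \<and> t < 1 / lam0"
    using lam0 by (auto simp: eventually_at_left_field intro!: exI[of _ 0])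
  ultimately have "\<forall>\<^sub>F t in at_left (1 / lam0). M + 1 \<le> l t \<and> 0 < t \<and> t < 1 / lam0"
    by eventually_elim blast
  then obtain t where t: "M + 1 \<le> l t" "0 < t" "t < 1 / lam0"
    using eventually_happens' trivial_limit_at_left_real by blast
  have "w (axis 1 1) t = vsol (axis 1 1) t"
    using t lt by (intro euler_solution_eq_vsol[OF sol]) auto
  then have "?f t = l t" by (simp add: vsol_component Dm_mult axis_def)
  moreover have "norm (?f t) \<le> M" using M t by auto
  ultimately show False using t l_pos[of t] by simp
qed

lemma max_existence_time_vsol:
  assumes "0 < p"
  shows "max_existence_time p (\<lambda>x. vsol x 0) = ereal (1 / lam0)"
  unfolding max_existence_time_def
proof (rule antisym)
  show "Sup {T. 0 < T \<and> (\<exists>v \<pi>. euler_solution p (\<lambda>x. vsol x 0) T v \<pi>)} \<le> ereal (1 / lam0)"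
    by (rule Sup_least) (auto dest: euler_solution_time_le)
  show "ereal (1 / lam0) \<le> Sup {T. 0 < T \<and> (\<exists>v \<pi>. euler_solution p (\<lambda>x. vsol x 0) T v \<pi>)}"
    by (rule Sup_upper) (use euler_solution_vsol[OF assms] lam0 in auto)
qed

end

theorem mainTheorem7:
  fixes p lam0 :: real and v0 :: "real^3 \<Rightarrow> real^3"
  assumes "1 < p" and "0 < lam0"
    and "v0 = (\<lambda>x. lam0 *\<^sub>R vector [x $ 1, x $ 2, - 2 * x $ 3])"
  shows "v0 \<in> L_vec_space p \<and> divergence_free v0 \<and> v0 0 = 0 \<and>
    (\<exists>T v \<pi> (\<Lambda> :: real \<Rightarrow> real^3) (lam :: real \<Rightarrow> real).
       T = 1 / lam0 \<and>
       max_existence_time p v0 = ereal T \<and>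
       euler_solution p v0 (ereal T) v \<pi> \<and>
       (\<forall>S w q. 0 < S \<and> euler_solution p v0 S w q \<longrightarrow>
          S \<le> ereal T \<and> (\<forall>x t. 0 \<le> t \<and> ereal t < S \<longrightarrow> w x t = v x t)) \<and>
       (\<forall>x. \<forall>t\<in>{0..<T}. v x t = (\<chi> i. \<Lambda> t $ i * x $ i)) \<and>
       (\<forall>i. \<forall>t\<in>{0<..<T}. \<exists>d. ((\<lambda>s. \<Lambda> s $ i) has_real_derivative d) (at t) \<and>
          d + (\<Lambda> t $ i)\<^sup>2 = 1 / 3 * (norm (\<Lambda> t))\<^sup>2) \<and>
       (\<forall>t\<in>{0..<T}. \<Lambda> t $ 1 = lam t \<and> \<Lambda> t $ 2 = lam t \<and> \<Lambda> t $ 3 = - 2 * lam t) \<and>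
       continuous_on {0..<T} lam \<and> lam 0 = lam0 \<and>
       (\<forall>t\<in>{0<..<T}. (lam has_real_derivative (lam t)\<^sup>2) (at t)) \<and>
       (\<forall>\<mu>. continuous_on {0..<T} \<mu> \<and> \<mu> 0 = lam0 \<and>
          (\<forall>t\<in>{0<..<T}. (\<mu> has_real_derivative (\<mu> t)\<^sup>2) (at t)) \<longrightarrow>
          (\<forall>t\<in>{0..<T}. \<mu> t = lam t)) \<and>
       (\<forall>t\<in>{0..<T}. lam t = lam0 / (1 - lam0 * t)) \<and>
       ((\<lambda>t. L_vec_norm p (\<lambda>x. v x t)) \<longlongrightarrow> \<infinity>) (at_left T))"
proof -
  note lam0 = \<open>0 < lam0\<close>
  have p: "0 < p" using \<open>1 < p\<close> by simp
  let ?T = "1 / lam0" and ?v = "vsol lam0" and ?l = "lamf lam0"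
  define \<Lambda> where "\<Lambda> t = ?l t *\<^sub>R (vector [1, 1, - 2] :: real^3)" for t
  have v0: "v0 = (\<lambda>x. ?v x 0)"
    unfolding assms(3) vsol_def[OF lam0]
    by (simp add: lamf_def scaleR_mult_vec Dm_mult fun_eq_iff vec_eq_iff forall_3)
  have v0_lin: "v0 = (\<lambda>x. (?l 0 *\<^sub>R Dm) *v x)" by (simp add: v0 vsol_def[OF lam0])
  have c: "continuous_on {0..<?T} ?l" by (rule continuous_on_subset[OF l_continuous[OF lam0]]) auto
  have norm_\<Lambda>: "(norm (\<Lambda> t))\<^sup>2 = 6 * (?l t)\<^sup>2" for t
    unfolding power2_norm_eq_inner \<Lambda>_def inner_vec_def sum_3 by (simp add: power2_eq_square)
  have ode: "\<exists>d. ((\<lambda>s. \<Lambda> s $ i) has_real_derivative d) (at t) \<and> d + (\<Lambda> t $ i)\<^sup>2 = 1 / 3 * (norm (\<Lambda> t))\<^sup>2"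
    if t: "t \<in> {0<..<?T}" for i t
  proof (intro exI conjI)
    have "t < ?T" using t by simp
    show "((\<lambda>s. \<Lambda> s $ i) has_real_derivative (?l t)\<^sup>2 * (vector [1, 1, - 2] :: real^3) $ i) (at t)"
      unfolding \<Lambda>_def vector_scaleR_component real_scaleR_def
      by (rule DERIV_cmult_right[OF l_deriv[OF lam0 \<open>t < ?T\<close>]])
    \<comment> \<open>The entries 1 and -2 are the roots of c + c^2 = 2, and 2 is a third of |(1, 1,
      -2)|^2 = 6; this makes the three component equations one and the same equation lambda' =
      lambda^2.\<close>
    have "\<forall>i. (vector [1, 1, - 2] :: real^3) $ i + ((vector [1, 1, - 2] :: real^3) $ i)\<^sup>2 = 2"
      by (simp add: forall_3)
    then have "(?l t)\<^sup>2 * ((vector [1, 1, - 2] :: real^3) $ i + ((vector [1, 1, - 2] :: real^3) $ i)\<^sup>2) = (?l t)\<^sup>2 * 2"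
      by metis
    then have "(?l t)\<^sup>2 * (vector [1, 1, - 2] :: real^3) $ i + (?l t)\<^sup>2 * ((vector [1, 1, - 2] :: real^3) $ i)\<^sup>2 = 2 * (?l t)\<^sup>2"
      by (simp only: distrib_left mult.commute)
    then show "(?l t)\<^sup>2 * (vector [1, 1, - 2] :: real^3) $ i + (\<Lambda> t $ i)\<^sup>2 = 1 / 3 * (norm (\<Lambda> t))\<^sup>2"
      unfolding norm_\<Lambda> by (simp only: \<Lambda>_def vector_scaleR_component real_scaleR_def power_mult_distrib)
  qed
  have uniq: "S \<le> ereal ?T \<and> (\<forall>x t. 0 \<le> t \<and> ereal t < S \<longrightarrow> w x t = ?v x t)" if "euler_solution p v0 S w q" for S w q
  proof -
    have S: "S \<le> ereal ?T" using euler_solution_time_le[OF lam0] that v0 by blast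
    moreover have "w x t = ?v x t" if "0 \<le> t" "ereal t < S" for x t
    proof -
      have "ereal t < ereal ?T" using that S by (rule_tac order_less_le_trans)
      then show ?thesis
        using euler_solution_eq_vsol[OF lam0] that \<open>euler_solution p v0 S w q\<close> v0 by simp
    qed
    ultimately show ?thesis by blast
  qed
  have scalar: "\<mu> t = ?l t"
    if \<mu>: "continuous_on {0..<?T} \<mu>" "\<mu> 0 = lam0" "\<forall>t\<in>{0<..<?T}. (\<mu> has_real_derivative (\<mu> t)\<^sup>2) (at t)"
      and t: "t \<in> {0..<?T}" for \<mu> t
  proof (rule riccati_scalar_unique[of t \<mu> ?l])
    show "continuous_on {0..t} \<mu>" "continuous_on {0..t} ?l"
      using \<mu>(1) c t by (auto intro: continuous_on_subset)
    show "\<mu> 0 = ?l 0" using \<mu>(2) by (simp add: lamf_def)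
  qed (use \<mu>(3) t l_deriv[OF lam0] in auto)
  show ?thesis
  proof (intro conjI exI)
    show "v0 \<in> L_vec_space p" unfolding v0_lin by (rule L_vec_space_linear[OF p])
    show "divergence_free v0"
      unfolding v0_lin by (rule divergence_free_linear) (simp add: trace_scaleR Dm_facts)
    show "v0 0 = 0" by (simp add: v0_lin)
    show "?T = 1 / lam0" by simp
    show "max_existence_time p v0 = ereal ?T" unfolding v0 by (rule max_existence_time_vsol[OF lam0 p])
    show "euler_solution p v0 (ereal ?T) ?v (psol lam0)" unfolding v0 by (rule euler_solution_vsol[OF lam0 p])
    show "\<forall>S w q. 0 < S \<and> euler_solution p v0 S w q \<longrightarrow>
        S \<le> ereal ?T \<and> (\<forall>x t. 0 \<le> t \<and> ereal t < S \<longrightarrow> w x t = ?v x t)" using uniq by blast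
    show "\<forall>x. \<forall>t\<in>{0..<?T}. ?v x t = (\<chi> i. \<Lambda> t $ i * x $ i)"
      by (simp add: vsol_def[OF lam0] scaleR_mult_vec Dm_mult \<Lambda>_def vec_eq_iff)
    show "\<forall>i. \<forall>t\<in>{0<..<?T}. \<exists>d. ((\<lambda>s. \<Lambda> s $ i) has_real_derivative d) (at t) \<and>
        d + (\<Lambda> t $ i)\<^sup>2 = 1 / 3 * (norm (\<Lambda> t))\<^sup>2" using ode by blast
    show "\<forall>t\<in>{0..<?T}. \<Lambda> t $ 1 = ?l t \<and> \<Lambda> t $ 2 = ?l t \<and> \<Lambda> t $ 3 = - 2 * ?l t"
      by (simp add: \<Lambda>_def)
    show "continuous_on {0..<?T} ?l" by (rule c)
    show "?l 0 = lam0" by (simp add: lamf_def)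
    show "\<forall>t\<in>{0<..<?T}. (?l has_real_derivative (?l t)\<^sup>2) (at t)" using l_deriv[OF lam0] by simp
    show "\<forall>\<mu>. continuous_on {0..<?T} \<mu> \<and> \<mu> 0 = lam0 \<and>
        (\<forall>t\<in>{0<..<?T}. (\<mu> has_real_derivative (\<mu> t)\<^sup>2) (at t)) \<longrightarrow> (\<forall>t\<in>{0..<?T}. \<mu> t = ?l t)"
      using scalar by blast
    show "\<forall>t\<in>{0..<?T}. ?l t = lam0 / (1 - lam0 * t)" by (simp add: lamf_def)
    show "((\<lambda>t. L_vec_norm p (\<lambda>x. ?v x t)) \<longlongrightarrow> \<infinity>) (at_left ?T)"
      by (rule L_vec_norm_vsol_blowup[OF lam0 p])
  qed
qed

end
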